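(* Let $N\in\mathbb{N}$ and let $\sigma\in M_N(\{\pm1\})$ be given by $\sigma_{ij}=-1$ for $i<j$ and $\sigma_{ij}=+1$ for $i\ge j$. Let $\times\in\mathscr{P}(2,2)$ have blocks $\{1,2'\},\{2,1'\}$ and let $b_{2,2}\in\mathscr{P}(2,2)$ have the single block $\{1,2,1',2'\}$. Let $h\in\mathscr{P}(3,3)$ have blocks $\{1,3'\},\{2,2'\},\{3,1'\}$, let $h_1,h_2,h_3$ be the three partitions obtained from $h$ by uniting two of its three blocks, and let $b_{3,3}\in\mathscr{P}(3,3)$ be the partition with a single block. Then the non-easy linear categories of partitions $$\mathscr{K}_1=\langle\times-2b_{2,2}\rangle_N,\qquad \mathscr{K}_2=\langle h-2h_1-2h_2-2h_3+4b_{3,3}\rangle_N$$ correspond to the quantum groups $O_N^{-1}=O_N^\sigma$ and $O_N^{*\,-1}=O_N^{*\,\sigma}$, respectively; that is, for all $k,l\in\mathbb{N}_0$, $\operatorname{Mor}(\hat u^{\otimes k},\hat u^{\otimes l})=\{T_p\mid p\in\mathscr{K}_1(k,l)\}$ for the fundamental representation $\hat u$ of $O_N^\sigma$, and $\operatorname{Mor}(\hat u^{\otimes k},\hat u^{\otimes l})=\{T_p\mid p\in\mathscr{K}_2(k,l)\}$ for the fundamental representation $\hat u$ of $O_N^{*\,\sigma}$.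
   Context: Partitions. For $k,l\in\mathbb{N}_0$ let $\mathscr{P}(k,l)$ be the set of set partitions of $k$ upper points $1,\dots,k$ and $l$ lower points $1',\dots,l'$. For $\delta\in\mathbb{C}$, $\mathbf{Part}_\delta(k,l)$ is the complex vector space with basis $\mathscr{P}(k,l)$. Category operations: tensor product (side by side, bilinear); composition $qp=\delta^c r$ for $p\in\mathscr{P}(k,l),q\in\mathscr{P}(l,m)$, where the lower points of $p$ are identified with the upper points of $q$, $r\in\mathscr{P}(k,m)$ is the induced partition and $c$ is the number of connected components consisting only of middle points (bilinear); involution $p^*$ (interchange upper and lower rows, antilinear). A linear category of partitions is a collection of subspaces $\mathscr{K}(k,l)\subseteq\mathbf{Part}_\delta(k,l)$ closed under these operations and containing $\{1,1'\}\in\mathscr{P}(1,1)$ and $\{1',2'\}\in\mathscr{P}(0,2)$; $\langle p_1,\dots,p_n\rangle_\delta$ is the smallest one containing $p_1,\dots,p_n$. It is easy if every $\mathscr{K}(k,l)$ is spanned by a set of partitions, and non-easy otherwise. For $\delta=N$ and $p\in\mathscr{P}(k,l)$ let $T_p:(\mathbb{C}^N)^{\otimes k}\to(\mathbb{C}^N)^{\otimes l}$ have entries $[T_p]_{\mathbf{i}\mathbf{j}}=1$ if labelling the upper points by $\mathbf{j}=(j_1,\dots,j_k)$ and the lower points by $\mathbf{i}=(i_1,\dots,i_l)$ is constant on each block of $p$, and $0$ otherwise; extend linearly to $\mathbf{Part}_N(k,l)$. Quantum groups. $O_N$: $\operatorname{Pol}O_N$ is the universal commutative $*$-algebra generated by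 self-adjoint $u_{ij}$, $1\le i,j\le N$, with $u=(u_{ij})$ orthogonal ($uu^t=u^tu=1$). $O_N^*$: $\operatorname{Pol}O_N^*$ is the universal $*$-algebra generated by self-adjoint $u_{ij}$ with $u$ orthogonal and $abc=cba$ for all $a,b,c\in\{u_{ij}\}$. Both are Hopf $*$-algebras with $\Delta(u_{ij})=\sum_k u_{ik}\otimes u_{kj}$. Twist. Let $G$ be $O_N$ or $O_N^*$ and $q:\operatorname{Pol}G\to\mathbb{C}\mathbb{Z}_2^N$, $u_{ij}\mapsto\delta_{ij}t_i$, where $t_1,\dots,t_N$ are the canonical generators of $\mathbb{Z}_2^N$. The matrix $\sigma$ determines a unique bicharacter on $\mathbb{Z}_2^N$ with $(t_i,t_j)\mapsto\sigma_{ij}$; extended bilinearly to $\mathbb{C}\mathbb{Z}_2^N$ and composed with $q\otimes q$ it gives a unitary 2-cocycle on $\operatorname{Pol}G$, again denoted $\sigma$, with convolution inverse $\sigma^{-1}$. $G^\sigma$ is the compact quantum group for which $\operatorname{Pol}G^\sigma$ equals $\operatorname{Pol}G$ as a coalgebra (with $\hat x$ denoting $x$ viewed in $\operatorname{Pol}G^\sigma$) and, in Sweedler notation, $\hat x\hat y=\sigma(x_{(1)},y_{(1)})\sigma^{-1}(x_{(3)},y_{(3)})\widehat{x_{(2)}y_{(2)}}$ and $\hat x^*=\sigma(S(x_{(5)})^*,x_{(4)}^* )\,\sigma^{-1}(x_{(2)}^*,S(x_{(1)})^* )\,\widehat{x_{(3)}^*}$. Its fundamental representation is $\hat u=(\hat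 u_{ij})$, and $\operatorname{Mor}(\hat u^{\otimes k},\hat u^{\otimes l})=\{T:(\mathbb{C}^N)^{\otimes k}\to(\mathbb{C}^N)^{\otimes l}\mid T\hat u^{\otimes k}=\hat u^{\otimes l}T\}$, where $[\hat u^{\otimes k}]_{\mathbf{i}\mathbf{j}}=\hat u_{i_1j_1}\cdots\hat u_{i_kj_k}$. For this $\sigma$, $O_N^\sigma$ and $O_N^{*\,\sigma}$ are denoted $O_N^{-1}$, $O_N^{*\,-1}$. *)

theory Defs
  imports
    Complex_Main
    "HOL-Library.Poly_Mapping"
    "HOL-Library.Z2"
    "HOL-Library.Product_Plus"
    "HOL-Library.Disjoint_Sets"
    "HOL-Algebra.QuotRing"
    "HOL-Algebra.Module"
begin

section \<open>Free complex vector spaces\<close>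

text \<open>\<^typ>\<open>'a \<Rightarrow>\<^sub>0 complex\<close> is the complex vector space with basis \<^typ>\<open>'a\<close>; the basis vector at \<open>x\<close>
  is \<open>basis_vec x\<close>.  Elements of algebraic tensor products are represented by formal linear
  combinations of tuples.\<close>

abbreviation basis_vec :: "'a \<Rightarrow> ('a \<Rightarrow>\<^sub>0 complex)"
  where "basis_vec x \<equiv> Poly_Mapping.single x 1"

definition vscale :: "complex \<Rightarrow> ('a \<Rightarrow>\<^sub>0 complex) \<Rightarrow> ('a \<Rightarrow>\<^sub>0 complex)"
  where "vscale c f = Poly_Mapping.map ((*) c) f"

definition lin_ext :: "('a \<Rightarrow> ('b \<Rightarrow>\<^sub>0 complex)) \<Rightarrow> ('a \<Rightarrow>\<^sub>0 complex) \<Rightarrow> ('b \<Rightarrow>\<^sub>0 complex)"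
  where "lin_ext \<phi> f = (\<Sum>x\<in>Poly_Mapping.keys f. vscale (Poly_Mapping.lookup f x) (\<phi> x))"

definition antilin_ext :: "('a \<Rightarrow> ('b \<Rightarrow>\<^sub>0 complex)) \<Rightarrow> ('a \<Rightarrow>\<^sub>0 complex) \<Rightarrow> ('b \<Rightarrow>\<^sub>0 complex)"
  where "antilin_ext \<phi> f =
    (\<Sum>x\<in>Poly_Mapping.keys f. vscale (cnj (Poly_Mapping.lookup f x)) (\<phi> x))"

lemma lookup_vscale [simp]: "Poly_Mapping.lookup (vscale c f) x = c * Poly_Mapping.lookup f x"
  unfolding vscale_def by (simp add: Poly_Mapping.map.rep_eq when_def)

interpretation free_vs: vector_space vscale
  by unfold_locales (auto intro!: poly_mapping_eqI simp: lookup_add algebra_simps)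


section \<open>Linear categories of partitions\<close>

text \<open>The upper point \<open>i\<close> is \<open>Inl i\<close>, the lower point \<open>i'\<close> is \<open>Inr i\<close>.\<close>

type_synonym part = "(nat + nat) set set"

definition partitions :: "nat \<Rightarrow> nat \<Rightarrow> part set"
  where "partitions k l = {p. partition_on ({1..k} <+> {1..l}) p}"

definition Part :: "nat \<Rightarrow> nat \<Rightarrow> (part \<Rightarrow>\<^sub>0 complex) set"
  where "Part k l = {f. Poly_Mapping.keys f \<subseteq> partitions k l}"

definition part_tensor :: "nat \<Rightarrow> nat \<Rightarrow> part \<Rightarrow> part \<Rightarrow> part"
  where "part_tensor k l p q = p \<union> (`) (map_sum (\<lambda>i. i + k) (\<lambda>i. i + l)) ` q"

datatype row_point = Up nat | Mid nat | Low nat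

text \<open>For \<open>p \<in> partitions k l\<close> and \<open>q \<in> partitions l m\<close>: the connected components of the diagram
  in which the lower row of \<open>p\<close> is glued to the upper row of \<open>q\<close>.\<close>

definition glued_blocks :: "part \<Rightarrow> part \<Rightarrow> row_point set set"
  where "glued_blocks p q = (`) (case_sum Up Mid) ` p \<union> (`) (case_sum Mid Low) ` q"

definition glued_components :: "part \<Rightarrow> part \<Rightarrow> row_point set set"
  where "glued_components p q =
    \<Union>(glued_blocks p q) // {(x, y). \<exists>B\<in>glued_blocks p q. x \<in> B \<and> y \<in> B}\<^sup>+"

definition outer_points :: "row_point set \<Rightarrow> (nat + nat) set"
  where "outer_points C = {Inl i |i. Up i \<in> C} \<union> {Inr i |i. Low i \<in> C}"

definition part_comp :: "part \<Rightarrow> part \<Rightarrow> part"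
  where "part_comp q p = outer_points ` glued_components p q - {{}}"

definition loops :: "part \<Rightarrow> part \<Rightarrow> nat"
  where "loops q p = card {C \<in> glued_components p q. C \<subseteq> range Mid}"

definition part_inv :: "part \<Rightarrow> part"
  where "part_inv p = (`) (case_sum Inr Inl) ` p"

definition vec_tensor ::
    "nat \<Rightarrow> nat \<Rightarrow> (part \<Rightarrow>\<^sub>0 complex) \<Rightarrow> (part \<Rightarrow>\<^sub>0 complex) \<Rightarrow> (part \<Rightarrow>\<^sub>0 complex)"
  where "vec_tensor k l f g = lin_ext (\<lambda>p. lin_ext (\<lambda>q. basis_vec (part_tensor k l p q)) g) f"

definition vec_comp ::
    "complex \<Rightarrow> (part \<Rightarrow>\<^sub>0 complex) \<Rightarrow> (part \<Rightarrow>\<^sub>0 complex) \<Rightarrow> (part \<Rightarrow>\<^sub>0 complex)"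
  where "vec_comp \<delta> g f =
    lin_ext (\<lambda>q. lin_ext (\<lambda>p. vscale (\<delta> ^ loops q p) (basis_vec (part_comp q p))) f) g"

definition vec_inv :: "(part \<Rightarrow>\<^sub>0 complex) \<Rightarrow> (part \<Rightarrow>\<^sub>0 complex)"
  where "vec_inv f = antilin_ext (\<lambda>p. basis_vec (part_inv p)) f"

definition linear_category :: "complex \<Rightarrow> (nat \<Rightarrow> nat \<Rightarrow> (part \<Rightarrow>\<^sub>0 complex) set) \<Rightarrow> bool"
  where "linear_category \<delta> K \<longleftrightarrow>
    (\<forall>k l. K k l \<subseteq> Part k l \<and> free_vs.subspace (K k l)) \<and>
    (\<forall>k l k' l' f g. f \<in> K k l \<longrightarrow> g \<in> K k' l' \<longrightarrow> vec_tensor k l f g \<in> K (k + k') (l + l')) \<and>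
    (\<forall>k l m f g. f \<in> K k l \<longrightarrow> g \<in> K l m \<longrightarrow> vec_comp \<delta> g f \<in> K k m) \<and>
    (\<forall>k l f. f \<in> K k l \<longrightarrow> vec_inv f \<in> K l k) \<and>
    basis_vec {{Inl 1, Inr 1}} \<in> K 1 1 \<and>
    basis_vec {{Inr 1, Inr 2}} \<in> K 0 2"

text \<open>The category generated by a set of elements \<open>f \<in> Part k l\<close>, given as triples \<open>(k, l, f)\<close>.\<close>

definition generated_category ::
    "complex \<Rightarrow> (nat \<times> nat \<times> (part \<Rightarrow>\<^sub>0 complex)) set \<Rightarrow> nat \<Rightarrow> nat \<Rightarrow> (part \<Rightarrow>\<^sub>0 complex) set"
  where "generated_category \<delta> G k l =
    \<Inter>{K k l |K. linear_category \<delta> K \<and> (\<forall>(a, b, f)\<in>G. f \<in> K a b)}"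

definition easy :: "(nat \<Rightarrow> nat \<Rightarrow> (part \<Rightarrow>\<^sub>0 complex) set) \<Rightarrow> bool"
  where "easy K \<longleftrightarrow> (\<forall>k l. \<exists>S\<subseteq>partitions k l. K k l = free_vs.span (basis_vec ` S))"

definition part_crossing :: part
  where "part_crossing = {{Inl 1, Inr 2}, {Inl 2, Inr 1}}"

definition part_b22 :: part
  where "part_b22 = {{Inl 1, Inl 2, Inr 1, Inr 2}}"

definition part_h :: part
  where "part_h = {{Inl 1, Inr 3}, {Inl 2, Inr 2}, {Inl 3, Inr 1}}"

definition part_h1 :: part
  where "part_h1 = {{Inl 1, Inr 3}, {Inl 2, Inr 2, Inl 3, Inr 1}}"

definition part_h2 :: part
  where "part_h2 = {{Inl 2, Inr 2}, {Inl 1, Inr 3, Inl 3, Inr 1}}"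

definition part_h3 :: part
  where "part_h3 = {{Inl 3, Inr 1}, {Inl 1, Inr 3, Inl 2, Inr 2}}"

definition part_b33 :: part
  where "part_b33 = {{Inl 1, Inl 2, Inl 3, Inr 1, Inr 2, Inr 3}}"

definition cat_K1 :: "nat \<Rightarrow> nat \<Rightarrow> nat \<Rightarrow> (part \<Rightarrow>\<^sub>0 complex) set"
  where "cat_K1 N = generated_category (of_nat N) {(2, 2, basis_vec part_crossing - vscale 2 (basis_vec part_b22))}"

definition cat_K2 :: "nat \<Rightarrow> nat \<Rightarrow> nat \<Rightarrow> (part \<Rightarrow>\<^sub>0 complex) set"
  where "cat_K2 N = generated_category (of_nat N)
    {(3, 3, basis_vec part_h - vscale 2 (basis_vec part_h1) - vscale 2 (basis_vec part_h2)
            - vscale 2 (basis_vec part_h3) + vscale 4 (basis_vec part_b33))}"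


section \<open>Linear maps between tensor powers\<close>

text \<open>A linear map from the \<open>k\<close>-fold to the \<open>l\<close>-fold tensor power of \<open>\<complex>\<^sup>N\<close> is its matrix \<open>T i j\<close>,
  with row index \<open>i \<in> multi_indices N l\<close> and column index \<open>j \<in> multi_indices N k\<close>, extended
  by zero.\<close>

definition multi_indices :: "nat \<Rightarrow> nat \<Rightarrow> nat list set"
  where "multi_indices N k = {is. length is = k \<and> set is \<subseteq> {1..N}}"

definition lin_maps :: "nat \<Rightarrow> nat \<Rightarrow> nat \<Rightarrow> (nat list \<Rightarrow> nat list \<Rightarrow> complex) set"
  where "lin_maps N k l =
    {T. \<forall>i j. T i j \<noteq> 0 \<longrightarrow> i \<in> multi_indices N l \<and> j \<in> multi_indices N k}"

definition point_label :: "nat list \<Rightarrow> nat list \<Rightarrow> nat + nat \<Rightarrow> nat"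
  where "point_label i j = case_sum (\<lambda>a. j ! (a - 1)) (\<lambda>a. i ! (a - 1))"

definition T_part :: "nat \<Rightarrow> nat \<Rightarrow> nat \<Rightarrow> part \<Rightarrow> nat list \<Rightarrow> nat list \<Rightarrow> complex"
  where "T_part N k l p i j =
    (if i \<in> multi_indices N l \<and> j \<in> multi_indices N k \<and>
        (\<forall>B\<in>p. \<forall>x\<in>B. \<forall>y\<in>B. point_label i j x = point_label i j y)
     then 1 else 0)"

definition T_vec ::
    "nat \<Rightarrow> nat \<Rightarrow> nat \<Rightarrow> (part \<Rightarrow>\<^sub>0 complex) \<Rightarrow> nat list \<Rightarrow> nat list \<Rightarrow> complex"
  where "T_vec N k l f i j =
    (\<Sum>p\<in>Poly_Mapping.keys f. Poly_Mapping.lookup f p * T_part N k l p i j)"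


section \<open>Hopf \<open>*\<close>-algebras and twists\<close>

text \<open>\<open>comult A x\<close> is a formal linear combination of pairs that represents an element of the
  algebraic tensor product of \<open>A\<close> with itself.  It is only ever evaluated in bilinear
  expressions, so the choice of representative is irrelevant.\<close>

record 'a star_bialgebra = "(complex, 'a) module" +
  star :: "'a \<Rightarrow> 'a"
  comult :: "'a \<Rightarrow> ('a \<times> 'a \<Rightarrow>\<^sub>0 complex)"
  counit :: "'a \<Rightarrow> complex"

record 'a hopf_star_algebra = "'a star_bialgebra" +
  antipode :: "'a \<Rightarrow> 'a"

text \<open>The basis elements \<open>a\<close> of \<open>iter_comult A n x\<close> are lists of length \<open>n + 1\<close>; the
  Sweedler factor \<open>x\<^sub>(\<^sub>i\<^sub>)\<close> is \<open>a ! (i - 1)\<close>.\<close>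

primrec iter_comult ::
    "('a, 'm) star_bialgebra_scheme \<Rightarrow> nat \<Rightarrow> 'a \<Rightarrow> ('a list \<Rightarrow>\<^sub>0 complex)"
  where
    "iter_comult A 0 x = basis_vec [x]"
  | "iter_comult A (Suc n) x =
      lin_ext (\<lambda>(a, b). lin_ext (\<lambda>as. basis_vec (a # as)) (iter_comult A n b)) (comult A x)"

definition bilinear_form ::
    "('a, 'm) star_bialgebra_scheme \<Rightarrow> ('a \<Rightarrow> 'a \<Rightarrow> complex) \<Rightarrow> bool"
  where "bilinear_form A \<sigma> \<longleftrightarrow>
    (\<forall>x\<in>carrier A. \<forall>y\<in>carrier A. \<forall>z\<in>carrier A. \<forall>c.
       \<sigma> (x \<oplus>\<^bsub>A\<^esub> y) z = \<sigma> x z + \<sigma> y z \<and> \<sigma> (c \<odot>\<^bsub>A\<^esub> x) z = c * \<sigma> x z \<and>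
       \<sigma> z (x \<oplus>\<^bsub>A\<^esub> y) = \<sigma> z x + \<sigma> z y \<and> \<sigma> z (c \<odot>\<^bsub>A\<^esub> x) = c * \<sigma> z x)"

text \<open>\<open>convolution A \<sigma> \<tau> x y = \<sigma>(x\<^sub>(\<^sub>1\<^sub>), y\<^sub>(\<^sub>1\<^sub>)) \<tau>(x\<^sub>(\<^sub>2\<^sub>), y\<^sub>(\<^sub>2\<^sub>))\<close>; its unit is \<open>\<epsilon> \<otimes> \<epsilon>\<close>.\<close>

definition convolution ::
    "('a, 'm) star_bialgebra_scheme \<Rightarrow> ('a \<Rightarrow> 'a \<Rightarrow> complex) \<Rightarrow> ('a \<Rightarrow> 'a \<Rightarrow> complex)
      \<Rightarrow> 'a \<Rightarrow> 'a \<Rightarrow> complex"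
  where "convolution A \<sigma> \<tau> x y =
    (\<Sum>(x1, x2)\<in>Poly_Mapping.keys (comult A x). \<Sum>(y1, y2)\<in>Poly_Mapping.keys (comult A y).
       Poly_Mapping.lookup (comult A x) (x1, x2) * Poly_Mapping.lookup (comult A y) (y1, y2) *
       \<sigma> x1 y1 * \<tau> x2 y2)"

text \<open>The inverse is unique on \<open>carrier A\<close>.\<close>

definition conv_inverse ::
    "('a, 'm) star_bialgebra_scheme \<Rightarrow> ('a \<Rightarrow> 'a \<Rightarrow> complex) \<Rightarrow> ('a \<Rightarrow> 'a \<Rightarrow> complex)"
  where "conv_inverse A \<sigma> = (SOME \<tau>. bilinear_form A \<tau> \<and>
    (\<forall>x\<in>carrier A. \<forall>y\<in>carrier A.
       convolution A \<sigma> \<tau> x y = counit A x * counit A y \<and>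
       convolution A \<tau> \<sigma> x y = counit A x * counit A y))"

definition twist_mult ::
    "'a hopf_star_algebra \<Rightarrow> ('a \<Rightarrow> 'a \<Rightarrow> complex) \<Rightarrow> 'a \<Rightarrow> 'a \<Rightarrow> 'a"
  where "twist_mult A \<sigma> x y =
    (\<Oplus>\<^bsub>A\<^esub>a\<in>Poly_Mapping.keys (iter_comult A 2 x). \<Oplus>\<^bsub>A\<^esub>b\<in>Poly_Mapping.keys (iter_comult A 2 y).
       (Poly_Mapping.lookup (iter_comult A 2 x) a * Poly_Mapping.lookup (iter_comult A 2 y) b *
        \<sigma> (a ! 0) (b ! 0) * conv_inverse A \<sigma> (a ! 2) (b ! 2)) \<odot>\<^bsub>A\<^esub> (a ! 1 \<otimes>\<^bsub>A\<^esub> b ! 1))"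

text \<open>The coefficients are conjugated because each of the five Sweedler factors enters
  antilinearly.\<close>

definition twist_star ::
    "'a hopf_star_algebra \<Rightarrow> ('a \<Rightarrow> 'a \<Rightarrow> complex) \<Rightarrow> 'a \<Rightarrow> 'a"
  where "twist_star A \<sigma> x =
    (\<Oplus>\<^bsub>A\<^esub>a\<in>Poly_Mapping.keys (iter_comult A 4 x).
       (cnj (Poly_Mapping.lookup (iter_comult A 4 x) a) *
        \<sigma> (star A (antipode A (a ! 4))) (star A (a ! 3)) *
        conv_inverse A \<sigma> (star A (a ! 1)) (star A (antipode A (a ! 0)))) \<odot>\<^bsub>A\<^esub> star A (a ! 2))"

definition twist :: "'a hopf_star_algebra \<Rightarrow> ('a \<Rightarrow> 'a \<Rightarrow> complex) \<Rightarrow> 'a star_bialgebra"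
  where "twist A \<sigma> =
    \<lparr>carrier = carrier A, mult = twist_mult A \<sigma>, one = one A, zero = zero A, add = add A,
     smult = smult A, star = twist_star A \<sigma>, comult = comult A, counit = counit A\<rparr>"


section \<open>The free \<open>*\<close>-algebra on the symbols \<open>u\<^sub>i\<^sub>j\<close> and its quotients\<close>

datatype 'a free_mon = Word (letters: "'a list")

instantiation free_mon :: (type) monoid_add
begin

definition zero_free_mon :: "'a free_mon"
  where "0 = Word []"

definition plus_free_mon :: "'a free_mon \<Rightarrow> 'a free_mon \<Rightarrow> 'a free_mon"
  where "v + w = Word (letters v @ letters w)"

instance
  by standard (auto simp: zero_free_mon_def plus_free_mon_def)

end

text \<open>Monoid algebras: the free algebra \<open>F\<close> on the \<open>u\<^sub>i\<^sub>j\<close>, and \<open>F \<otimes> F\<close> (the monoid algebra of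
  the product monoid), both with multiplication \<open>(*)\<close> from the library.\<close>

type_synonym free_alg = "(nat \<times> nat) free_mon \<Rightarrow>\<^sub>0 complex"
type_synonym free_alg2 = "(nat \<times> nat) free_mon \<times> (nat \<times> nat) free_mon \<Rightarrow>\<^sub>0 complex"

definition u_gen :: "nat \<Rightarrow> nat \<Rightarrow> free_alg"
  where "u_gen i j = basis_vec (Word [(i, j)])"

definition free_ring :: "nat \<Rightarrow> free_alg ring"
  where "free_ring N =
    \<lparr>carrier = {f. \<forall>w\<in>Poly_Mapping.keys f. set (letters w) \<subseteq> {1..N} \<times> {1..N}},
     mult = (*), one = 1, zero = 0, add = (+)\<rparr>"

definition hom_ext ::
    "(nat \<times> nat \<Rightarrow> ('b::monoid_add \<Rightarrow>\<^sub>0 complex)) \<Rightarrow> free_alg \<Rightarrow> ('b \<Rightarrow>\<^sub>0 complex)"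
  where "hom_ext \<phi> = lin_ext (\<lambda>w. prod_list (map \<phi> (letters w)))"

definition free_star :: "free_alg \<Rightarrow> free_alg"
  where "free_star = antilin_ext (\<lambda>w. basis_vec (Word (rev (letters w))))"

definition free_comult :: "nat \<Rightarrow> free_alg \<Rightarrow> free_alg2"
  where "free_comult N =
    hom_ext (\<lambda>(i, j). \<Sum>k=1..N. basis_vec (Word [(i, k)], Word [(k, j)]))"

definition free_counit :: "free_alg \<Rightarrow> complex"
  where "free_counit f =
    (\<Sum>w\<in>Poly_Mapping.keys f. Poly_Mapping.lookup f w *
       prod_list (map (\<lambda>(i, j). if i = j then 1 else 0) (letters w)))"

text \<open>\<open>S(u\<^sub>i\<^sub>j) = u\<^sub>j\<^sub>i\<close>, extended antimultiplicatively.\<close>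

definition free_antipode :: "free_alg \<Rightarrow> free_alg"
  where "free_antipode = lin_ext (\<lambda>w. basis_vec (Word (rev (map prod.swap (letters w)))))"

text \<open>The ideal of the universal \<open>*\<close>-algebra with self-adjoint generators \<open>u\<^sub>i\<^sub>j\<close>, \<open>1 \<le> i, j \<le> N\<close>,
  and relations \<open>r = 0\<close>, \<open>r \<in> R\<close>.\<close>

definition rel_ideal :: "nat \<Rightarrow> free_alg set \<Rightarrow> free_alg set"
  where "rel_ideal N R = Idl\<^bsub>free_ring N\<^esub> (R \<union> free_star ` R)"

definition coset :: "nat \<Rightarrow> free_alg set \<Rightarrow> free_alg \<Rightarrow> free_alg set"
  where "coset N R f = rel_ideal N R +>\<^bsub>free_ring N\<^esub> f"

definition some_rep :: "free_alg set \<Rightarrow> free_alg"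
  where "some_rep X = (SOME f. f \<in> X)"

text \<open>For the relations considered below, the structure maps of the free algebra descend to the
  quotient, so the choice of \<open>some_rep X\<close> is irrelevant.\<close>

definition universal_algebra :: "nat \<Rightarrow> free_alg set \<Rightarrow> free_alg set hopf_star_algebra"
  where "universal_algebra N R = (let Q = free_ring N Quot rel_ideal N R in
    \<lparr>carrier = carrier Q, mult = mult Q, one = one Q, zero = zero Q, add = add Q,
     smult = (\<lambda>c X. coset N R (vscale c (some_rep X))),
     star = (\<lambda>X. coset N R (free_star (some_rep X))),
     comult = (\<lambda>X. lin_ext
       (\<lambda>(v, w). basis_vec (coset N R (basis_vec v), coset N R (basis_vec w)))
       (free_comult N (some_rep X))),
     counit = (\<lambda>X. free_counit (some_rep X)),
     antipode = (\<lambda>X. coset N R (free_antipode (some_rep X)))\<rparr>)"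

definition orthogonality :: "nat \<Rightarrow> free_alg set"
  where "orthogonality N =
    {(\<Sum>k=1..N. u_gen i k * u_gen j k) - (if i = j then 1 else 0) |i j. i \<in> {1..N} \<and> j \<in> {1..N}} \<union>
    {(\<Sum>k=1..N. u_gen k i * u_gen k j) - (if i = j then 1 else 0) |i j. i \<in> {1..N} \<and> j \<in> {1..N}}"

definition O_rel :: "nat \<Rightarrow> free_alg set"
  where "O_rel N = orthogonality N \<union>
    {a * b - b * a |a b. a \<in> carrier (free_ring N) \<and> b \<in> carrier (free_ring N)}"

definition O_star_rel :: "nat \<Rightarrow> free_alg set"
  where "O_star_rel N = orthogonality N \<union>
    {a * b * c - c * b * a |a b c. {a, b, c} \<subseteq> {u_gen i j |i j. i \<in> {1..N} \<and> j \<in> {1..N}}}"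

definition Pol_O :: "nat \<Rightarrow> free_alg set hopf_star_algebra"
  where "Pol_O N = universal_algebra N (O_rel N)"

definition Pol_O_star :: "nat \<Rightarrow> free_alg set hopf_star_algebra"
  where "Pol_O_star N = universal_algebra N (O_star_rel N)"

definition u_O :: "nat \<Rightarrow> nat \<Rightarrow> nat \<Rightarrow> free_alg set"
  where "u_O N i j = coset N (O_rel N) (u_gen i j)"

definition u_O_star :: "nat \<Rightarrow> nat \<Rightarrow> nat \<Rightarrow> free_alg set"
  where "u_O_star N i j = coset N (O_star_rel N) (u_gen i j)"


section \<open>The bicharacter cocycle\<close>

text \<open>\<open>\<int>\<^sub>2\<^sup>N\<close> consists of the \<open>g :: nat \<Rightarrow>\<^sub>0 bit\<close> supported in \<open>{1..N}\<close>, written additively, with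
  generators \<open>z2_gen i\<close>.  Its group algebra sits inside the group algebra of all \<^typ>\<open>nat \<Rightarrow>\<^sub>0 bit\<close>.\<close>

definition z2_gen :: "nat \<Rightarrow> (nat \<Rightarrow>\<^sub>0 bit)"
  where "z2_gen i = Poly_Mapping.single i 1"

definition bicharacter ::
    "nat \<Rightarrow> (nat \<Rightarrow> nat \<Rightarrow> complex) \<Rightarrow> (nat \<Rightarrow>\<^sub>0 bit) \<Rightarrow> (nat \<Rightarrow>\<^sub>0 bit) \<Rightarrow> complex"
  where "bicharacter N \<sigma> g g' =
    (\<Prod>i=1..N. \<Prod>j=1..N.
       if Poly_Mapping.lookup g i = 1 \<and> Poly_Mapping.lookup g' j = 1 then \<sigma> i j else 1)"

lemma bicharacter_generators:
  assumes "i \<in> {1..N}" "j \<in> {1..N}"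
  shows "bicharacter N \<sigma> (z2_gen i) (z2_gen j) = \<sigma> i j"
proof -
  have "bicharacter N \<sigma> (z2_gen i) (z2_gen j) = (\<Prod>a=1..N. \<Prod>b=1..N. if i = a \<and> j = b then \<sigma> i j else 1)"
    unfolding bicharacter_def z2_gen_def
    by (intro prod.cong refl) (auto simp: lookup_single when_def)
  also have "\<dots> = (\<Prod>a=1..N. if i = a then \<sigma> i j else 1)"
  proof (rule prod.cong[OF refl])
    fix a
    show "(\<Prod>b=1..N. if i = a \<and> j = b then \<sigma> i j else 1) = (if i = a then \<sigma> i j else 1)"
      using assms by (cases "i = a") (auto simp: prod.delta)
  qed
  also have "\<dots> = \<sigma> i j"
    using assms by (simp add: prod.delta)
  finally show ?thesis .
qed

lemma bicharacter_bimultiplicative: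
  assumes "\<And>i j. i \<in> {1..N} \<Longrightarrow> j \<in> {1..N} \<Longrightarrow> \<sigma> i j \<in> {1, -1}"
  shows "bicharacter N \<sigma> (g1 + g2) g' = bicharacter N \<sigma> g1 g' * bicharacter N \<sigma> g2 g'"
    and "bicharacter N \<sigma> g' (g1 + g2) = bicharacter N \<sigma> g' g1 * bicharacter N \<sigma> g' g2"
proof -
  have bit: "a + b = 1 \<longleftrightarrow> (a = 1) \<noteq> (b = 1)" for a b :: bit
    by (cases a; cases b) auto
  have sq: "\<sigma> i j * \<sigma> i j = 1" if "i \<in> {1..N}" "j \<in> {1..N}" for i j
    using assms[OF that] by auto
  show "bicharacter N \<sigma> (g1 + g2) g' = bicharacter N \<sigma> g1 g' * bicharacter N \<sigma> g2 g'"
    unfolding bicharacter_def prod.distrib[symmetric]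
    by (intro prod.cong refl) (use sq in \<open>auto simp: lookup_add bit\<close>)
  show "bicharacter N \<sigma> g' (g1 + g2) = bicharacter N \<sigma> g' g1 * bicharacter N \<sigma> g' g2"
    unfolding bicharacter_def prod.distrib[symmetric]
    by (intro prod.cong refl) (use sq in \<open>auto simp: lookup_add bit\<close>)
qed

text \<open>The homomorphism \<open>q(u\<^sub>i\<^sub>j) = \<delta>\<^sub>i\<^sub>j t\<^sub>i\<close>; it annihilates the relations of \<open>O\<^sub>N\<close> and \<open>O\<^sub>N\<^sup>*\<close>.\<close>

definition q_map :: "free_alg set \<Rightarrow> ((nat \<Rightarrow>\<^sub>0 bit) \<Rightarrow>\<^sub>0 complex)"
  where "q_map X = hom_ext (\<lambda>(i, j). if i = j then basis_vec (z2_gen i) else 0) (some_rep X)"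

definition cocycle ::
    "nat \<Rightarrow> (nat \<Rightarrow> nat \<Rightarrow> complex) \<Rightarrow> free_alg set \<Rightarrow> free_alg set \<Rightarrow> complex"
  where "cocycle N \<sigma> X Y =
    (\<Sum>g\<in>Poly_Mapping.keys (q_map X). \<Sum>g'\<in>Poly_Mapping.keys (q_map Y).
       Poly_Mapping.lookup (q_map X) g * Poly_Mapping.lookup (q_map Y) g' * bicharacter N \<sigma> g g')"


section \<open>Intertwiners\<close>

text \<open>The entries of the tensor powers of a matrix \<open>u\<close> over \<open>A\<close>; multi-indices of different
  lengths are never used.\<close>

fun rep_power :: "('a, 'm) ring_scheme \<Rightarrow> (nat \<Rightarrow> nat \<Rightarrow> 'a) \<Rightarrow> nat list \<Rightarrow> nat list \<Rightarrow> 'a"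
  where
    "rep_power A u (i # is) (j # js) = u i j \<otimes>\<^bsub>A\<^esub> rep_power A u is js"
  | "rep_power A u _ _ = \<one>\<^bsub>A\<^esub>"

definition Mor :: "'a star_bialgebra \<Rightarrow> nat \<Rightarrow> (nat \<Rightarrow> nat \<Rightarrow> 'a) \<Rightarrow> nat \<Rightarrow> nat
    \<Rightarrow> (nat list \<Rightarrow> nat list \<Rightarrow> complex) set"
  where "Mor A N u k l = {T \<in> lin_maps N k l.
    \<forall>i\<in>multi_indices N l. \<forall>j\<in>multi_indices N k.
      (\<Oplus>\<^bsub>A\<^esub>m\<in>multi_indices N k. T i m \<odot>\<^bsub>A\<^esub> rep_power A u m j) =
      (\<Oplus>\<^bsub>A\<^esub>m\<in>multi_indices N l. T m j \<odot>\<^bsub>A\<^esub> rep_power A u i m)}"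

end

theory Submission
  imports Defs "HOL-Computational_Algebra.Polynomial"
begin

text \<open>In the twisted algebra, the matrix \<open>u^k\<close> of words of length \<open>k\<close> in the generators changes only
  by the signs \<open>sg i * sg j\<close>.  Hence \<open>T\<close> intertwines powers of the twisted fundamental representation
  iff the matrix \<open>tw T\<close> with entries \<open>sg i * sg j * T i j\<close> intertwines powers of \<open>u\<close>.  Under \<open>tw\<close>,
  both generators become the negative of the map reversing the order of the tensor factors, which
  encodes the relations \<open>ab = ba\<close> and \<open>abc = cba\<close>.  So the defining ideal of the quantum group is
  spanned by the entries of \<open>A u^k - u^l A\<close> with \<open>A\<close> in the matrix category \<open>C\<close> of all \<open>tw T\<^sub>f\<close>, \<open>f\<close> in
  the category of partitions.

  That there are no further intertwiners is Tannaka--Krein duality: as \<open>C\<close> is closed under adjoints,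
  the orthogonal projections onto the spaces \<open>C k m\<close> (\<open>k\<close> fixed) commute with composition by elements
  of \<open>C\<close>, so their matrix coefficients define functionals that vanish on the ideal.  Applied to
  \<open>A u^k - u^l A\<close> for an arbitrary intertwiner \<open>A\<close>, they show that \<open>A\<close> is fixed by the projection.

  If one of the categories were easy, it would contain a one-block partition, whose matrix does not
  commute with the tensor powers of a rotation.\<close>

text \<open>Words in the generators are bigraded by Z_2^N, through the degrees of their row and
  column indices, and every map in the two categories preserves degree. Hence the defining ideal is
  homogeneous, and this carries the computation in the twisted algebra: cosets are evaluated at
  representatives picked by choice, so a Sweedler sum runs over unknown combinations of words, but a
  sign that depends only on degrees survives any change of representative. The cocycle has values 1
  and -1 on diagonal words and is its own convolution inverse. Since \<open>conv_inverse\<close> is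
  again a choice, its values are nevertheless recovered from the convolution equation. The plain
  linear span of the entries is already an ideal, because tensoring with an identity matrix
  multiplies an entry by words. On the side of the algebra, adjoints are available because
  orthogonality makes the matrices of words unitary modulo the ideal.\<close>

section \<open>Linear extensions, conjugation of coefficients and linear forms on free vector
  spaces\<close>

lemma lin_ext_superset:
  assumes "finite S" "Poly_Mapping.keys f \<subseteq> S"
  shows "lin_ext \<phi> f = (\<Sum>x\<in>S. vscale (Poly_Mapping.lookup f x) (\<phi> x))"
  unfolding lin_ext_def using assms
  by (intro sum.mono_neutral_left) (auto simp: in_keys_iff)

lemma lookup_lin_ext:
  "Poly_Mapping.lookup (lin_ext \<phi> f) y =
    (\<Sum>x\<in>Poly_Mapping.keys f. Poly_Mapping.lookup f x * Poly_Mapping.lookup (\<phi> x) y)"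
  by (simp add: lin_ext_def lookup_sum)

lemma lin_ext_zero [simp]: "lin_ext \<phi> 0 = 0"
  by (simp add: lin_ext_def)

lemma lin_ext_add: "lin_ext \<phi> (f + g) = lin_ext \<phi> f + lin_ext \<phi> g"
proof -
  let ?S = "Poly_Mapping.keys f \<union> Poly_Mapping.keys g"
  have "lin_ext \<phi> (f + g) = (\<Sum>x\<in>?S. vscale (Poly_Mapping.lookup (f + g) x) (\<phi> x))"
    by (rule lin_ext_superset) (simp_all add: keys_add)
  also have "\<dots> = (\<Sum>x\<in>?S. vscale (Poly_Mapping.lookup f x) (\<phi> x))
      + (\<Sum>x\<in>?S. vscale (Poly_Mapping.lookup g x) (\<phi> x))"
    by (simp add: lookup_add free_vs.scale_left_distrib sum.distrib)
  also have "\<dots> = lin_ext \<phi> f + lin_ext \<phi> g"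
    by (simp add: lin_ext_superset[of ?S, symmetric])
  finally show ?thesis .
qed

lemma keys_vscale: "Poly_Mapping.keys (vscale c f) \<subseteq> Poly_Mapping.keys f"
  by (auto simp: in_keys_iff)

lemma lin_ext_vscale: "lin_ext \<phi> (vscale c f) = vscale c (lin_ext \<phi> f)"
  by (subst lin_ext_superset[OF finite_keys keys_vscale]) (simp add: lin_ext_def free_vs.scale_sum_right)

lemma lin_ext_uminus: "lin_ext \<phi> (- f) = - lin_ext \<phi> f"
  using lin_ext_vscale[of \<phi> "-1" f] by (simp add: free_vs.scale_minus_left)

lemma lin_ext_diff: "lin_ext \<phi> (f - g) = lin_ext \<phi> f - lin_ext \<phi> g"
  using lin_ext_add[of \<phi> f "- g"] by (simp add: lin_ext_uminus)

lemma lin_ext_sum: "lin_ext \<phi> (\<Sum>i\<in>A. h i) = (\<Sum>i\<in>A. lin_ext \<phi> (h i))"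
  by (induction A rule: infinite_finite_induct) (auto simp: lin_ext_add)

lemma lin_ext_basis [simp]: "lin_ext \<phi> (basis_vec x) = \<phi> x"
  by (simp add: lin_ext_def)

lemma lin_ext_lin_ext: "lin_ext \<phi> (lin_ext \<psi> f) = lin_ext (\<lambda>x. lin_ext \<phi> (\<psi> x)) f"
  by (simp add: lin_ext_def[of \<psi>] lin_ext_def[of "\<lambda>x. lin_ext \<phi> (\<psi> x)"] lin_ext_sum lin_ext_vscale)

lemma lin_ext_basis_vec: "lin_ext basis_vec f = f"
  by (rule poly_mapping_eqI)
    (auto simp: lookup_lin_ext lookup_single when_def in_keys_iff if_distrib[of "(*) _"] sum.delta
      cong: if_cong)

lemma lin_ext_fun_vscale: "lin_ext (\<lambda>x. vscale c (\<phi> x)) f = vscale c (lin_ext \<phi> f)"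
  by (simp add: lin_ext_def free_vs.scale_sum_right mult.commute)

lemma lin_ext_mem_subspace:
  assumes "free_vs.subspace V" "\<And>x. x \<in> Poly_Mapping.keys f \<Longrightarrow> \<phi> x \<in> V"
  shows "lin_ext \<phi> f \<in> V"
  unfolding lin_ext_def using assms
  by (intro free_vs.subspace_sum free_vs.subspace_scale) auto

lemma keys_lin_ext:
  "Poly_Mapping.keys (lin_ext \<phi> f) \<subseteq> (\<Union>x\<in>Poly_Mapping.keys f. Poly_Mapping.keys (\<phi> x))"
proof
  fix y assume "y \<in> Poly_Mapping.keys (lin_ext \<phi> f)"
  then have "(\<Sum>x\<in>Poly_Mapping.keys f. Poly_Mapping.lookup f x * Poly_Mapping.lookup (\<phi> x) y) \<noteq> 0"
    by (simp add: in_keys_iff lookup_lin_ext)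
  then obtain x where "x \<in> Poly_Mapping.keys f"
      "Poly_Mapping.lookup f x * Poly_Mapping.lookup (\<phi> x) y \<noteq> 0"
    by (meson sum.not_neutral_contains_not_neutral)
  then show "y \<in> (\<Union>x\<in>Poly_Mapping.keys f. Poly_Mapping.keys (\<phi> x))"
    by (auto simp: in_keys_iff)
qed

definition conj_coeffs :: "('a \<Rightarrow>\<^sub>0 complex) \<Rightarrow> ('a \<Rightarrow>\<^sub>0 complex)"
  where "conj_coeffs f = Poly_Mapping.map cnj f"

lemma lookup_conj_coeffs [simp]:
  "Poly_Mapping.lookup (conj_coeffs f) x = cnj (Poly_Mapping.lookup f x)"
  by (simp add: conj_coeffs_def Poly_Mapping.map.rep_eq when_def)

lemma keys_conj_coeffs [simp]: "Poly_Mapping.keys (conj_coeffs f) = Poly_Mapping.keys f"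
  by (auto simp: in_keys_iff)

lemma antilin_ext_eq: "antilin_ext \<phi> f = lin_ext \<phi> (conj_coeffs f)"
  by (simp add: antilin_ext_def lin_ext_def)

lemma conj_coeffs_add: "conj_coeffs (f + g) = conj_coeffs f + conj_coeffs g"
  and conj_coeffs_diff: "conj_coeffs (f - g) = conj_coeffs f - conj_coeffs g"
  and conj_coeffs_vscale: "conj_coeffs (vscale c f) = vscale (cnj c) (conj_coeffs f)"
  and conj_coeffs_basis [simp]: "conj_coeffs (basis_vec x) = basis_vec x"
  and conj_coeffs_zero [simp]: "conj_coeffs 0 = 0"
  by (auto intro!: poly_mapping_eqI simp: lookup_add lookup_minus lookup_single when_def)

definition lin_form :: "('a \<Rightarrow> complex) \<Rightarrow> ('a \<Rightarrow>\<^sub>0 complex) \<Rightarrow> complex"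
  where "lin_form g f = (\<Sum>x\<in>Poly_Mapping.keys f. Poly_Mapping.lookup f x * g x)"

text \<open>Scalars are identified with the free vector space on one point, so that the rules for
  \<open>lin_ext\<close> carry over to \<open>lin_form\<close>.\<close>

lemma lin_form_eq_lookup:
  "lin_form g f = Poly_Mapping.lookup (lin_ext (\<lambda>x. Poly_Mapping.single () (g x)) f) ()"
  by (simp add: lin_form_def lookup_lin_ext)

lemma lin_form_zero [simp]: "lin_form g 0 = 0"
  and lin_form_add: "lin_form g (f + f') = lin_form g f + lin_form g f'"
  and lin_form_diff: "lin_form g (f - f') = lin_form g f - lin_form g f'"
  and lin_form_vscale: "lin_form g (vscale c f) = c * lin_form g f"
  and lin_form_sum: "lin_form g (\<Sum>i\<in>A. h i) = (\<Sum>i\<in>A. lin_form g (h i))"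
  and lin_form_basis [simp]: "lin_form g (basis_vec x) = g x"
  by (simp_all add: lin_form_eq_lookup lin_ext_add lin_ext_diff lin_ext_vscale lin_ext_sum
      lookup_add lookup_minus lookup_sum)

lemma lin_form_lin_ext: "lin_form g (lin_ext \<phi> f) = lin_form (\<lambda>x. lin_form g (\<phi> x)) f"
  by (simp add: lin_ext_def lin_form_sum lin_form_vscale lin_form_def[of _ f])

lemma lin_form_superset:
  assumes "finite S" "Poly_Mapping.keys f \<subseteq> S"
  shows "lin_form g f = (\<Sum>x\<in>S. Poly_Mapping.lookup f x * g x)"
  unfolding lin_form_def using assms
  by (intro sum.mono_neutral_left) (auto simp: in_keys_iff)

lemma lin_form_cong:
  "(\<And>x. x \<in> Poly_Mapping.keys f \<Longrightarrow> g x = h x) \<Longrightarrow> lin_form g f = lin_form h f"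
  by (simp add: lin_form_def)

lemma lin_form_fun_mult: "lin_form (\<lambda>x. c * g x) f = c * lin_form g f"
  by (simp add: lin_form_def sum_distrib_left mult.left_commute)

lemma lin_form_fun_sum: "lin_form (\<lambda>x. \<Sum>m\<in>M. g m x) f = (\<Sum>m\<in>M. lin_form (g m) f)"
  by (simp add: lin_form_def sum_distrib_left sum.swap[of _ M])

lemma lin_form_conj_coeffs: "lin_form g (conj_coeffs f) = cnj (lin_form (\<lambda>x. cnj (g x)) f)"
  by (simp add: lin_form_def)


section \<open>Partitions\<close>

lemma finite_partitions [simp]: "finite (partitions k l)"
  unfolding partitions_def by (rule finitely_many_partition_on) simp

lemma partition_on_Un:
  assumes "partition_on A P" "partition_on B Q" "A \<inter> B = {}"
  shows "partition_on (A \<union> B) (P \<union> Q)"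
proof (rule partition_onI)
  show "\<Union> (P \<union> Q) = A \<union> B" "{} \<notin> P \<union> Q"
    using assms by (auto simp: partition_on_def)
  fix p q assume pq: "p \<in> P \<union> Q" "q \<in> P \<union> Q" "p \<noteq> q"
  have sub: "\<And>p. p \<in> P \<Longrightarrow> p \<subseteq> A" "\<And>p. p \<in> Q \<Longrightarrow> p \<subseteq> B"
    using assms by (auto simp: partition_on_def)
  have "p \<in> P \<Longrightarrow> q \<in> P \<Longrightarrow> p \<inter> q = {}" "p \<in> Q \<Longrightarrow> q \<in> Q \<Longrightarrow> p \<inter> q = {}"
    using pq(3) assms(1,2)[THEN partition_onD2] by (auto simp: pairwise_def disjnt_def)
  with pq sub assms(3) show "disjnt p q"
    unfolding disjnt_def by blast
qed

lemma partition_on_image_inj: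
  assumes "partition_on A P" "inj_on f A"
  shows "partition_on (f ` A) ((`) f ` P)"
  using partition_on_inj_image[OF assms] partition_onD3[OF assms(1)]
  by (metis Diff_empty Diff_insert0 image_iff image_is_empty)

lemma part_tensor_in_partitions:
  assumes "p \<in> partitions k l" "q \<in> partitions k' l'"
  shows "part_tensor k l p q \<in> partitions (k + k') (l + l')"
proof -
  let ?f = "map_sum (\<lambda>i. i + k) (\<lambda>i. i + l)"
  have "inj ?f" by (rule sum.inj_map) (auto intro: inj_onI)
  then have *: "partition_on (?f ` ({1..k'} <+> {1..l'})) ((`) ?f ` q)"
    using assms(2) by (intro partition_on_image_inj) (auto simp: partitions_def intro: inj_on_subset)
  have im: "(\<lambda>i. i + a) ` {1..b} = {a+1..a+b}" for a b :: nat
    by (auto simp: image_iff Bex_def intro: exI[of _ "_ - a"])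
  have "?f ` (X <+> Y) = (\<lambda>i. i + k) ` X <+> (\<lambda>i. i + l) ` Y" for X Y
    by (auto simp: Plus_def image_Un image_image)
  then have A: "?f ` ({1..k'} <+> {1..l'}) = {k+1..k+k'} <+> {l+1..l+l'}"
    by (simp only: im)
  have "({1..k} <+> {1..l}) \<union> ({k+1..k+k'} <+> {l+1..l+l'}) = {1..k+k'} <+> {1..l+l'}"
    by (auto simp: Plus_def image_iff)
  moreover have "({1..k} <+> {1..l}) \<inter> ({k+1..k+k'} <+> {l+1..l+l'}) = {}"
    by (auto simp: Plus_def)
  ultimately show ?thesis
    using partition_on_Un[OF assms(1)[unfolded partitions_def mem_Collect_eq] *[unfolded A]]
    unfolding partitions_def part_tensor_def mem_Collect_eq by metis
qed

lemma part_inv_in_partitions: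
  assumes "p \<in> partitions k l"
  shows "part_inv p \<in> partitions l k"
proof -
  have "(case_sum Inr Inl :: nat + nat \<Rightarrow> nat + nat) ` ({1..k} <+> {1..l}) = {1..l} <+> {1..k}"
    by (auto simp: Plus_def image_Un image_image)
  moreover have "inj_on (case_sum Inr Inl :: nat + nat \<Rightarrow> nat + nat) ({1..k} <+> {1..l})"
    by (auto simp: inj_on_def split: sum.splits)
  ultimately show ?thesis
    using assms partition_on_image_inj unfolding partitions_def part_inv_def by fastforce
qed

section \<open>Glued diagrams and composition of partitions\<close>

abbreviation glued_rel :: "part \<Rightarrow> part \<Rightarrow> (row_point \<times> row_point) set"
  where "glued_rel p q \<equiv> {(x, y). \<exists>B\<in>glued_blocks p q. x \<in> B \<and> y \<in> B}"

text \<open>Sharing a block is symmetric, and reflexive on the union of the blocks; the transitive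
  closure therefore gives a genuine equivalence and \<open>glued_components\<close> a genuine
  partition.\<close>

lemma equiv_glued: "equiv (\<Union>(glued_blocks p q)) ((glued_rel p q)\<^sup>+)"
proof -
  have "sym (glued_rel p q)" by (auto simp: sym_def)
  then have "sym ((glued_rel p q)\<^sup>+)" by (rule sym_trancl)
  moreover have "(glued_rel p q)\<^sup>+ \<subseteq> \<Union>(glued_blocks p q) \<times> \<Union>(glued_blocks p q)"
    by (rule trancl_subset_Sigma) auto
  moreover have "refl_on (\<Union>(glued_blocks p q)) ((glued_rel p q)\<^sup>+)"
    by (rule refl_onI) auto
  ultimately show ?thesis
    by (auto simp: equiv_def)
qed

lemma partition_on_glued:
  "partition_on (\<Union>(glued_blocks p q)) (glued_components p q)"
  unfolding glued_components_def by (rule partition_on_quotient[OF equiv_glued])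

lemma Union_glued_blocks:
  assumes "p \<in> partitions k l" "q \<in> partitions l m"
  shows "\<Union>(glued_blocks p q) = Up ` {1..k} \<union> Mid ` {1..l} \<union> Low ` {1..m}"
proof -
  have "\<Union>p = {1..k} <+> {1..l}" "\<Union>q = {1..l} <+> {1..m}"
    using assms by (auto simp: partitions_def partition_on_def)
  then have "\<Union>(glued_blocks p q) =
      case_sum Up Mid ` ({1..k} <+> {1..l}) \<union> case_sum Mid Low ` ({1..l} <+> {1..m})"
    unfolding glued_blocks_def by (simp add: image_Union[symmetric])
  then show ?thesis
    by (auto simp: Plus_def image_Un image_image)
qed

text \<open>Restricting components to their outer points keeps them disjoint; the empty set, removed
  in \<open>part_comp\<close>, is the trace of the components inside the middle row.\<close>

lemma part_comp_in_partitions: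
  assumes "p \<in> partitions k l" "q \<in> partitions l m"
  shows "part_comp q p \<in> partitions k m"
proof -
  have "partition_on (outer_points (\<Union>(glued_blocks p q)))
      (outer_points ` glued_components p q - {{}})"
    by (rule partition_on_transform[OF partition_on_glued, THEN back_subst[of "\<lambda>A. partition_on A _"]])
      (use partition_onD1[OF partition_on_glued[of p q]] in \<open>auto simp: outer_points_def disjnt_def\<close>)
  moreover have "outer_points (\<Union>(glued_blocks p q)) = {1..k} <+> {1..m}"
    unfolding Union_glued_blocks[OF assms] by (auto simp: outer_points_def Plus_def)
  ultimately show ?thesis
    by (simp add: partitions_def part_comp_def)
qed

lemma subspace_Part: "free_vs.subspace (Part k l)"
  by (rule free_vs.subspaceI)
    (use keys_add keys_vscale in \<open>(fastforce simp: Part_def dest!: subsetD)+\<close>)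

lemma basis_vec_in_Part [simp]: "basis_vec p \<in> Part k l \<longleftrightarrow> p \<in> partitions k l"
  by (simp add: Part_def)

lemma lin_ext_in_Part:
  "(\<And>p. p \<in> Poly_Mapping.keys f \<Longrightarrow> \<phi> p \<in> Part k l) \<Longrightarrow> lin_ext \<phi> f \<in> Part k l"
  by (rule lin_ext_mem_subspace[OF subspace_Part])

lemma vec_tensor_in_Part:
  assumes "f \<in> Part k l" "g \<in> Part k' l'"
  shows "vec_tensor k l f g \<in> Part (k + k') (l + l')"
  unfolding vec_tensor_def
  by (intro lin_ext_in_Part)
    (use assms part_tensor_in_partitions in \<open>fastforce simp: Part_def\<close>)

lemma vec_comp_in_Part:
  assumes "f \<in> Part k l" "g \<in> Part l m"
  shows "vec_comp \<delta> g f \<in> Part k m"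
  unfolding vec_comp_def
  by (intro lin_ext_in_Part free_vs.subspace_scale[OF subspace_Part])
    (use assms part_comp_in_partitions in \<open>fastforce simp: Part_def\<close>)

lemma vec_inv_in_Part:
  assumes "f \<in> Part k l"
  shows "vec_inv f \<in> Part l k"
  unfolding vec_inv_def antilin_ext_eq
  by (intro lin_ext_in_Part)
    (use assms part_inv_in_partitions in \<open>fastforce simp: Part_def\<close>)

lemma id_in_partitions: "{{Inl 1, Inr 1}} \<in> partitions 1 1"
  and pair_in_partitions: "{{Inr 1, Inr 2}} \<in> partitions 0 2"
  and b22_in_partitions: "part_b22 \<in> partitions 2 2"
  and b33_in_partitions: "part_b33 \<in> partitions 3 3"
proof -
  have *: "partition_on A {B}" if "A = B" "B \<noteq> {}" for A B :: "(nat + nat) set"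
    using that partition_on_space by simp
  have i2: "{1..2::nat} = {1,2}" and i3: "{1..3::nat} = {1,2,3}" by auto
  show "{{Inl 1, Inr 1}} \<in> partitions 1 1" "{{Inr 1, Inr 2}} \<in> partitions 0 2"
      "part_b22 \<in> partitions 2 2" "part_b33 \<in> partitions 3 3"
    unfolding partitions_def mem_Collect_eq part_b22_def part_b33_def
    by (rule *; force simp: Plus_def i2 i3)+
qed

lemma crossing_in_partitions: "part_crossing \<in> partitions 2 2"
proof -
  have i2: "{1..2::nat} = {1,2}" by auto
  show ?thesis
    unfolding partitions_def part_crossing_def mem_Collect_eq i2
    by (rule partition_onI) (auto simp: Plus_def disjnt_def)
qed

lemma h_in_partitions:
  "part_h \<in> partitions 3 3" "part_h1 \<in> partitions 3 3" "part_h2 \<in> partitions 3 3"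
  "part_h3 \<in> partitions 3 3"
proof -
  have i3: "{1..3::nat} = {1,2,3}" by auto
  show "part_h \<in> partitions 3 3" "part_h1 \<in> partitions 3 3" "part_h2 \<in> partitions 3 3"
      "part_h3 \<in> partitions 3 3"
    unfolding partitions_def part_h_def part_h1_def part_h2_def part_h3_def mem_Collect_eq i3
    by (rule partition_onI; auto simp: Plus_def disjnt_def)+
qed

lemma linear_category_Part: "linear_category \<delta> Part"
  unfolding linear_category_def
  by (simp add: subspace_Part vec_tensor_in_Part vec_comp_in_Part vec_inv_in_Part
      id_in_partitions[unfolded One_nat_def] pair_in_partitions[unfolded One_nat_def])

lemma linear_categoryI:
  assumes "\<And>k l. K k l \<subseteq> Part k l" "\<And>k l. free_vs.subspace (K k l)"
    "\<And>k l k' l' f g. f \<in> K k l \<Longrightarrow> g \<in> K k' l' \<Longrightarrow> vec_tensor k l f g \<in> K (k + k') (l + l')"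
    "\<And>k l m f g. f \<in> K k l \<Longrightarrow> g \<in> K l m \<Longrightarrow> vec_comp \<delta> g f \<in> K k m"
    "\<And>k l f. f \<in> K k l \<Longrightarrow> vec_inv f \<in> K l k"
    "basis_vec {{Inl 1, Inr 1}} \<in> K 1 1" "basis_vec {{Inr 1, Inr 2}} \<in> K 0 2"
  shows "linear_category \<delta> K"
  unfolding linear_category_def using assms by blast

lemma linear_categoryD:
  assumes "linear_category \<delta> K"
  shows "K k l \<subseteq> Part k l" "free_vs.subspace (K k l)"
    "f \<in> K k l \<Longrightarrow> g \<in> K k' l' \<Longrightarrow> vec_tensor k l f g \<in> K (k + k') (l + l')"
    "f \<in> K k l \<Longrightarrow> g \<in> K l m \<Longrightarrow> vec_comp \<delta> g f \<in> K k m"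
    "f \<in> K k l \<Longrightarrow> vec_inv f \<in> K l k"
    "basis_vec {{Inl 1, Inr 1}} \<in> K 1 1" "basis_vec {{Inr 1, Inr 2}} \<in> K 0 2"
  using assms unfolding linear_category_def by blast+

lemma linear_category_generated:
  assumes "\<And>a b f. (a, b, f) \<in> G \<Longrightarrow> f \<in> Part a b"
  shows "linear_category \<delta> (generated_category \<delta> G)"
proof -
  \<comment> \<open>\<open>Part\<close> itself is one of the categories in the intersection, so the
    intersection is bounded by it.\<close>
  have sub: "generated_category \<delta> G k l \<subseteq> Part k l" for k l
    unfolding generated_category_def using linear_category_Part assms by blast
  have subsp: "free_vs.subspace (generated_category \<delta> G k l)" for k l
    unfolding generated_category_def
    by (rule free_vs.subspace_Inter) (auto simp: linear_category_def)
  have mem: "f \<in> generated_category \<delta> G k l"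
    if "\<And>K. linear_category \<delta> K \<Longrightarrow> (\<forall>(a, b, f)\<in>G. f \<in> K a b) \<Longrightarrow> f \<in> K k l" for f k l
    using that unfolding generated_category_def by blast
  have gen: "f \<in> K k l" if "f \<in> generated_category \<delta> G k l" "linear_category \<delta> K"
      "\<forall>(a, b, f)\<in>G. f \<in> K a b" for f K k l
    using that unfolding generated_category_def by blast
  show ?thesis
  proof (rule linear_categoryI[OF sub subsp])
    fix k l k' l' f g
    assume "f \<in> generated_category \<delta> G k l" "g \<in> generated_category \<delta> G k' l'"
    then show "vec_tensor k l f g \<in> generated_category \<delta> G (k + k') (l + l')"
      by (auto intro!: mem linear_categoryD(3) dest: gen)
  next
    fix k l m f g
    assume "f \<in> generated_category \<delta> G k l" "g \<in> generated_category \<delta> G l m"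
    then show "vec_comp \<delta> g f \<in> generated_category \<delta> G k m"
      by (intro mem) (rule linear_categoryD(4)[OF _ gen gen])
  next
    fix k l f
    assume "f \<in> generated_category \<delta> G k l"
    then show "vec_inv f \<in> generated_category \<delta> G l k"
      by (intro mem) (rule linear_categoryD(5)[OF _ gen])
  qed (auto intro!: mem dest: linear_categoryD(6,7))
qed

lemma generated_category_least:
  assumes "linear_category \<delta> K" "\<And>a b f. (a, b, f) \<in> G \<Longrightarrow> f \<in> K a b"
  shows "generated_category \<delta> G k l \<subseteq> K k l"
  unfolding generated_category_def using assms by blast

lemma generator_in_generated:
  "(a, b, f) \<in> G \<Longrightarrow> f \<in> generated_category \<delta> G a b"
  unfolding generated_category_def by blast

section \<open>The maps $T_p$\<close>

definition mat_tensor :: "nat \<Rightarrow> nat \<Rightarrow> (nat list \<Rightarrow> nat list \<Rightarrow> complex) \<Rightarrow>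
    (nat list \<Rightarrow> nat list \<Rightarrow> complex) \<Rightarrow> nat list \<Rightarrow> nat list \<Rightarrow> complex"
  where "mat_tensor k l A B i j = A (take l i) (take k j) * B (drop l i) (drop k j)"

definition mat_comp :: "nat \<Rightarrow> nat \<Rightarrow> (nat list \<Rightarrow> nat list \<Rightarrow> complex) \<Rightarrow>
    (nat list \<Rightarrow> nat list \<Rightarrow> complex) \<Rightarrow> nat list \<Rightarrow> nat list \<Rightarrow> complex"
  where "mat_comp N l A B i j = (\<Sum>n\<in>multi_indices N l. A i n * B n j)"

definition mat_adj :: "(nat list \<Rightarrow> nat list \<Rightarrow> complex) \<Rightarrow> nat list \<Rightarrow> nat list \<Rightarrow> complex"
  where "mat_adj A i j = cnj (A j i)"

definition mat_id :: "nat \<Rightarrow> nat \<Rightarrow> nat list \<Rightarrow> nat list \<Rightarrow> complex"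
  where "mat_id N k i j = (if i = j \<and> i \<in> multi_indices N k then 1 else 0)"

lemma finite_multi_indices [simp]: "finite (multi_indices N k)"
proof -
  have "multi_indices N k = {xs. set xs \<subseteq> {1..N} \<and> length xs = k}"
    by (auto simp: multi_indices_def)
  then show ?thesis by (simp add: finite_lists_length_eq)
qed

lemma multi_indices_0 [simp]: "multi_indices N 0 = {[]}"
  by (auto simp: multi_indices_def)

lemma nth_multi_indices:
  assumes "i \<in> multi_indices N k" "a \<in> {1..k}"
  shows "i ! (a - 1) \<in> {1..N}"
proof -
  have "i ! (a - 1) \<in> set i" using assms by (auto simp: multi_indices_def)
  then show ?thesis using assms by (auto simp: multi_indices_def)
qed

lemma multi_indices_append:
  assumes "length i = k" "length i' = k'"
  shows "i @ i' \<in> multi_indices N (k + k') \<longleftrightarrow> i \<in> multi_indices N k \<and> i' \<in> multi_indices N k'"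
  using assms by (auto simp: multi_indices_def)

lemma multi_indices_take_drop:
  "i \<in> multi_indices N (k + k') \<longleftrightarrow>
    take k i \<in> multi_indices N k \<and> drop k i \<in> multi_indices N k'"
proof
  assume "i \<in> multi_indices N (k + k')"
  then show "take k i \<in> multi_indices N k \<and> drop k i \<in> multi_indices N k'"
    by (auto simp: multi_indices_def dest: in_set_takeD in_set_dropD)
next
  assume *: "take k i \<in> multi_indices N k \<and> drop k i \<in> multi_indices N k'"
  then have "length i = k + k'"
    by (auto simp: multi_indices_def)
  moreover have "set i = set (take k i) \<union> set (drop k i)"
    by (metis append_take_drop_id set_append)
  ultimately show "i \<in> multi_indices N (k + k')"
    using * by (auto simp: multi_indices_def)
qed

lemma sum_multi_indices_add:
  "(\<Sum>i\<in>multi_indices N (k + k'). f i) =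
    (\<Sum>i\<in>multi_indices N k. \<Sum>i'\<in>multi_indices N k'. f (i @ i'))"
proof -
  have "(\<Sum>i\<in>multi_indices N k. \<Sum>i'\<in>multi_indices N k'. f (i @ i')) =
      (\<Sum>(i, i')\<in>multi_indices N k \<times> multi_indices N k'. f (i @ i'))"
    by (simp add: sum.cartesian_product)
  also have "\<dots> = (\<Sum>i\<in>multi_indices N (k + k'). f i)"
    by (rule sum.reindex_bij_witness[of _ "\<lambda>i. (take k i, drop k i)" "\<lambda>(i, i'). i @ i'"])
      (auto simp: multi_indices_take_drop, auto simp: multi_indices_def)
  finally show ?thesis by simp
qed

lemma multi_indices_Suc: "multi_indices N (Suc k) = (\<lambda>(a, i). a # i) ` ({1..N} \<times> multi_indices N k)"
proof -
  have "x \<in> (\<lambda>(a, i). a # i) ` ({1..N} \<times> multi_indices N k)" if "x \<in> multi_indices N (Suc k)" for x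
    using that by (cases x) (auto simp: multi_indices_def)
  then show ?thesis by (auto simp: multi_indices_def)
qed

lemma sum_multi_indices_Suc:
  "(\<Sum>i\<in>multi_indices N (Suc k). f i) = (\<Sum>a=1..N. \<Sum>i\<in>multi_indices N k. f (a # i))"
  unfolding multi_indices_Suc
  by (subst sum.reindex) (auto simp: inj_on_def sum.cartesian_product case_prod_unfold)

text \<open>The labelling condition of \<open>T_part\<close> for an arbitrary set of points, so that
  it also applies to the three rows of a glued diagram.\<close>

definition const_on_blocks :: "'a set set \<Rightarrow> ('a \<Rightarrow> 'b) \<Rightarrow> bool"
  where "const_on_blocks p L \<longleftrightarrow> (\<forall>B\<in>p. \<forall>x\<in>B. \<forall>y\<in>B. L x = L y)"

lemma const_on_blocksD: "const_on_blocks p L \<Longrightarrow> B \<in> p \<Longrightarrow> x \<in> B \<Longrightarrow> y \<in> B \<Longrightarrow> L x = L y"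
  unfolding const_on_blocks_def by blast

lemma const_on_blocks_cong:
  "(\<And>x. x \<in> \<Union>p \<Longrightarrow> L x = L' x) \<Longrightarrow> const_on_blocks p L \<longleftrightarrow> const_on_blocks p L'"
  unfolding const_on_blocks_def by (metis UnionI)

lemma const_on_blocks_pair: "const_on_blocks {{x, y}} L \<longleftrightarrow> L x = L y"
proof
  assume "L x = L y"
  then have "L z = L z'" if "z = x \<or> z = y" "z' = x \<or> z' = y" for z z'
    using that by metis
  then show "const_on_blocks {{x, y}} L"
    unfolding const_on_blocks_def singleton_iff insert_iff by blast
qed (auto dest: const_on_blocksD)

lemma const_on_blocks_image: "const_on_blocks ((`) f ` p) L \<longleftrightarrow> const_on_blocks p (\<lambda>x. L (f x))"
  unfolding const_on_blocks_def by blast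

lemma const_on_blocks_Un:
  "const_on_blocks (p \<union> q) L \<longleftrightarrow> const_on_blocks p L \<and> const_on_blocks q L"
  unfolding const_on_blocks_def by blast

lemma T_part_eq: "T_part N k l p i j =
  (if i \<in> multi_indices N l \<and> j \<in> multi_indices N k \<and> const_on_blocks p (point_label i j)
   then 1 else 0)"
  by (simp add: T_part_def const_on_blocks_def)

lemma T_part_tensor:
  assumes "p \<in> partitions k l" "q \<in> partitions k' l'"
  shows "T_part N (k + k') (l + l') (part_tensor k l p q) i j =
    mat_tensor k l (T_part N k l p) (T_part N k' l' q) i j"
proof (cases "i \<in> multi_indices N (l + l') \<and> j \<in> multi_indices N (k + k')")
  case True
  then have len: "length i = l + l'" "length j = k + k'" by (auto simp: multi_indices_def)
  have "\<Union>p = {1..k} <+> {1..l}" "\<Union>q = {1..k'} <+> {1..l'}"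
    using assms by (auto simp: partitions_def partition_on_def)
  then have "const_on_blocks p (point_label i j) \<longleftrightarrow>
        const_on_blocks p (point_label (take l i) (take k j))"
      "const_on_blocks q (\<lambda>x. point_label i j (map_sum (\<lambda>i. i + k) (\<lambda>i. i + l) x)) \<longleftrightarrow>
        const_on_blocks q (point_label (drop l i) (drop k j))"
    by (intro const_on_blocks_cong; use len in \<open>auto simp: point_label_def add.commute\<close>)+
  with True show ?thesis
    by (simp add: T_part_eq mat_tensor_def part_tensor_def const_on_blocks_Un const_on_blocks_image
        multi_indices_take_drop[of i] multi_indices_take_drop[of j])
next
  case False
  then show ?thesis
    by (auto simp: T_part_eq mat_tensor_def multi_indices_take_drop[of i] multi_indices_take_drop[of j])
qed

lemma T_part_inv: "T_part N l k (part_inv p) i j = T_part N k l p j i"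
proof -
  have "(\<lambda>x. point_label i j (case_sum Inr Inl x)) = point_label j i"
    by (auto simp: point_label_def fun_eq_iff split: sum.splits)
  then show ?thesis
    by (auto simp: T_part_eq part_inv_def const_on_blocks_image)
qed

definition glued_label :: "nat list \<Rightarrow> nat list \<Rightarrow> nat list \<Rightarrow> row_point \<Rightarrow> nat"
  where "glued_label i n j x =
    (case x of Up a \<Rightarrow> j ! (a - 1) | Mid a \<Rightarrow> n ! (a - 1) | Low a \<Rightarrow> i ! (a - 1))"

lemma const_on_glued_blocks:
  "const_on_blocks (glued_blocks p q) (glued_label i n j) \<longleftrightarrow>
    const_on_blocks p (point_label n j) \<and> const_on_blocks q (point_label i n)"
proof -
  have "(\<lambda>x. glued_label i n j (case_sum Up Mid x)) = point_label n j"
    "(\<lambda>x. glued_label i n j (case_sum Mid Low x)) = point_label i n"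
    by (auto simp: point_label_def glued_label_def fun_eq_iff split: sum.splits)
  then show ?thesis
    by (simp add: glued_blocks_def const_on_blocks_Un const_on_blocks_image)
qed

text \<open>Equality of labels propagates along chains of overlapping blocks, so passing to the
  transitive closure adds no condition.\<close>

lemma const_on_glued_components:
  "const_on_blocks (glued_components p q) L \<longleftrightarrow> const_on_blocks (glued_blocks p q) L"
proof
  assume *: "const_on_blocks (glued_blocks p q) L"
  have "L x = L y" if "(x, y) \<in> (glued_rel p q)\<^sup>+" for x y
    using that
  proof induction
    case (base y)
    with * show ?case unfolding const_on_blocks_def by blast
  next
    case (step y z)
    from step.hyps(2) * have "L y = L z" unfolding const_on_blocks_def by blast
    with step.IH show ?case by simp
  qed
  moreover have "(x, y) \<in> (glued_rel p q)\<^sup>+" if "C \<in> glued_components p q" "x \<in> C" "y \<in> C" for C x y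
    using that quotient_eq_iff[OF equiv_glued, of C p q C x y] by (simp add: glued_components_def)
  ultimately show "const_on_blocks (glued_components p q) L"
    unfolding const_on_blocks_def by blast
next
  assume *: "const_on_blocks (glued_components p q) L"
  show "const_on_blocks (glued_blocks p q) L"
    unfolding const_on_blocks_def
  proof (intro ballI)
    fix B x y assume B: "B \<in> glued_blocks p q" "x \<in> B" "y \<in> B"
    then obtain C where C: "C \<in> glued_components p q" "x \<in> C"
      using partition_onD1[OF partition_on_glued[of p q]] by blast
    have "(x, y) \<in> (glued_rel p q)\<^sup>+"
      using B by (intro r_into_trancl) blast
    then have "y \<in> C"
      using C in_quotient_imp_closed[OF equiv_glued, of C p q x y] by (simp add: glued_components_def)
    with * C show "L x = L y"
      unfolding const_on_blocks_def by blast
  qed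
qed

text \<open>The inner labels \<open>n\<close> are arbitrary: only points outside the middle row are
  compared, and their labels do not depend on \<open>n\<close>.\<close>

lemma const_on_part_comp:
  "const_on_blocks (part_comp q p) (point_label i j) \<longleftrightarrow>
    (\<forall>C\<in>glued_components p q. \<forall>x\<in>C - range Mid. \<forall>y\<in>C - range Mid.
      glued_label i n j x = glued_label i n j y)"
proof -
  have "const_on_blocks (part_comp q p) (point_label i j) \<longleftrightarrow>
      (\<forall>C\<in>glued_components p q. \<forall>x\<in>outer_points C. \<forall>y\<in>outer_points C.
        point_label i j x = point_label i j y)"
    unfolding const_on_blocks_def part_comp_def by auto
  also have "\<dots> \<longleftrightarrow> (\<forall>C\<in>glued_components p q. \<forall>x\<in>C - range Mid. \<forall>y\<in>C - range Mid.
      glued_label i n j x = glued_label i n j y)"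
  proof (rule ball_cong[OF refl])
    fix C
    have "C - range Mid = case_sum Up Low ` outer_points C"
    proof (rule Set.set_eqI)
      fix x show "x \<in> C - range Mid \<longleftrightarrow> x \<in> case_sum Up Low ` outer_points C"
        by (cases x) (force simp: outer_points_def image_iff)+
    qed
    moreover have "glued_label i n j (case_sum Up Low x) = point_label i j x" for x
      by (auto simp: glued_label_def point_label_def split: sum.splits)
    ultimately show "(\<forall>x\<in>outer_points C. \<forall>y\<in>outer_points C. point_label i j x = point_label i j y)
      \<longleftrightarrow> (\<forall>x\<in>C - range Mid. \<forall>y\<in>C - range Mid. glued_label i n j x = glued_label i n j y)"
      by simp
  qed
  finally show ?thesis .
qed

text \<open>An inner labelling compatible with fixed outer labels is determined by its values on the
  components that consist of middle points only, and these values are arbitrary.\<close>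

lemma card_inner_labellings:
  assumes p: "p \<in> partitions k l" and q: "q \<in> partitions l m"
    and i: "i \<in> multi_indices N m" and j: "j \<in> multi_indices N k"
    and outer: "const_on_blocks (part_comp q p) (point_label i j)"
  shows "card {n \<in> multi_indices N l. const_on_blocks (glued_components p q) (glued_label i n j)}
    = N ^ loops q p"
proof -
  let ?Cs = "glued_components p q"
  let ?L = "\<lambda>n. glued_label i n j"
  let ?S = "{n \<in> multi_indices N l. const_on_blocks ?Cs (?L n)}"
  define Lp where "Lp = {C \<in> ?Cs. C \<subseteq> range Mid}"
  \<comment> \<open>A component that is not a loop has an outer point. Taking it as representative
    makes the label of \<open>rep C\<close> independent of the inner labelling.\<close>
  define rep where "rep C = (SOME x. x \<in> C \<and> (C \<in> Lp \<or> x \<notin> range Mid))" for C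
  note part = partition_on_glued[of p q, unfolded Union_glued_blocks[OF p q]]
  have fin: "finite ?Cs"
    by (rule finite_elements[OF _ part]) simp
  have rep: "rep C \<in> C" "C \<notin> Lp \<Longrightarrow> rep C \<notin> range Mid" if "C \<in> ?Cs" for C
  proof -
    have "\<exists>x. x \<in> C \<and> (C \<in> Lp \<or> x \<notin> range Mid)"
    proof (cases "C \<subseteq> range Mid")
      case True
      moreover have "C \<noteq> {}" using that partition_onD3[OF part] by metis
      ultimately show ?thesis using that by (auto simp: Lp_def)
    qed blast
    from someI_ex[OF this] show "rep C \<in> C" "C \<notin> Lp \<Longrightarrow> rep C \<notin> range Mid"
      unfolding rep_def by auto
  qed
  have indep: "?L n x = ?L n' x" if "x \<notin> range Mid" for n n' x
    using that by (cases x) (auto simp: glued_label_def)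
  have comp: "\<exists>!C. C \<in> ?Cs \<and> Mid a \<in> C" if "a \<in> {1..l}" for a
  proof -
    have "Mid a \<in> \<Union>?Cs" using partition_onD1[OF part] that by blast
    moreover have "C = D" if "C \<in> ?Cs" "D \<in> ?Cs" "Mid a \<in> C" "Mid a \<in> D" for C D
      using partition_onD2[OF part] that unfolding disjoint_def by blast
    ultimately show ?thesis by blast
  qed
  have "bij_betw (\<lambda>n. \<lambda>C\<in>Lp. ?L n (rep C)) ?S (Lp \<rightarrow>\<^sub>E {1..N})"
    unfolding bij_betw_def
  proof (intro conjI Set.set_eqI iffI)
    show "inj_on (\<lambda>n. \<lambda>C\<in>Lp. ?L n (rep C)) ?S"
    proof (rule inj_onI)
      fix n n' assume n: "n \<in> ?S" and n': "n' \<in> ?S"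
        and eq: "(\<lambda>C\<in>Lp. ?L n (rep C)) = (\<lambda>C\<in>Lp. ?L n' (rep C))"
      have len: "length n = l" "length n' = l"
        using n n' by (auto simp: multi_indices_def)
      show "n = n'"
      proof (rule nth_equalityI)
        fix a assume "a < length n"
        then have "Suc a \<in> {1..l}" using len by auto
        then obtain C where C: "C \<in> ?Cs" "Mid (Suc a) \<in> C" using comp by blast
        have "?L n (rep C) = ?L n' (rep C)"
        proof (cases "C \<in> Lp")
          case True then show ?thesis using fun_cong[OF eq, of C] by simp
        next
          case False then show ?thesis using indep rep C by blast
        qed
        moreover have "?L n (rep C) = ?L n (Mid (Suc a))" "?L n' (rep C) = ?L n' (Mid (Suc a))"
          using n n' const_on_blocksD[OF _ C(1) rep(1)[OF C(1)] C(2)] by blast+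
        ultimately show "n ! a = n' ! a" by (simp add: glued_label_def)
      qed (simp add: len)
    qed
  next
    fix c assume "c \<in> (\<lambda>n. \<lambda>C\<in>Lp. ?L n (rep C)) ` ?S"
    then obtain n where n: "n \<in> multi_indices N l" and c: "c = (\<lambda>C\<in>Lp. ?L n (rep C))" by auto
    have "?L n (rep C) \<in> {1..N}" if "C \<in> Lp" for C
    proof -
      have C: "rep C \<in> C" "C \<subseteq> range Mid" "C \<in> ?Cs" using rep that by (auto simp: Lp_def)
      then have *: "rep C \<in> Up ` {1..k} \<union> Mid ` {1..l} \<union> Low ` {1..m}"
        unfolding partition_onD1[OF part] by (intro UnionI)
      from C obtain a where "rep C = Mid a" by blast
      with * have a: "rep C = Mid a" "a \<in> {1..l}" by auto
      then show ?thesis using nth_multi_indices[OF n] by (simp add: glued_label_def)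
    qed
    then show "c \<in> Lp \<rightarrow>\<^sub>E {1..N}" unfolding c by (simp add: restrict_PiE_iff)
  next
    fix c assume c: "c \<in> Lp \<rightarrow>\<^sub>E {1..N}"
    \<comment> \<open>Loops receive the prescribed value, all other components the label of their
      outer representative. The inner labelling \<open>[]\<close> is a dummy, as outer labels ignore
      it.\<close>
    define val where "val C = (if C \<in> Lp then c C else ?L [] (rep C))" for C
    define n where "n = map (\<lambda>a. val (THE C. C \<in> ?Cs \<and> Mid a \<in> C)) [1..<Suc l]"
    have Mid: "?L n (Mid a) = val C" if "a \<in> {1..l}" "C \<in> ?Cs" "Mid a \<in> C" for a C
    proof -
      have "n ! (a - 1) = val (THE C. C \<in> ?Cs \<and> Mid a \<in> C)"
        unfolding n_def using that(1) by (subst nth_map) (auto simp del: upt_Suc)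
      also have "(THE C. C \<in> ?Cs \<and> Mid a \<in> C) = C"
        using comp[OF that(1)] that(2,3) by (intro the1_equality) auto
      finally show ?thesis by (simp add: glued_label_def)
    qed
    have L: "?L n x = val C" if "C \<in> ?Cs" "x \<in> C" for x C
    proof (cases "x \<in> range Mid")
      case True
      then obtain a where a: "x = Mid a" by auto
      moreover have "x \<in> Up ` {1..k} \<union> Mid ` {1..l} \<union> Low ` {1..m}"
        unfolding partition_onD1[OF part] using that by (intro UnionI)
      ultimately have "a \<in> {1..l}" by auto
      with a Mid that show ?thesis by simp
    next
      case False
      then have "C \<notin> Lp" using that by (auto simp: Lp_def)
      then have "rep C \<in> C - range Mid" "x \<in> C - range Mid"
        using rep[OF that(1)] that False by auto
      with \<open>C \<in> ?Cs\<close> have "?L n x = ?L n (rep C)"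
        using outer[unfolded const_on_part_comp[of q p i j n]] by blast
      also have "\<dots> = val C"
        using \<open>C \<notin> Lp\<close> indep rep[OF that(1)] by (auto simp: val_def)
      finally show ?thesis .
    qed
    have val: "val C \<in> {1..N}" if "C \<in> ?Cs" for C
    proof (cases "C \<in> Lp")
      case True then show ?thesis using c by (auto simp: val_def)
    next
      case False
      have "rep C \<in> Up ` {1..k} \<union> Mid ` {1..l} \<union> Low ` {1..m}"
        unfolding partition_onD1[OF part] using rep(1)[OF that] that by (intro UnionI)
      with rep(2)[OF that False] have "rep C \<in> Up ` {1..k} \<union> Low ` {1..m}"
        by blast
      moreover have "j ! (a - 1) \<in> {1..N}" if "a \<in> {1..k}" for a
        using nth_multi_indices[OF j that] .
      moreover have "i ! (a - 1) \<in> {1..N}" if "a \<in> {1..m}" for a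
        using nth_multi_indices[OF i that] .
      ultimately show ?thesis
        using False by (auto simp: val_def glued_label_def)
    qed
    have "n \<in> multi_indices N l"
    proof -
      have "val (THE C. C \<in> ?Cs \<and> Mid a \<in> C) \<in> {1..N}" if "a \<in> {1..l}" for a
        using theI'[OF comp[OF that]] val by blast
      then show ?thesis by (auto simp: multi_indices_def n_def simp del: upt_Suc)
    qed
    moreover have "const_on_blocks ?Cs (?L n)"
      using L by (simp add: const_on_blocks_def)
    moreover have "c = (\<lambda>C\<in>Lp. ?L n (rep C))"
    proof
      fix C show "c C = (\<lambda>C\<in>Lp. ?L n (rep C)) C"
      proof (cases "C \<in> Lp")
        case True
        then have "C \<in> ?Cs" by (simp add: Lp_def)
        with True show ?thesis using L[OF _ rep(1)] by (simp add: val_def)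
      next
        case False then show ?thesis using c by (auto simp: PiE_def extensional_def)
      qed
    qed
    ultimately show "c \<in> (\<lambda>n. \<lambda>C\<in>Lp. ?L n (rep C)) ` ?S" by blast
  qed
  then have "card ?S = card (Lp \<rightarrow>\<^sub>E {1..N})" by (rule bij_betw_same_card)
  also have "\<dots> = N ^ card Lp"
    by (subst card_PiE) (use fin in \<open>auto simp: Lp_def\<close>)
  finally show ?thesis by (simp add: loops_def Lp_def)
qed

text \<open>An entry of the matrix product counts the inner labellings compatible with both
  partitions: there are \<open>N\<close> choices per loop if the outer labels are compatible, and
  none otherwise.\<close>

lemma T_part_comp:
  assumes p: "p \<in> partitions k l" and q: "q \<in> partitions l m"
  shows "mat_comp N l (T_part N l m q) (T_part N k l p) i j =
    of_nat N ^ loops q p * T_part N k m (part_comp q p) i j"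
proof (cases "i \<in> multi_indices N m \<and> j \<in> multi_indices N k")
  case True
  let ?S = "{n \<in> multi_indices N l. const_on_blocks (glued_components p q) (glued_label i n j)}"
  have "mat_comp N l (T_part N l m q) (T_part N k l p) i j =
      (\<Sum>n\<in>multi_indices N l. if const_on_blocks (glued_components p q) (glued_label i n j) then 1 else 0)"
    unfolding mat_comp_def using True
    by (intro sum.cong) (auto simp: T_part_eq const_on_glued_components const_on_glued_blocks)
  also have "\<dots> = of_nat (card ?S)"
    by (simp add: sum.If_cases Int_def)
  also have "\<dots> = of_nat N ^ loops q p * T_part N k m (part_comp q p) i j"
  proof (cases "const_on_blocks (part_comp q p) (point_label i j)")
    case True
    with \<open>i \<in> _ \<and> j \<in> _\<close> show ?thesis
      using card_inner_labellings[OF p q] by (simp add: T_part_eq)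
  next
    case False
    have "?S = {}"
    proof (rule ccontr)
      assume "?S \<noteq> {}"
      then obtain n where "const_on_blocks (glued_components p q) (glued_label i n j)" by blast
      then have "const_on_blocks (part_comp q p) (point_label i j)"
        unfolding const_on_part_comp[of q p i j n] by (auto dest: const_on_blocksD)
      with False show False ..
    qed
    with False show ?thesis by (simp add: T_part_eq)
  qed
  finally show ?thesis .
next
  case False
  then show ?thesis by (auto simp: mat_comp_def T_part_eq)
qed

lemma lin_form_fun_mult_right: "lin_form (\<lambda>x. g x * c) f = lin_form g f * c"
  using lin_form_fun_mult[of c g f] by (simp add: mult.commute)

lemma T_vec_eq_lin_form: "T_vec N k l f i j = lin_form (\<lambda>p. T_part N k l p i j) f"
  by (simp add: T_vec_def lin_form_def)

lemma T_vec_basis: "T_vec N k l (basis_vec p) = T_part N k l p"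
  by (simp add: fun_eq_iff T_vec_eq_lin_form)

lemma T_vec_in_lin_maps: "T_vec N k l f \<in> lin_maps N k l"
proof -
  have "T_vec N k l f i j = 0" if "\<not> (i \<in> multi_indices N l \<and> j \<in> multi_indices N k)" for i j
    using that by (auto simp: T_vec_def T_part_def intro: sum.neutral)
  then show ?thesis by (auto simp: lin_maps_def)
qed

lemma T_vec_tensor:
  assumes "f \<in> Part k l" "g \<in> Part k' l'"
  shows "T_vec N (k + k') (l + l') (vec_tensor k l f g) =
    mat_tensor k l (T_vec N k l f) (T_vec N k' l' g)"
proof (intro ext)
  fix i j
  have "T_vec N (k + k') (l + l') (vec_tensor k l f g) i j =
      lin_form (\<lambda>p. lin_form (\<lambda>q. T_part N (k + k') (l + l') (part_tensor k l p q) i j) g) f"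
    by (simp add: T_vec_eq_lin_form vec_tensor_def lin_form_lin_ext)
  also have "\<dots> = lin_form (\<lambda>p. lin_form (\<lambda>q.
      T_part N k l p (take l i) (take k j) * T_part N k' l' q (drop l i) (drop k j)) g) f"
    using assms by (intro lin_form_cong) (auto simp: T_part_tensor mat_tensor_def Part_def subset_iff)
  also have "\<dots> = mat_tensor k l (T_vec N k l f) (T_vec N k' l' g) i j"
    by (simp add: lin_form_fun_mult lin_form_fun_mult_right mat_tensor_def T_vec_eq_lin_form)
  finally show "T_vec N (k + k') (l + l') (vec_tensor k l f g) i j =
    mat_tensor k l (T_vec N k l f) (T_vec N k' l' g) i j" .
qed

lemma T_vec_comp:
  assumes "f \<in> Part k l" "g \<in> Part l m"
  shows "T_vec N k m (vec_comp (of_nat N) g f) = mat_comp N l (T_vec N l m g) (T_vec N k l f)"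
proof (intro ext)
  fix i j
  have "T_vec N k m (vec_comp (of_nat N) g f) i j =
      lin_form (\<lambda>q. lin_form (\<lambda>p. of_nat N ^ loops q p * T_part N k m (part_comp q p) i j) f) g"
    by (simp add: T_vec_eq_lin_form vec_comp_def lin_form_lin_ext lin_form_vscale)
  also have "\<dots> = lin_form (\<lambda>q. lin_form (\<lambda>p.
      mat_comp N l (T_part N l m q) (T_part N k l p) i j) f) g"
    using assms by (intro lin_form_cong) (auto simp: T_part_comp Part_def subset_iff)
  also have "\<dots> = (\<Sum>n\<in>multi_indices N l. T_vec N l m g i n * T_vec N k l f n j)"
    by (simp add: mat_comp_def lin_form_fun_sum lin_form_fun_mult lin_form_fun_mult_right
        T_vec_eq_lin_form)
  finally show "T_vec N k m (vec_comp (of_nat N) g f) i j =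
      mat_comp N l (T_vec N l m g) (T_vec N k l f) i j"
    by (simp add: mat_comp_def)
qed

lemma T_vec_inv: "T_vec N l k (vec_inv f) = mat_adj (T_vec N k l f)"
proof (intro ext)
  fix i j
  have "T_vec N l k (vec_inv f) i j = cnj (lin_form (\<lambda>p. cnj (T_part N k l p j i)) f)"
    by (simp add: T_vec_eq_lin_form vec_inv_def antilin_ext_eq lin_form_lin_ext
        lin_form_conj_coeffs T_part_inv)
  also have "(\<lambda>p. cnj (T_part N k l p j i)) = (\<lambda>p. T_part N k l p j i)"
    by (auto simp: T_part_def)
  finally show "T_vec N l k (vec_inv f) i j = mat_adj (T_vec N k l f) i j"
    by (simp add: mat_adj_def T_vec_eq_lin_form)
qed

lemma T_part_id: "T_part N 1 1 {{Inl 1, Inr 1}} = mat_id N 1"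
proof (intro ext)
  fix i j
  have "i = j \<longleftrightarrow> j ! 0 = i ! 0" if "i \<in> multi_indices N 1" "j \<in> multi_indices N 1"
    using that by (auto simp: multi_indices_def length_Suc_conv)
  moreover have "const_on_blocks {{Inl 1, Inr 1}} (point_label i j) \<longleftrightarrow> j ! 0 = i ! 0"
    by (simp add: const_on_blocks_pair point_label_def)
  ultimately show "T_part N 1 1 {{Inl 1, Inr 1}} i j = mat_id N 1 i j"
    unfolding T_part_eq mat_id_def by metis
qed

lemma T_part_pair:
  "T_part N 0 2 {{Inr 1, Inr 2}} i j = (if j = [] \<and> (\<exists>a\<in>{1..N}. i = [a, a]) then 1 else 0)"
proof -
  have *: "i \<in> multi_indices N 2 \<longleftrightarrow> (\<exists>a\<in>{1..N}. \<exists>b\<in>{1..N}. i = [a, b])"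
    by (force simp: numeral_2_eq_2 multi_indices_Suc)
  have "const_on_blocks {{Inr 1, Inr 2}} (point_label i j) \<longleftrightarrow> i ! 0 = i ! 1"
    by (simp add: const_on_blocks_pair point_label_def)
  with * show ?thesis
    by (auto simp: T_part_eq)
qed

section \<open>The free algebra\<close>

lemma vscale_basis: "vscale c (basis_vec x) = Poly_Mapping.single x c"
  by (rule poly_mapping_eqI) (simp add: lookup_single when_def)

lemma vscale_single: "vscale c (Poly_Mapping.single x d) = Poly_Mapping.single x (c * d)"
  by (rule poly_mapping_eqI) (simp add: lookup_single when_def)

text \<open>This brings the library's convolution product into the calculus of
  \<open>lin_ext\<close>.\<close>

lemma mult_eq_lin_ext:
  fixes f g :: "'a::monoid_add \<Rightarrow>\<^sub>0 complex"
  shows "f * g = lin_ext (\<lambda>v. lin_ext (\<lambda>w. basis_vec (v + w)) g) f"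
proof -
  have expand: "h = (\<Sum>x\<in>Poly_Mapping.keys h. Poly_Mapping.single x (Poly_Mapping.lookup h x))"
    for h :: "'a \<Rightarrow>\<^sub>0 complex"
    using lin_ext_basis_vec[of h] by (simp add: lin_ext_def vscale_basis)
  have "f * g = (\<Sum>x\<in>Poly_Mapping.keys f. Poly_Mapping.single x (Poly_Mapping.lookup f x)) *
      (\<Sum>y\<in>Poly_Mapping.keys g. Poly_Mapping.single y (Poly_Mapping.lookup g y))"
    by (rule arg_cong2[where f="(*)", OF expand expand])
  also have "\<dots> = lin_ext (\<lambda>v. lin_ext (\<lambda>w. basis_vec (v + w)) g) f"
    by (simp add: sum_product mult_single lin_ext_def vscale_basis vscale_single free_vs.scale_sum_right)
  finally show ?thesis .
qed

lemma vscale_mult_left: "vscale c f * g = vscale c (f * g)"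
  and vscale_mult_right: "f * vscale c g = vscale c (f * g)"
  for f g :: "'a::monoid_add \<Rightarrow>\<^sub>0 complex"
  by (simp_all add: mult_eq_lin_ext lin_ext_vscale lin_ext_fun_vscale)

lemma lin_ext_mult_left: "lin_ext \<phi> f * g = lin_ext (\<lambda>x. \<phi> x * g) f"
  and lin_ext_mult_right: "g * lin_ext \<phi> f = lin_ext (\<lambda>x. g * \<phi> x) f"
  for g :: "'a::monoid_add \<Rightarrow>\<^sub>0 complex"
  by (simp_all add: lin_ext_def sum_distrib_left sum_distrib_right vscale_mult_left vscale_mult_right)

text \<open>For index words of equal length this is a matrix entry of the tensor power of
  \<open>u\<close>. As \<open>zip\<close> truncates otherwise, equal lengths are assumed where it
  matters.\<close>

definition wd :: "nat list \<Rightarrow> nat list \<Rightarrow> free_alg"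
  where "wd i j = basis_vec (Word (zip i j))"

lemma wd_append: "length i = length j \<Longrightarrow> wd i j * wd a b = wd (i @ a) (j @ b)"
  by (simp add: wd_def mult_single plus_free_mon_def)

lemma wd_Nil [simp]: "wd [] [] = 1"
  by (simp add: wd_def zero_free_mon_def[symmetric])

lemma wd_single: "wd [a] [b] = u_gen a b"
  by (simp add: wd_def u_gen_def)

lemma wd_Cons: "wd (a # i) (b # j) = u_gen a b * wd i j"
  using wd_append[of "[a]" "[b]" i j] by (simp add: wd_single)

definition row :: "(nat \<times> nat) free_mon \<Rightarrow> nat list"
  where "row w = map fst (letters w)"

definition col :: "(nat \<times> nat) free_mon \<Rightarrow> nat list"
  where "col w = map snd (letters w)"

definition word_of :: "nat \<Rightarrow> (nat \<times> nat) free_mon \<Rightarrow> bool"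
  where "word_of N w \<longleftrightarrow> set (letters w) \<subseteq> {1..N} \<times> {1..N}"

lemma row_zip [simp]: "length i = length j \<Longrightarrow> row (Word (zip i j)) = i"
  and col_zip [simp]: "length i = length j \<Longrightarrow> col (Word (zip i j)) = j"
  by (simp_all add: row_def col_def)

lemma zip_row_col: "Word (zip (row w) (col w)) = w"
  by (cases w) (simp add: row_def col_def zip_map_fst_snd)

lemma wd_row_col: "wd (row w) (col w) = basis_vec w"
  by (simp add: wd_def zip_row_col)

lemma length_row [simp]: "length (row w) = length (letters w)"
  and length_col [simp]: "length (col w) = length (letters w)"
  by (simp_all add: row_def col_def)

lemma row_in_multi_indices: "word_of N w \<Longrightarrow> row w \<in> multi_indices N (length (letters w))"
  and col_in_multi_indices: "word_of N w \<Longrightarrow> col w \<in> multi_indices N (length (letters w))"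
  by (auto simp: multi_indices_def row_def col_def word_of_def subset_iff)

lemma length_multi_index: "i \<in> multi_indices N k \<Longrightarrow> length i = k"
  by (simp add: multi_indices_def)

lemma word_of_zip:
  assumes "i \<in> multi_indices N k" "j \<in> multi_indices N k"
  shows "word_of N (Word (zip i j))"
proof -
  have "set (zip i j) \<subseteq> set i \<times> set j"
    by (auto dest: set_zip_leftD set_zip_rightD)
  also have "\<dots> \<subseteq> {1..N} \<times> {1..N}"
    using assms by (auto simp: multi_indices_def)
  finally show ?thesis by (simp add: word_of_def)
qed

lemma carrier_free_ring: "carrier (free_ring N) = {f. \<forall>w\<in>Poly_Mapping.keys f. word_of N w}"
  by (simp add: free_ring_def word_of_def)

lemma free_ring_simps [simp]:
  "(\<otimes>\<^bsub>free_ring N\<^esub>) = (*)" "\<one>\<^bsub>free_ring N\<^esub> = 1" "\<zero>\<^bsub>free_ring N\<^esub> = 0"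
  "(\<oplus>\<^bsub>free_ring N\<^esub>) = (+)"
  by (simp_all add: free_ring_def)

lemma subspace_carrier: "free_vs.subspace (carrier (free_ring N))"
  by (rule free_vs.subspaceI)
    (use keys_add keys_vscale in \<open>(fastforce simp: carrier_free_ring dest!: subsetD)+\<close>)

lemma basis_vec_in_carrier [simp]: "basis_vec w \<in> carrier (free_ring N) \<longleftrightarrow> word_of N w"
  by (simp add: carrier_free_ring)

lemma wd_in_carrier:
  "i \<in> multi_indices N k \<Longrightarrow> j \<in> multi_indices N k \<Longrightarrow> wd i j \<in> carrier (free_ring N)"
  by (simp add: wd_def word_of_zip)

lemma u_gen_in_carrier: "i \<in> {1..N} \<Longrightarrow> j \<in> {1..N} \<Longrightarrow> u_gen i j \<in> carrier (free_ring N)"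
  by (simp add: u_gen_def word_of_def)

lemma mult_in_carrier:
  assumes "f \<in> carrier (free_ring N)" "g \<in> carrier (free_ring N)"
  shows "f * g \<in> carrier (free_ring N)"
proof -
  have "word_of N w" if w: "w \<in> Poly_Mapping.keys (f * g)" for w
  proof -
    obtain a b where "w = a + b" "a \<in> Poly_Mapping.keys f" "b \<in> Poly_Mapping.keys g"
      using subsetD[OF keys_mult w] by blast
    then show ?thesis
      using assms by (auto simp: carrier_free_ring word_of_def plus_free_mon_def)
  qed
  then show ?thesis by (simp add: carrier_free_ring)
qed

lemma one_in_carrier: "1 \<in> carrier (free_ring N)"
  by (simp add: carrier_free_ring word_of_def zero_free_mon_def)

lemma ring_free_ring: "ring (free_ring N)"
proof (rule ringI)
  show "abelian_group (free_ring N)"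
  proof (rule abelian_groupI)
    fix f assume "f \<in> carrier (free_ring N)"
    then show "\<exists>y\<in>carrier (free_ring N). y \<oplus>\<^bsub>free_ring N\<^esub> f = \<zero>\<^bsub>free_ring N\<^esub>"
      using free_vs.subspace_neg[OF subspace_carrier] by (intro bexI[of _ "- f"]) auto
  qed (auto simp: add.assoc add.commute free_vs.subspace_add[OF subspace_carrier]
      free_vs.subspace_0[OF subspace_carrier])
  show "monoid (free_ring N)"
    by (rule monoidI) (auto simp: mult.assoc mult_in_carrier one_in_carrier)
qed (auto simp: distrib_left distrib_right)

lemma ideal_free_ringI:
  assumes "S \<subseteq> carrier (free_ring N)" "free_vs.subspace S"
    "\<And>x f. x \<in> carrier (free_ring N) \<Longrightarrow> f \<in> S \<Longrightarrow> x * f \<in> S"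
    "\<And>x f. x \<in> carrier (free_ring N) \<Longrightarrow> f \<in> S \<Longrightarrow> f * x \<in> S"
  shows "ideal S (free_ring N)"
proof (rule idealI[OF ring_free_ring])
  interpret F: ring "free_ring N" by (rule ring_free_ring)
  show "subgroup S (add_monoid (free_ring N))"
  proof (rule F.add.subgroupI)
    show "S \<noteq> {}" using free_vs.subspace_0[OF assms(2)] by blast
  next
    fix f assume f: "f \<in> S"
    then have "- f \<in> S" by (rule free_vs.subspace_neg[OF assms(2)])
    moreover have "\<ominus>\<^bsub>free_ring N\<^esub> f = - f"
      using f \<open>- f \<in> S\<close> assms(1) by (intro F.minus_equality) auto
    ultimately show "\<ominus>\<^bsub>free_ring N\<^esub> f \<in> S" by simp
  qed (use assms(1) in \<open>auto intro: free_vs.subspace_add[OF assms(2)]\<close>)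
qed (use assms(3,4) in auto)

lemma lin_ext_in_carrier:
  "(\<And>w. w \<in> Poly_Mapping.keys f \<Longrightarrow> \<phi> w \<in> carrier (free_ring N)) \<Longrightarrow>
    lin_ext \<phi> f \<in> carrier (free_ring N)"
  by (rule lin_ext_mem_subspace[OF subspace_carrier])

lemma free_star_eq: "free_star f = lin_ext (\<lambda>w. basis_vec (Word (rev (letters w)))) (conj_coeffs f)"
  by (simp add: free_star_def antilin_ext_eq)

lemma free_star_add: "free_star (f + g) = free_star f + free_star g"
  and free_star_diff: "free_star (f - g) = free_star f - free_star g"
  and free_star_vscale: "free_star (vscale c f) = vscale (cnj c) (free_star f)"
  and free_star_zero [simp]: "free_star 0 = 0"
  and free_star_basis [simp]: "free_star (basis_vec w) = basis_vec (Word (rev (letters w)))"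
  by (simp_all add: free_star_eq conj_coeffs_add conj_coeffs_diff conj_coeffs_vscale
      lin_ext_add lin_ext_diff lin_ext_vscale)

lemma free_star_sum: "free_star (\<Sum>i\<in>A. h i) = (\<Sum>i\<in>A. free_star (h i))"
  by (induction A rule: infinite_finite_induct) (auto simp: free_star_add)

lemma free_star_lin_ext: "free_star (lin_ext \<phi> f) = lin_ext (\<lambda>x. free_star (\<phi> x)) (conj_coeffs f)"
  by (simp add: lin_ext_def free_star_sum free_star_vscale)

lemma conj_coeffs_lin_ext: "conj_coeffs (lin_ext \<phi> f) = lin_ext (\<lambda>x. conj_coeffs (\<phi> x)) (conj_coeffs f)"
  by (rule poly_mapping_eqI) (simp add: lookup_lin_ext)

lemma conj_coeffs_conj_coeffs [simp]: "conj_coeffs (conj_coeffs f) = f"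
  by (rule poly_mapping_eqI) simp

lemma free_star_mult: "free_star (f * g) = free_star g * free_star f"
proof -
  have "free_star (f * g) = lin_ext (\<lambda>v. lin_ext (\<lambda>w. basis_vec (Word (rev (letters w) @ rev (letters v))))
      (conj_coeffs g)) (conj_coeffs f)"
    by (simp add: mult_eq_lin_ext free_star_lin_ext plus_free_mon_def)
  also have "\<dots> = lin_ext (\<lambda>v. free_star g * basis_vec (Word (rev (letters v)))) (conj_coeffs f)"
    by (simp add: free_star_eq lin_ext_mult_left mult_single plus_free_mon_def)
  also have "\<dots> = free_star g * free_star f"
    by (simp add: free_star_eq[of f] lin_ext_mult_right)
  finally show ?thesis .
qed

lemma free_star_u_gen [simp]: "free_star (u_gen i j) = u_gen i j"
  by (simp add: u_gen_def)

lemma free_star_one [simp]: "free_star 1 = 1"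
  using free_star_basis[of 0] by (simp add: zero_free_mon_def[symmetric])
    (metis free_mon.sel rev.simps(1) single_one zero_free_mon_def)

lemma free_star_free_star [simp]: "free_star (free_star f) = f"
  by (simp add: free_star_eq[of f] free_star_lin_ext lin_ext_basis_vec)

lemma free_star_in_carrier: "f \<in> carrier (free_ring N) \<Longrightarrow> free_star f \<in> carrier (free_ring N)"
  unfolding free_star_eq
  by (rule lin_ext_in_carrier) (auto simp: carrier_free_ring word_of_def)


section \<open>Intertwiners modulo an ideal\<close>

definition intertw :: "nat \<Rightarrow> nat \<Rightarrow> nat \<Rightarrow> (nat list \<Rightarrow> nat list \<Rightarrow> complex) \<Rightarrow>
    nat list \<Rightarrow> nat list \<Rightarrow> free_alg"
  where "intertw N k l A i j =
    (\<Sum>m\<in>multi_indices N k. vscale (A i m) (wd m j)) - (\<Sum>m\<in>multi_indices N l. vscale (A m j) (wd i m))"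

lemma intertw_add: "intertw N k l (\<lambda>i j. A i j + B i j) i j = intertw N k l A i j + intertw N k l B i j"
  by (simp add: intertw_def free_vs.scale_left_distrib sum.distrib)

lemma intertw_scale: "intertw N k l (\<lambda>i j. c * A i j) i j = vscale c (intertw N k l A i j)"
  by (simp add: intertw_def free_vs.scale_sum_right free_vs.scale_right_diff_distrib)

text \<open>The Leibniz rule \<open>AB u - u AB = A (B u - u B) + (A u - u A) B\<close>.\<close>

lemma intertw_comp:
  "intertw N k m (mat_comp N l A B) i j =
    (\<Sum>n\<in>multi_indices N l. vscale (A i n) (intertw N k l B n j)) +
    (\<Sum>n\<in>multi_indices N l. vscale (B n j) (intertw N l m A i n))"
proof -
  have 1: "(\<Sum>a\<in>multi_indices N k. vscale (mat_comp N l A B i a) (wd a j)) =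
      (\<Sum>n\<in>multi_indices N l. vscale (A i n) (\<Sum>a\<in>multi_indices N k. vscale (B n a) (wd a j)))"
    by (simp add: mat_comp_def free_vs.scale_sum_left free_vs.scale_sum_right sum.swap[of _ "multi_indices N k"])
  have 2: "(\<Sum>a\<in>multi_indices N m. vscale (mat_comp N l A B a j) (wd i a)) =
      (\<Sum>n\<in>multi_indices N l. vscale (B n j) (\<Sum>a\<in>multi_indices N m. vscale (A a n) (wd i a)))"
    by (simp add: mat_comp_def free_vs.scale_sum_left free_vs.scale_sum_right
        sum.swap[of _ "multi_indices N m"] mult.commute)
  have 3: "(\<Sum>n\<in>multi_indices N l. vscale (A i n) (\<Sum>a\<in>multi_indices N l. vscale (B a j) (wd n a))) =
      (\<Sum>n\<in>multi_indices N l. vscale (B n j) (\<Sum>a\<in>multi_indices N l. vscale (A i a) (wd a n)))"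
    unfolding free_vs.scale_sum_right by (subst sum.swap) (simp add: mult.commute)
  show ?thesis
    unfolding intertw_def 1 2 free_vs.scale_right_diff_distrib sum_subtractf 3 by simp
qed

text \<open>The Leibniz rule for tensor products, inserting the mixed term \<open>u A\<close> times
  \<open>B u\<close>.\<close>

lemma intertw_tensor:
  assumes "i \<in> multi_indices N l" "i' \<in> multi_indices N l'"
    "j \<in> multi_indices N k" "j' \<in> multi_indices N k'"
  shows "intertw N (k + k') (l + l') (mat_tensor k l A B) (i @ i') (j @ j') =
    intertw N k l A i j * (\<Sum>m\<in>multi_indices N k'. vscale (B i' m) (wd m j')) +
    (\<Sum>m\<in>multi_indices N l. vscale (A m j) (wd i m)) * intertw N k' l' B i' j'"
proof -
  note len = assms[THEN length_multi_index]
  have 1: "(\<Sum>m\<in>multi_indices N (k + k'). vscale (mat_tensor k l A B (i @ i') m) (wd m (j @ j'))) =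
      (\<Sum>m\<in>multi_indices N k. vscale (A i m) (wd m j)) * (\<Sum>m\<in>multi_indices N k'. vscale (B i' m) (wd m j'))"
    unfolding sum_multi_indices_add sum_product
    by (intro sum.cong refl)
      (simp add: mat_tensor_def len length_multi_index wd_append[symmetric] vscale_mult_left vscale_mult_right)
  have 2: "(\<Sum>m\<in>multi_indices N (l + l'). vscale (mat_tensor k l A B m (j @ j')) (wd (i @ i') m)) =
      (\<Sum>m\<in>multi_indices N l. vscale (A m j) (wd i m)) * (\<Sum>m\<in>multi_indices N l'. vscale (B m j') (wd i' m))"
    unfolding sum_multi_indices_add sum_product
    by (intro sum.cong refl)
      (simp add: mat_tensor_def len length_multi_index wd_append[symmetric] vscale_mult_left vscale_mult_right)
  show ?thesis
    unfolding intertw_def 1 2 by (simp add: algebra_simps)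
qed

lemma sum_mat_id:
  assumes "i \<in> multi_indices N k"
  shows "(\<Sum>m\<in>multi_indices N k. vscale (mat_id N k i m) (f m)) = f i"
    "(\<Sum>m\<in>multi_indices N k. vscale (mat_id N k m i) (f m)) = f i"
proof -
  have "(\<Sum>m\<in>multi_indices N k. vscale (mat_id N k i m) (f m)) =
      (\<Sum>m\<in>multi_indices N k. if i = m then f m else 0)"
    by (intro sum.cong) (auto simp: mat_id_def assms)
  then show "(\<Sum>m\<in>multi_indices N k. vscale (mat_id N k i m) (f m)) = f i"
    using assms by simp
  have "(\<Sum>m\<in>multi_indices N k. vscale (mat_id N k m i) (f m)) =
      (\<Sum>m\<in>multi_indices N k. if i = m then f m else 0)"
    by (intro sum.cong) (auto simp: mat_id_def assms)
  then show "(\<Sum>m\<in>multi_indices N k. vscale (mat_id N k m i) (f m)) = f i"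
    using assms by simp
qed

lemma intertw_id:
  assumes "i \<in> multi_indices N k" "j \<in> multi_indices N k"
  shows "intertw N k k (mat_id N k) i j = 0"
  using assms by (simp add: intertw_def sum_mat_id)

lemma intertw_in_carrier:
  assumes "i \<in> multi_indices N l" "j \<in> multi_indices N k"
  shows "intertw N k l A i j \<in> carrier (free_ring N)"
  unfolding intertw_def using assms
  by (intro free_vs.subspace_diff[OF subspace_carrier] free_vs.subspace_sum[OF subspace_carrier]
      free_vs.subspace_scale[OF subspace_carrier] wd_in_carrier)

lemma free_star_intertw:
  "free_star (intertw N k l A i j) =
    (\<Sum>m\<in>multi_indices N k. vscale (cnj (A i m)) (free_star (wd m j))) -
    (\<Sum>m\<in>multi_indices N l. vscale (cnj (A m j)) (free_star (wd i m)))"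
  by (simp add: intertw_def free_star_diff free_star_sum free_star_vscale)

locale free_ideal =
  fixes N :: nat and J :: "free_alg set"
  assumes ideal: "ideal J (free_ring N)"
begin

lemma J_carrier: "f \<in> J \<Longrightarrow> f \<in> carrier (free_ring N)"
  by (rule ideal.Icarr[OF ideal])

lemma J_zero [simp]: "0 \<in> J"
  using additive_subgroup.zero_closed[OF ideal.axioms(1)[OF ideal]] by simp

lemma J_add: "f \<in> J \<Longrightarrow> g \<in> J \<Longrightarrow> f + g \<in> J"
  using additive_subgroup.a_closed[OF ideal.axioms(1)[OF ideal]] by simp

lemma J_mult_left: "f \<in> J \<Longrightarrow> x \<in> carrier (free_ring N) \<Longrightarrow> x * f \<in> J"
  using ideal.I_l_closed[OF ideal] by simp

lemma J_mult_right: "f \<in> J \<Longrightarrow> x \<in> carrier (free_ring N) \<Longrightarrow> f * x \<in> J"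
  using ideal.I_r_closed[OF ideal] by simp

lemma J_scale: "f \<in> J \<Longrightarrow> vscale c f \<in> J"
  using J_mult_left[of f "vscale c 1"] free_vs.subspace_scale[OF subspace_carrier one_in_carrier]
  by (simp add: vscale_mult_left)

lemma subspace_J: "free_vs.subspace J"
  by (rule free_vs.subspaceI) (auto intro: J_add J_scale)

lemma J_diff: "f \<in> J \<Longrightarrow> g \<in> J \<Longrightarrow> f - g \<in> J"
  by (rule free_vs.subspace_diff[OF subspace_J])

lemma J_uminus: "f \<in> J \<Longrightarrow> - f \<in> J"
  by (rule free_vs.subspace_neg[OF subspace_J])

lemma J_sum: "(\<And>x. x \<in> A \<Longrightarrow> f x \<in> J) \<Longrightarrow> sum f A \<in> J"
  by (rule free_vs.subspace_sum[OF subspace_J])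

lemma J_trans: "f - g \<in> J \<Longrightarrow> g - h \<in> J \<Longrightarrow> f - h \<in> J"
  using J_add[of "f - g" "g - h"] by simp

lemma J_sum_diff: "(\<And>x. x \<in> A \<Longrightarrow> f x - g x \<in> J) \<Longrightarrow> sum f A - sum g A \<in> J"
  using J_sum[of A "\<lambda>x. f x - g x"] by (simp add: sum_subtractf)

lemma J_lin_ext_diff:
  "(\<And>x. x \<in> Poly_Mapping.keys f \<Longrightarrow> \<phi> x - \<psi> x \<in> J) \<Longrightarrow> lin_ext \<phi> f - lin_ext \<psi> f \<in> J"
  unfolding lin_ext_def
  by (rule J_sum_diff) (simp add: free_vs.scale_right_diff_distrib[symmetric] J_scale)

end

text \<open>Kept abstract because it serves twice: for the defining ideal of a quantum group, and
  for the kernel of the evaluation at an orthogonal matrix in the proof of non-easiness.\<close>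

locale orth_ideal = free_ideal +
  assumes star: "f \<in> J \<Longrightarrow> free_star f \<in> J"
    and orth: "orthogonality N \<subseteq> J"
begin

lemma orth_rows:
  "i \<in> {1..N} \<Longrightarrow> j \<in> {1..N} \<Longrightarrow> (\<Sum>k=1..N. u_gen i k * u_gen j k) - (if i = j then 1 else 0) \<in> J"
  using orth unfolding orthogonality_def by blast

lemma orth_cols:
  "i \<in> {1..N} \<Longrightarrow> j \<in> {1..N} \<Longrightarrow> (\<Sum>k=1..N. u_gen k i * u_gen k j) - (if i = j then 1 else 0) \<in> J"
  using orth unfolding orthogonality_def by blast

text \<open>The star reverses words, so the sum over the tails is sandwiched between the two first
  letters: the induction hypothesis collapses it, and row orthogonality does the rest.\<close>

lemma wd_mult_star:
  "i \<in> multi_indices N k \<Longrightarrow> j \<in> multi_indices N k \<Longrightarrow>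
    (\<Sum>m\<in>multi_indices N k. wd i m * free_star (wd j m)) - (if i = j then 1 else 0) \<in> J"
proof (induction k arbitrary: i j)
  case (Suc k)
  from Suc.prems obtain a i' b j' where ij: "i = a # i'" "j = b # j'" "a \<in> {1..N}" "b \<in> {1..N}"
      "i' \<in> multi_indices N k" "j' \<in> multi_indices N k"
    unfolding multi_indices_Suc by auto
  define d :: free_alg where "d = (if i' = j' then 1 else 0)"
  define S where "S = (\<Sum>m\<in>multi_indices N k. wd i' m * free_star (wd j' m))"
  have S: "S - d \<in> J" using Suc.IH[OF ij(5,6)] by (simp add: S_def d_def)
  have e: "(\<Sum>m\<in>multi_indices N (Suc k). wd i m * free_star (wd j m)) =
      (\<Sum>c=1..N. u_gen a c * S * u_gen b c)"
    unfolding sum_multi_indices_Suc S_def ij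
    by (simp add: wd_Cons free_star_mult mult.assoc sum_distrib_left sum_distrib_right)
  have 1: "(\<Sum>c=1..N. u_gen a c * S * u_gen b c) - (\<Sum>c=1..N. u_gen a c * d * u_gen b c) \<in> J"
  proof (rule J_sum_diff)
    fix c assume "c \<in> {1..N}"
    then have "u_gen a c * (S - d) * u_gen b c \<in> J"
      using S ij by (intro J_mult_left J_mult_right u_gen_in_carrier)
    then show "u_gen a c * S * u_gen b c - u_gen a c * d * u_gen b c \<in> J"
      by (simp add: algebra_simps)
  qed
  have 2: "(\<Sum>c=1..N. u_gen a c * d * u_gen b c) - (if i = j then 1 else 0) \<in> J"
  proof (cases "i' = j'")
    case True
    then show ?thesis using orth_rows[OF ij(3,4)] by (simp add: d_def ij)
  next
    case False
    then show ?thesis by (simp add: d_def ij)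
  qed
  show ?case unfolding e by (rule J_trans[OF 1 2])
qed auto

text \<open>Here the first letters meet in the middle, so column orthogonality collapses them before
  the induction hypothesis applies to the tails.\<close>

lemma star_mult_wd:
  "i \<in> multi_indices N k \<Longrightarrow> j \<in> multi_indices N k \<Longrightarrow>
    (\<Sum>m\<in>multi_indices N k. free_star (wd m i) * wd m j) - (if i = j then 1 else 0) \<in> J"
proof (induction k arbitrary: i j)
  case (Suc k)
  from Suc.prems obtain a i' b j' where ij: "i = a # i'" "j = b # j'" "a \<in> {1..N}" "b \<in> {1..N}"
      "i' \<in> multi_indices N k" "j' \<in> multi_indices N k"
    unfolding multi_indices_Suc by auto
  define d :: free_alg where "d = (if a = b then 1 else 0)"
  define S where "S = (\<Sum>c=1..N. u_gen c a * u_gen c b)"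
  have S: "S - d \<in> J" using orth_cols[OF ij(3,4)] by (simp add: S_def d_def)
  have e: "(\<Sum>m\<in>multi_indices N (Suc k). free_star (wd m i) * wd m j) =
      (\<Sum>m\<in>multi_indices N k. free_star (wd m i') * S * wd m j')"
    unfolding sum_multi_indices_Suc S_def ij
    by (subst sum.swap) (simp add: wd_Cons free_star_mult mult.assoc sum_distrib_left sum_distrib_right)
  have 1: "(\<Sum>m\<in>multi_indices N k. free_star (wd m i') * S * wd m j') -
      (\<Sum>m\<in>multi_indices N k. free_star (wd m i') * d * wd m j') \<in> J"
  proof (rule J_sum_diff)
    fix m assume "m \<in> multi_indices N k"
    then have "free_star (wd m i') * (S - d) * wd m j' \<in> J"
      using S ij by (intro J_mult_left J_mult_right free_star_in_carrier wd_in_carrier)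
    then show "free_star (wd m i') * S * wd m j' - free_star (wd m i') * d * wd m j' \<in> J"
      by (simp add: algebra_simps)
  qed
  have 2: "(\<Sum>m\<in>multi_indices N k. free_star (wd m i') * d * wd m j') - (if i = j then 1 else 0) \<in> J"
    using Suc.IH[OF ij(5,6)] by (cases "a = b") (simp_all add: d_def ij)
  show ?case unfolding e by (rule J_trans[OF 1 2])
qed auto

text \<open>Modulo \<open>J\<close>, the word matrices are invertible with inverse \<open>free_star (wd j i)\<close>; hence
  starring the relation \<open>A u = u A\<close> and multiplying with the word matrices on both sides gives
  \<open>A\<^sup>* u = u A\<^sup>*\<close>.\<close>

lemma intertw_adj:
  assumes A: "\<And>i j. i \<in> multi_indices N l \<Longrightarrow> j \<in> multi_indices N k \<Longrightarrow> intertw N k l A i j \<in> J"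
    and j: "j \<in> multi_indices N k" and i: "i \<in> multi_indices N l"
  shows "intertw N l k (mat_adj A) j i \<in> J"
proof -
  let ?K = "multi_indices N k" and ?L = "multi_indices N l"
  let ?\<delta> = "\<lambda>x y. (if x = y then 1 else 0) :: free_alg"
  \<comment> \<open>\<open>X\<close> and \<open>Y\<close> are the two halves of the entry of
    \<open>u (A u - u A)^* u\<close> at \<open>(j, i)\<close>. In \<open>X\<close> a factor
    \<open>u u^*\<close> collapses, in \<open>Y\<close> a factor \<open>u^* u\<close>.\<close>
  define X where "X = (\<Sum>p\<in>?L. \<Sum>q\<in>?K. \<Sum>n\<in>?K.
    vscale (cnj (A p n)) (wd j q * free_star (wd n q) * wd p i))"
  define Y where "Y = (\<Sum>p\<in>?L. \<Sum>q\<in>?K. \<Sum>n\<in>?L.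
    vscale (cnj (A n q)) (wd j q * (free_star (wd p n) * wd p i)))"
  have "X - Y = (\<Sum>p\<in>?L. \<Sum>q\<in>?K. wd j q * free_star (intertw N k l A p q) * wd p i)"
    unfolding X_def Y_def free_star_intertw
    by (simp add: sum_subtractf sum_distrib_left sum_distrib_right vscale_mult_left
        vscale_mult_right right_diff_distrib left_diff_distrib mult.assoc)
  also have "\<dots> \<in> J"
    by (intro J_sum J_mult_right J_mult_left star A) (use i j wd_in_carrier in auto)
  finally have XY: "X - Y \<in> J" .
  have "X = (\<Sum>p\<in>?L. \<Sum>n\<in>?K. vscale (cnj (A p n)) ((\<Sum>q\<in>?K. wd j q * free_star (wd n q)) * wd p i))"
    unfolding X_def
    by (rule sum.cong[OF refl], subst sum.swap) (simp add: sum_distrib_right free_vs.scale_sum_right)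
  also have "\<dots> - (\<Sum>p\<in>?L. \<Sum>n\<in>?K. vscale (cnj (A p n)) (?\<delta> j n * wd p i)) \<in> J"
  proof (intro J_sum_diff)
    fix p n assume "p \<in> ?L" "n \<in> ?K"
    then have "vscale (cnj (A p n)) (((\<Sum>q\<in>?K. wd j q * free_star (wd n q)) - ?\<delta> j n) * wd p i) \<in> J"
      using i j by (intro J_scale J_mult_right wd_mult_star wd_in_carrier)
    then show "vscale (cnj (A p n)) ((\<Sum>q\<in>?K. wd j q * free_star (wd n q)) * wd p i) -
        vscale (cnj (A p n)) (?\<delta> j n * wd p i) \<in> J"
      by (simp only: left_diff_distrib free_vs.scale_right_diff_distrib)
  qed
  also have "(\<Sum>p\<in>?L. \<Sum>n\<in>?K. vscale (cnj (A p n)) (?\<delta> j n * wd p i)) =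
      (\<Sum>p\<in>?L. vscale (mat_adj A j p) (wd p i))"
    using j by (simp add: mat_adj_def if_distrib[of "\<lambda>x. x * _"] if_distrib[of "vscale _"] cong: if_cong)
  finally have X: "X - (\<Sum>p\<in>?L. vscale (mat_adj A j p) (wd p i)) \<in> J" .
  have "Y = (\<Sum>q\<in>?K. \<Sum>n\<in>?L. vscale (cnj (A n q)) (wd j q * (\<Sum>p\<in>?L. free_star (wd p n) * wd p i)))"
    unfolding Y_def
    by (subst sum.swap, rule sum.cong[OF refl], subst sum.swap) (simp add: sum_distrib_left free_vs.scale_sum_right)
  also have "\<dots> - (\<Sum>q\<in>?K. \<Sum>n\<in>?L. vscale (cnj (A n q)) (wd j q * ?\<delta> n i)) \<in> J"
  proof (intro J_sum_diff)
    fix q n assume "q \<in> ?K" "n \<in> ?L"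
    then have "vscale (cnj (A n q)) (wd j q * ((\<Sum>p\<in>?L. free_star (wd p n) * wd p i) - ?\<delta> n i)) \<in> J"
      using i j by (intro J_scale J_mult_left star_mult_wd wd_in_carrier)
    then show "vscale (cnj (A n q)) (wd j q * (\<Sum>p\<in>?L. free_star (wd p n) * wd p i)) -
        vscale (cnj (A n q)) (wd j q * ?\<delta> n i) \<in> J"
      by (simp only: right_diff_distrib free_vs.scale_right_diff_distrib)
  qed
  also have "(\<Sum>q\<in>?K. \<Sum>n\<in>?L. vscale (cnj (A n q)) (wd j q * ?\<delta> n i)) =
      (\<Sum>q\<in>?K. vscale (mat_adj A q i) (wd j q))"
    using i by (simp add: mat_adj_def if_distrib[of "\<lambda>x. _ * x"] if_distrib[of "vscale _"] cong: if_cong)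
  finally have Y: "Y - (\<Sum>q\<in>?K. vscale (mat_adj A q i) (wd j q)) \<in> J" .
  have "intertw N l k (mat_adj A) j i = (X - Y) - (X - (\<Sum>p\<in>?L. vscale (mat_adj A j p) (wd p i))) +
      (Y - (\<Sum>q\<in>?K. vscale (mat_adj A q i) (wd j q)))"
    by (simp add: intertw_def)
  also have "\<dots> \<in> J" by (intro J_add J_diff XY X Y)
  finally show ?thesis .
qed

end

section \<open>The signs\<close>

text \<open>The bicharacter of the cocycle, read off from index words directly; it depends on their
  degrees only (\<open>chi_eq_bicharacter\<close>).\<close>

definition chi :: "nat list \<Rightarrow> nat list \<Rightarrow> complex"
  where "chi is js = (\<Prod>i\<leftarrow>is. \<Prod>j\<leftarrow>js. if i < j then -1 else 1)"

text \<open>The sign is \<open>-1\<close> to the number of position pairs \<open>p < q\<close> whose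
  letters increase. It accumulates when a word is multiplied up letter by letter in the twisted
  algebra.\<close>

primrec sg :: "nat list \<Rightarrow> complex"
  where "sg [] = 1" | "sg (i # is) = chi [i] is * sg is"

definition deg :: "nat list \<Rightarrow> (nat \<Rightarrow>\<^sub>0 bit)"
  where "deg is = (\<Sum>i\<leftarrow>is. z2_gen i)"

lemma prod_list_distrib: "(\<Prod>x\<leftarrow>xs. f x * g x) = (\<Prod>x\<leftarrow>xs. f x) * (\<Prod>x\<leftarrow>xs. g x)"
  for f g :: "'a \<Rightarrow> 'b::comm_monoid_mult"
  by (induction xs) (simp_all add: ac_simps)

lemma chi_Nil [simp]: "chi [] js = 1" "chi is [] = 1"
  by (simp_all add: chi_def map_replicate_const prod_list_replicate)

lemma chi_append_left: "chi (i @ i') j = chi i j * chi i' j"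
  by (simp add: chi_def)

lemma chi_append_right: "chi i (j @ j') = chi i j * chi i j'"
  by (simp add: chi_def prod_list_distrib)

lemma chi_Cons_left: "chi (a # i) j = chi [a] j * chi i j"
  using chi_append_left[of "[a]" i j] by simp

lemma chi_Cons_right: "chi i (b # j) = chi i [b] * chi i j"
  using chi_append_right[of i "[b]" j] by simp

lemma chi_single: "chi [a] [b] = (if a < b then -1 else 1)"
  by (simp add: chi_def)

lemma prod_list_sq_eq_1:
  "(\<And>x. x \<in> set xs \<Longrightarrow> x * x = 1) \<Longrightarrow> prod_list xs * prod_list xs = (1 :: 'a::comm_monoid_mult)"
proof (induction xs)
  case (Cons a xs)
  have "prod_list (a # xs) * prod_list (a # xs) = (a * a) * (prod_list xs * prod_list xs)"
    by (simp add: ac_simps)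
  also have "\<dots> = 1" using Cons by simp
  finally show ?case .
qed simp

lemma chi_sq: "chi i j * chi i j = 1"
  unfolding chi_def by (intro prod_list_sq_eq_1) (auto intro!: prod_list_sq_eq_1)

lemma sg_sq: "sg i * sg i = 1"
proof (induction i)
  case (Cons a i)
  have "sg (a # i) * sg (a # i) = (chi [a] i * chi [a] i) * (sg i * sg i)"
    by (simp add: ac_simps)
  then show ?case using Cons by (simp add: chi_sq)
qed simp

text \<open>On words, \<open>chi\<close> is thus the coboundary of \<open>sg\<close>. Only
  \<open>chi\<close> descends to degrees: \<open>[1, 2]\<close> and \<open>[2, 1]\<close> have equal
  degree but different \<open>sg\<close>.\<close>

lemma sg_append: "sg (i @ j) = sg i * sg j * chi i j"
proof (induction i)
  case (Cons a i)
  then show ?case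
    by (subst chi_Cons_left) (simp add: chi_append_right ac_simps)
qed simp

lemma cnj_chi [simp]: "cnj (chi i j) = chi i j"
proof -
  have *: "cnj (prod_list xs) = prod_list (map cnj xs)" for xs :: "complex list"
    by (induction xs) simp_all
  show ?thesis
    by (simp add: chi_def * o_def if_distrib[of cnj] cong: if_cong)
qed

lemma cnj_sg [simp]: "cnj (sg i) = sg i"
  by (induction i) simp_all

lemma deg_Nil [simp]: "deg [] = 0"
  and deg_Cons: "deg (a # i) = z2_gen a + deg i"
  and deg_append: "deg (i @ j) = deg i + deg j"
  and deg_rev [simp]: "deg (rev i) = deg i"
  by (simp_all add: deg_def sum_list_rev rev_map[symmetric])

lemma bicharacter_0 [simp]: "bicharacter N \<sigma> 0 g = 1" "bicharacter N \<sigma> g 0 = 1"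
  by (simp_all add: bicharacter_def)

text \<open>Both sides are multiplicative in each argument and agree on single letters.\<close>

lemma chi_eq_bicharacter:
  assumes \<sigma>: "\<And>i j. i \<in> {1..N} \<Longrightarrow> j \<in> {1..N} \<Longrightarrow> \<sigma> i j = (if i < j then -1 else 1)"
    and i: "i \<in> multi_indices N k" and j: "j \<in> multi_indices N l"
  shows "chi i j = bicharacter N \<sigma> (deg i) (deg j)"
proof -
  have \<sigma>': "\<And>i j. i \<in> {1..N} \<Longrightarrow> j \<in> {1..N} \<Longrightarrow> \<sigma> i j \<in> {1, -1}" using \<sigma> by auto
  have bim: "bicharacter N \<sigma> (g1 + g2) g' = bicharacter N \<sigma> g1 g' * bicharacter N \<sigma> g2 g'"
      "bicharacter N \<sigma> g' (g1 + g2) = bicharacter N \<sigma> g' g1 * bicharacter N \<sigma> g' g2" for g1 g2 g'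
    by (rule bicharacter_bimultiplicative, rule \<sigma>'; assumption)+
  have single: "chi [a] j = bicharacter N \<sigma> (z2_gen a) (deg j)"
    if "a \<in> {1..N}" "set j \<subseteq> {1..N}" for a j
    using that(2)
  proof (induction j)
    case (Cons b j)
    then show ?case
      using that(1) by (subst chi_Cons_right)
        (simp add: deg_Cons bim(2) bicharacter_generators \<sigma> chi_single)
  qed simp
  have "set i \<subseteq> {1..N}" "set j \<subseteq> {1..N}" using i j by (auto simp: multi_indices_def)
  then show ?thesis
  proof (induction i)
    case (Cons a i)
    then show ?case
      using single[of a j] by (subst chi_Cons_left)
        (simp add: deg_Cons bim(1))
  qed simp
qed

lemma chi_deg_cong:
  assumes "i \<in> multi_indices N k" "i' \<in> multi_indices N k'" "j \<in> multi_indices N l"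
    "j' \<in> multi_indices N l'" "deg i = deg i'" "deg j = deg j'"
  shows "chi i j = chi i' j'"
  using chi_eq_bicharacter[of N "\<lambda>i j. if i < j then -1 else 1"] assms by metis

text \<open>Conjugation by the diagonal matrices with entries \<open>sg\<close>. Hence it is an
  involution and respects composition and adjoints; tensor products are where degrees enter
  (\<open>tw_tensor\<close>).\<close>

definition tw :: "(nat list \<Rightarrow> nat list \<Rightarrow> complex) \<Rightarrow> nat list \<Rightarrow> nat list \<Rightarrow> complex"
  where "tw A i j = sg i * sg j * A i j"

lemma tw_tw [simp]: "tw (tw A) = A"
proof (intro ext)
  fix i j
  have "tw (tw A) i j = (sg i * sg i) * (sg j * sg j) * A i j" by (simp add: tw_def ac_simps)
  then show "tw (tw A) i j = A i j" by (simp add: sg_sq)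
qed

lemma tw_eq_0_iff: "tw A i j = 0 \<longleftrightarrow> A i j = 0"
  using sg_sq[of i] sg_sq[of j] by (auto simp: tw_def)

lemma tw_comp: "tw (mat_comp N l A B) = mat_comp N l (tw A) (tw B)"
proof (intro ext)
  fix i j
  have "tw A i n * tw B n j = sg i * sg j * (A i n * B n j) * (sg n * sg n)" for n
    by (simp add: tw_def ac_simps)
  then show "tw (mat_comp N l A B) i j = mat_comp N l (tw A) (tw B) i j"
    by (simp add: mat_comp_def tw_def[of "mat_comp N l A B"] sg_sq sum_distrib_left)
qed

lemma tw_adj: "tw (mat_adj A) = mat_adj (tw A)"
  by (simp add: fun_eq_iff tw_def mat_adj_def mult.commute)

lemma tw_id: "tw (mat_id N k) = mat_id N k"
  by (auto simp: fun_eq_iff tw_def mat_id_def sg_sq)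

text \<open>Equivalently, \<open>A\<close> commutes with the tensor powers of all diagonal sign
  matrices, that is, with the subgroup Z_2^N from which the cocycle is induced.\<close>

definition deg_pres :: "(nat list \<Rightarrow> nat list \<Rightarrow> complex) \<Rightarrow> bool"
  where "deg_pres A \<longleftrightarrow> (\<forall>i j. A i j \<noteq> 0 \<longrightarrow> deg i = deg j)"

lemma deg_pres_tw [simp]: "deg_pres (tw A) \<longleftrightarrow> deg_pres A"
  by (simp add: deg_pres_def tw_eq_0_iff)

lemma lin_maps_D: "A \<in> lin_maps N k l \<Longrightarrow> A i j \<noteq> 0 \<Longrightarrow> i \<in> multi_indices N l \<and> j \<in> multi_indices N k"
  by (simp add: lin_maps_def)

lemma lin_maps_tw [simp]: "tw A \<in> lin_maps N k l \<longleftrightarrow> A \<in> lin_maps N k l"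
  by (simp add: lin_maps_def tw_eq_0_iff)

lemma lin_maps_add: "A \<in> lin_maps N k l \<Longrightarrow> B \<in> lin_maps N k l \<Longrightarrow> (\<lambda>i j. A i j + B i j) \<in> lin_maps N k l"
  unfolding lin_maps_def by simp (metis add.right_neutral)

lemma lin_maps_scale: "A \<in> lin_maps N k l \<Longrightarrow> (\<lambda>i j. c * A i j) \<in> lin_maps N k l"
  by (auto simp: lin_maps_def)

lemma lin_maps_comp:
  assumes "A \<in> lin_maps N l m" "B \<in> lin_maps N k l"
  shows "mat_comp N l A B \<in> lin_maps N k m"
  using assms unfolding lin_maps_def mat_comp_def mem_Collect_eq
  by (intro allI impI) (erule sum.not_neutral_contains_not_neutral, fastforce)

lemma lin_maps_adj: "A \<in> lin_maps N k l \<Longrightarrow> mat_adj A \<in> lin_maps N l k"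
  by (auto simp: lin_maps_def mat_adj_def)

lemma lin_maps_tensor:
  "A \<in> lin_maps N k l \<Longrightarrow> B \<in> lin_maps N k' l' \<Longrightarrow> mat_tensor k l A B \<in> lin_maps N (k + k') (l + l')"
  by (auto simp: lin_maps_def mat_tensor_def multi_indices_take_drop)

lemma lin_maps_id: "mat_id N k \<in> lin_maps N k k"
  by (simp add: lin_maps_def mat_id_def)

lemma deg_pres_add: "deg_pres A \<Longrightarrow> deg_pres B \<Longrightarrow> deg_pres (\<lambda>i j. A i j + B i j)"
  unfolding deg_pres_def by (metis add.right_neutral)

lemma deg_pres_scale: "deg_pres A \<Longrightarrow> deg_pres (\<lambda>i j. c * A i j)"
  by (simp add: deg_pres_def)

lemma deg_pres_comp:
  assumes "deg_pres A" "deg_pres B"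
  shows "deg_pres (mat_comp N l A B)"
  using assms unfolding deg_pres_def mat_comp_def
  by (intro allI impI) (erule sum.not_neutral_contains_not_neutral, fastforce)

lemma deg_pres_adj: "deg_pres A \<Longrightarrow> deg_pres (mat_adj A)"
  by (auto simp: deg_pres_def mat_adj_def)

lemma deg_take_drop: "deg i = deg (take k i) + deg (drop k i)"
  by (metis append_take_drop_id deg_append)

lemma deg_pres_tensor: "deg_pres A \<Longrightarrow> deg_pres B \<Longrightarrow> deg_pres (mat_tensor k l A B)"
  unfolding deg_pres_def mat_tensor_def
  by (metis deg_take_drop mult_eq_0_iff)

lemma deg_pres_id: "deg_pres (mat_id N k)"
  by (simp add: deg_pres_def mat_id_def)

text \<open>The correction \<open>chi\<close> between \<open>sg (i @ i')\<close> and \<open>sg i * sg i'\<close> depends on degrees only,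
  so it cancels between the rows and the columns of degree-preserving matrices.\<close>

lemma tw_tensor:
  assumes A: "A \<in> lin_maps N k l" "deg_pres A" and B: "B \<in> lin_maps N k' l'" "deg_pres B"
  shows "tw (mat_tensor k l A B) = mat_tensor k l (tw A) (tw B)"
proof (intro ext)
  fix i j :: "nat list"
  let ?a = "take l i" and ?b = "drop l i" and ?c = "take k j" and ?d = "drop k j"
  show "tw (mat_tensor k l A B) i j = mat_tensor k l (tw A) (tw B) i j"
  proof (cases "A ?a ?c = 0 \<or> B ?b ?d = 0")
    case True
    then show ?thesis by (auto simp: tw_def mat_tensor_def)
  next
    case False
    then have "?a \<in> multi_indices N l" "?c \<in> multi_indices N k"
        "?b \<in> multi_indices N l'" "?d \<in> multi_indices N k'"
        "deg ?a = deg ?c" "deg ?b = deg ?d"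
      using A B by (auto dest: lin_maps_D simp: deg_pres_def)
    then have "chi ?a ?b = chi ?c ?d" by (intro chi_deg_cong)
    moreover have "sg i = sg ?a * sg ?b * chi ?a ?b" "sg j = sg ?c * sg ?d * chi ?c ?d"
      by (metis append_take_drop_id sg_append)+
    ultimately have "tw (mat_tensor k l A B) i j =
        mat_tensor k l (tw A) (tw B) i j * (chi ?c ?d * chi ?c ?d)"
      by (simp add: tw_def mat_tensor_def ac_simps)
    then show ?thesis by (simp add: chi_sq)
  qed
qed

lemma T_vec_add: "T_vec N k l (f + g) = (\<lambda>i j. T_vec N k l f i j + T_vec N k l g i j)"
  and T_vec_scale: "T_vec N k l (vscale c f) = (\<lambda>i j. c * T_vec N k l f i j)"
  and T_vec_diff: "T_vec N k l (f - g) = (\<lambda>i j. T_vec N k l f i j - T_vec N k l g i j)"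
  and T_vec_zero: "T_vec N k l 0 = (\<lambda>i j. 0)"
  by (simp_all add: fun_eq_iff T_vec_eq_lin_form lin_form_add lin_form_vscale lin_form_diff)


section \<open>The categories defined by an ideal\<close>

definition pair_mat :: "nat \<Rightarrow> nat list \<Rightarrow> nat list \<Rightarrow> complex"
  where "pair_mat N i j = (if j = [] \<and> (\<exists>a\<in>{1..N}. i = [a, a]) then 1 else 0)"

text \<open>Equal letters carry the sign \<open>+1\<close>, the inequality in \<open>chi\<close>
  being strict; so the twist leaves the orthogonality relations unchanged.\<close>

lemma tw_pair: "tw (pair_mat N) = pair_mat N"
  by (auto simp: fun_eq_iff tw_def pair_mat_def chi_single)

lemma deg_pair [simp]: "deg [a, a] = 0"
proof -
  have "x + x = 0" for x :: bit by (cases x) auto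
  then have "z2_gen a + z2_gen a = 0"
    by (intro poly_mapping_eqI) (simp only: lookup_add lookup_zero)
  then show ?thesis by (simp add: deg_Cons)
qed

lemma multi_indices_2: "i \<in> multi_indices N 2 \<longleftrightarrow> (\<exists>a\<in>{1..N}. \<exists>b\<in>{1..N}. i = [a, b])"
  by (force simp: numeral_2_eq_2 multi_indices_Suc)

lemma sum_multi_indices_2: "(\<Sum>m\<in>multi_indices N 2. f m) = (\<Sum>a=1..N. \<Sum>b=1..N. f [a, b])"
  by (simp add: numeral_2_eq_2 sum_multi_indices_Suc)

text \<open>The intertwining relations of the pair partition are, up to sign, the row orthogonality
  relations.\<close>

lemma intertw_pair:
  assumes "a \<in> {1..N}" "b \<in> {1..N}"
  shows "intertw N 0 2 (pair_mat N) [a, b] [] =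
    (if a = b then 1 else 0) - (\<Sum>c=1..N. u_gen a c * u_gen b c)"
proof -
  have "(\<Sum>m\<in>multi_indices N 2. vscale (pair_mat N m []) (wd [a, b] m)) =
      (\<Sum>c=1..N. \<Sum>d=1..N. if d = c then wd [a, b] [c, d] else 0)"
    unfolding sum_multi_indices_2
    by (intro sum.cong refl) (auto simp: pair_mat_def)
  also have "\<dots> = (\<Sum>c=1..N. u_gen a c * u_gen b c)"
    by (simp add: wd_Cons)
  finally show ?thesis
    using assms by (auto simp: intertw_def pair_mat_def)
qed

lemma T_vec_pair: "T_vec N 0 2 (basis_vec {{Inr 1, Inr 2}}) = pair_mat N"
  unfolding T_vec_basis by (simp only: fun_eq_iff T_part_pair pair_mat_def) simp

lemma T_vec_id: "T_vec N 1 1 (basis_vec {{Inl 1, Inr 1}}) = mat_id N 1"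
  unfolding T_vec_basis by (rule T_part_id)

context orth_ideal
begin

text \<open>Degree preservation is built in because closure under tensor products relies on it
  through \<open>tw_tensor\<close>.\<close>

definition interm :: "nat \<Rightarrow> nat \<Rightarrow> (nat list \<Rightarrow> nat list \<Rightarrow> complex) set"
  where "interm k l = {A \<in> lin_maps N k l. deg_pres A \<and>
    (\<forall>i\<in>multi_indices N l. \<forall>j\<in>multi_indices N k. intertw N k l (tw A) i j \<in> J)}"

lemma intermI:
  "A \<in> lin_maps N k l \<Longrightarrow> deg_pres A \<Longrightarrow>
    (\<And>i j. i \<in> multi_indices N l \<Longrightarrow> j \<in> multi_indices N k \<Longrightarrow> intertw N k l (tw A) i j \<in> J) \<Longrightarrow>
    A \<in> interm k l"
  by (simp add: interm_def)

lemma intermD: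
  assumes "A \<in> interm k l"
  shows "A \<in> lin_maps N k l" "deg_pres A"
    "\<And>i j. i \<in> multi_indices N l \<Longrightarrow> j \<in> multi_indices N k \<Longrightarrow> intertw N k l (tw A) i j \<in> J"
  using assms by (auto simp: interm_def)

lemma interm_add:
  assumes "A \<in> interm k l" "B \<in> interm k l"
  shows "(\<lambda>i j. A i j + B i j) \<in> interm k l"
proof (rule intermI)
  fix i j assume "i \<in> multi_indices N l" "j \<in> multi_indices N k"
  then show "intertw N k l (tw (\<lambda>i j. A i j + B i j)) i j \<in> J"
    using assms[THEN intermD(3)] J_add intertw_add[of N k l "tw A" "tw B"]
    by (simp add: tw_def[abs_def] distrib_left)
qed (intro lin_maps_add deg_pres_add assms[THEN intermD(1)] assms[THEN intermD(2)])+

lemma interm_scale: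
  assumes "A \<in> interm k l"
  shows "(\<lambda>i j. c * A i j) \<in> interm k l"
proof (rule intermI)
  fix i j assume "i \<in> multi_indices N l" "j \<in> multi_indices N k"
  then show "intertw N k l (tw (\<lambda>i j. c * A i j)) i j \<in> J"
    using assms[THEN intermD(3)] J_scale intertw_scale[of N k l c "tw A"]
    by (simp add: tw_def[abs_def] mult.left_commute)
qed (intro lin_maps_scale deg_pres_scale assms[THEN intermD(1)] assms[THEN intermD(2)])+

lemma interm_comp:
  assumes "A \<in> interm l m" "B \<in> interm k l"
  shows "mat_comp N l A B \<in> interm k m"
proof (rule intermI)
  fix i j assume "i \<in> multi_indices N m" "j \<in> multi_indices N k"
  then show "intertw N k m (tw (mat_comp N l A B)) i j \<in> J"
    unfolding tw_comp intertw_comp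
    by (intro J_add J_sum J_scale assms[THEN intermD(3)])
qed (use assms intermD in \<open>auto intro: lin_maps_comp deg_pres_comp\<close>)

lemma interm_adj:
  assumes "A \<in> interm k l"
  shows "mat_adj A \<in> interm l k"
proof (rule intermI)
  fix i j assume "i \<in> multi_indices N k" "j \<in> multi_indices N l"
  then show "intertw N l k (tw (mat_adj A)) i j \<in> J"
    unfolding tw_adj by (intro intertw_adj intermD(3)[OF assms])
qed (use assms intermD in \<open>auto intro: lin_maps_adj deg_pres_adj\<close>)

lemma interm_tensor:
  assumes A: "A \<in> interm k l" and B: "B \<in> interm k' l'"
  shows "mat_tensor k l A B \<in> interm (k + k') (l + l')"
proof (rule intermI)
  fix i j assume i: "i \<in> multi_indices N (l + l')" and j: "j \<in> multi_indices N (k + k')"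
  then have i': "take l i \<in> multi_indices N l" "drop l i \<in> multi_indices N l'"
    and j': "take k j \<in> multi_indices N k" "drop k j \<in> multi_indices N k'"
    by (simp_all add: multi_indices_take_drop)
  have "intertw N (k + k') (l + l') (mat_tensor k l (tw A) (tw B)) (take l i @ drop l i) (take k j @ drop k j) \<in> J"
    unfolding intertw_tensor[OF i' j']
    by (intro J_add J_mult_left J_mult_right intermD(3)[OF A] intermD(3)[OF B] i' j'
        free_vs.subspace_sum[OF subspace_carrier] free_vs.subspace_scale[OF subspace_carrier])
      (use i' j' wd_in_carrier in auto)
  then show "intertw N (k + k') (l + l') (tw (mat_tensor k l A B)) i j \<in> J"
    using tw_tensor[OF intermD(1,2)[OF A] intermD(1,2)[OF B]] by simp
qed (use A B intermD in \<open>auto intro: lin_maps_tensor deg_pres_tensor\<close>)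

lemma interm_id: "mat_id N k \<in> interm k k"
  by (rule intermI) (simp_all add: lin_maps_id deg_pres_id tw_id intertw_id)

lemma interm_pair: "pair_mat N \<in> interm 0 2"
proof (rule intermI)
  show "pair_mat N \<in> lin_maps N 0 2"
    by (auto simp: lin_maps_def pair_mat_def multi_indices_2)
  show "deg_pres (pair_mat N)"
    by (auto simp: deg_pres_def pair_mat_def)
  fix i j assume "i \<in> multi_indices N 2" "j \<in> multi_indices N 0"
  then obtain a b where "i = [a, b]" "j = []" and ab: "a \<in> {1..N}" "b \<in> {1..N}"
    by (auto simp: multi_indices_2)
  then show "intertw N 0 2 (tw (pair_mat N)) i j \<in> J"
    using J_uminus[OF orth_rows[OF ab]] by (simp add: tw_pair intertw_pair)
qed

definition ideal_category :: "nat \<Rightarrow> nat \<Rightarrow> (part \<Rightarrow>\<^sub>0 complex) set"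
  where "ideal_category k l = {f \<in> Part k l. T_vec N k l f \<in> interm k l}"

text \<open>By minimality of a generated category, it now suffices to check the intertwining
  relations for the generator.\<close>

lemma linear_category_ideal_category: "linear_category (of_nat N) ideal_category"
proof (rule linear_categoryI)
  fix k l
  show "ideal_category k l \<subseteq> Part k l" by (auto simp: ideal_category_def)
  show "free_vs.subspace (ideal_category k l)"
  proof (rule free_vs.subspaceI)
    show "0 \<in> ideal_category k l"
      using interm_scale[of _ k l 0]
        free_vs.subspace_0[OF subspace_Part]
      by (auto simp: ideal_category_def T_vec_zero intro!: intermI)
        (auto simp: lin_maps_def deg_pres_def tw_def intertw_def)
  qed (auto simp: ideal_category_def T_vec_add T_vec_scale interm_add interm_scale
      free_vs.subspace_add[OF subspace_Part] free_vs.subspace_scale[OF subspace_Part])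
next
  show "basis_vec {{Inl 1, Inr 1}} \<in> ideal_category 1 1"
    unfolding ideal_category_def mem_Collect_eq T_vec_id
    by (intro conjI interm_id) (simp only: basis_vec_in_Part id_in_partitions)
  show "basis_vec {{Inr 1, Inr 2}} \<in> ideal_category 0 2"
    unfolding ideal_category_def mem_Collect_eq T_vec_pair
    by (intro conjI interm_pair) (simp only: basis_vec_in_Part pair_in_partitions)
qed (auto simp: ideal_category_def T_vec_tensor T_vec_comp T_vec_inv vec_tensor_in_Part
    vec_comp_in_Part vec_inv_in_Part interm_tensor interm_comp interm_adj)

end


section \<open>The generators\<close>

abbreviation gen1 :: "part \<Rightarrow>\<^sub>0 complex"
  where "gen1 \<equiv> basis_vec part_crossing - vscale 2 (basis_vec part_b22)"

abbreviation gen2 :: "part \<Rightarrow>\<^sub>0 complex"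
  where "gen2 \<equiv> basis_vec part_h - vscale 2 (basis_vec part_h1) - vscale 2 (basis_vec part_h2)
    - vscale 2 (basis_vec part_h3) + vscale 4 (basis_vec part_b33)"

lemma gen1_in_Part: "gen1 \<in> Part 2 2"
  by (intro free_vs.subspace_diff free_vs.subspace_scale subspace_Part)
    (simp_all add: crossing_in_partitions b22_in_partitions)

lemma gen2_in_Part: "gen2 \<in> Part 3 3"
  by (intro free_vs.subspace_diff free_vs.subspace_add free_vs.subspace_scale subspace_Part)
    (simp_all add: h_in_partitions b33_in_partitions)

definition rev_mat :: "nat \<Rightarrow> nat \<Rightarrow> nat list \<Rightarrow> nat list \<Rightarrow> complex"
  where "rev_mat N k i j = (if j \<in> multi_indices N k \<and> i = rev j then -1 else 0)"

lemma const_on_blocks_empty [simp]: "const_on_blocks {} L"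
  by (simp add: const_on_blocks_def)

lemma const_on_blocks_insert:
  "const_on_blocks (insert (insert x B) p) L \<longleftrightarrow> (\<forall>y\<in>B. L y = L x) \<and> const_on_blocks p L"
proof -
  have "const_on_blocks {insert x B} L \<longleftrightarrow> (\<forall>y\<in>B. L y = L x)"
    unfolding const_on_blocks_def by (metis insertE insertI1 insertI2 singletonD)
  then show ?thesis
    using const_on_blocks_Un[of "{insert x B}" p L] by simp
qed

lemma multi_indices_3:
  "i \<in> multi_indices N 3 \<longleftrightarrow> (\<exists>a\<in>{1..N}. \<exists>b\<in>{1..N}. \<exists>c\<in>{1..N}. i = [a, b, c])"
  by (force simp: numeral_3_eq_3 multi_indices_Suc)

lemma rev_in_multi_indices [simp]: "rev i \<in> multi_indices N k \<longleftrightarrow> i \<in> multi_indices N k"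
  by (simp add: multi_indices_def)

text \<open>For distinct letters \<open>sg [a, b] * sg [b, a] = -1\<close> and the crossing has
  entry 1. For equal letters the sign is \<open>+1\<close>, and the coefficient of
  \<open>part_b22\<close> makes the entry \<open>1 - 2 = -1\<close>. Both cases give
  \<open>-1\<close>.\<close>

lemma tw_gen1: "tw (T_vec N 2 2 gen1) = rev_mat N 2"
proof (intro ext)
  fix i j
  show "tw (T_vec N 2 2 gen1) i j = rev_mat N 2 i j"
  proof (cases "i \<in> multi_indices N 2 \<and> j \<in> multi_indices N 2")
    case True
    then obtain a b c d where ij: "i = [a, b]" "j = [c, d]"
      unfolding multi_indices_2 by blast
    have "T_part N 2 2 part_crossing i j = (if c = b \<and> d = a then 1 else 0)"
      using True unfolding T_part_eq part_crossing_def const_on_blocks_insert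
      by (auto simp: ij point_label_def)
    moreover have "T_part N 2 2 part_b22 i j = (if c = b \<and> d = a \<and> a = b then 1 else 0)"
      using True unfolding T_part_eq part_b22_def const_on_blocks_insert
      by (auto simp: ij point_label_def)
    ultimately show ?thesis
      using True by (simp add: tw_def T_vec_diff T_vec_scale T_vec_basis rev_mat_def)
        (auto simp: ij chi_single)
  next
    case False
    then have "T_vec N 2 2 gen1 i j = 0" using T_vec_in_lin_maps lin_maps_D by blast
    then show ?thesis using False by (auto simp: tw_def rev_mat_def)
  qed
qed

text \<open>Reversing a word of length three changes \<open>sg\<close> by \<open>-1\<close> for each
  pair of distinct letters. Three distinct letters give sign \<open>-1\<close> and entry 1; exactly
  one coincidence gives sign \<open>+1\<close> and entry \<open>1 - 2\<close>; three equal letters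
  give sign \<open>+1\<close> and entry \<open>1 - 6 + 4\<close>. The product is \<open>-1\<close>
  throughout.\<close>

lemma tw_gen2: "tw (T_vec N 3 3 gen2) = rev_mat N 3"
proof (intro ext)
  fix i j
  show "tw (T_vec N 3 3 gen2) i j = rev_mat N 3 i j"
  proof (cases "i \<in> multi_indices N 3 \<and> j \<in> multi_indices N 3")
    case True
    then obtain a b c d e f where ij: "i = [a, b, c]" "j = [d, e, f]"
      unfolding multi_indices_3 by blast
    \<comment> \<open>All five partitions arise from \<open>part_h\<close> by uniting blocks, so
      every entry vanishes unless \<open>P\<close> holds.\<close>
    define P where "P \<longleftrightarrow> d = c \<and> e = b \<and> f = a"
    have P: "i = rev j \<longleftrightarrow> P" by (auto simp: ij P_def)
    have 0: "T_part N 3 3 part_h i j = (if P then 1 else 0)"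
      using True unfolding T_part_eq part_h_def const_on_blocks_insert
      by (auto simp: ij point_label_def P_def)
    have 1: "T_part N 3 3 part_h1 i j = (if P \<and> a = b then 1 else 0)"
      using True unfolding T_part_eq part_h1_def const_on_blocks_insert
      by (auto simp: ij point_label_def P_def)
    have 2: "T_part N 3 3 part_h2 i j = (if P \<and> a = c then 1 else 0)"
      using True unfolding T_part_eq part_h2_def const_on_blocks_insert
      by (auto simp: ij point_label_def P_def)
    have 3: "T_part N 3 3 part_h3 i j = (if P \<and> b = c then 1 else 0)"
      using True unfolding T_part_eq part_h3_def const_on_blocks_insert
      by (auto simp: ij point_label_def P_def)
    have 4: "T_part N 3 3 part_b33 i j = (if P \<and> a = b \<and> b = c then 1 else 0)"
      using True unfolding T_part_eq part_b33_def const_on_blocks_insert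
      by (auto simp: ij point_label_def P_def)
    have sg3: "sg [x, y, z] = (if x < y then -1 else 1) * (if x < z then -1 else 1) * (if y < z then -1 else 1)"
      for x y z
      using chi_append_right[of "[x]" "[y]" "[z]"] by (simp add: chi_single)
    have s: "sg i * sg j = (if a = b \<or> b = c \<or> a = c then 1 else -1)" if P
    proof -
      have "j = [c, b, a]" using that by (simp add: ij P_def)
      then show ?thesis unfolding ij(1)
        by (cases a b rule: linorder_cases; cases a c rule: linorder_cases;
            cases b c rule: linorder_cases; simp only: sg3; simp)
    qed
    have V: "T_vec N 3 3 gen2 i j = (if P then (if a = b \<or> b = c \<or> a = c then -1 else 1) else 0)"
      unfolding T_vec_diff T_vec_add T_vec_scale T_vec_basis 0 1 2 3 4
      by (cases P; cases "a = b"; cases "b = c"; cases "a = c"; simp)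
    show ?thesis
    proof (cases P)
      case P': True
      then show ?thesis
        unfolding tw_def V s[OF P'] rev_mat_def using P True by simp
    next
      case False
      then show ?thesis
        unfolding tw_def V rev_mat_def using P by simp
    qed
  next
    case False
    then have "T_vec N 3 3 gen2 i j = 0" using T_vec_in_lin_maps lin_maps_D by blast
    then show ?thesis using False by (auto simp: tw_def rev_mat_def)
  qed
qed

lemma intertw_rev_mat:
  assumes "i \<in> multi_indices N k" "j \<in> multi_indices N k"
  shows "intertw N k k (rev_mat N k) i j = wd i (rev j) - wd (rev i) j"
proof -
  have "(\<Sum>m\<in>multi_indices N k. vscale (rev_mat N k i m) (wd m j)) =
      (\<Sum>m\<in>multi_indices N k. if m = rev i then - wd m j else 0)"
    by (intro sum.cong refl) (auto simp: rev_mat_def)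
  moreover have "(\<Sum>m\<in>multi_indices N k. vscale (rev_mat N k m j) (wd i m)) =
      (\<Sum>m\<in>multi_indices N k. if m = rev j then - wd i m else 0)"
    using assms by (intro sum.cong refl) (auto simp: rev_mat_def)
  ultimately show ?thesis
    using assms by (simp add: intertw_def)
qed

context orth_ideal
begin

lemma interm_of_rev_mat:
  assumes "A \<in> lin_maps N k k" "tw A = rev_mat N k"
    "\<And>i j. i \<in> multi_indices N k \<Longrightarrow> j \<in> multi_indices N k \<Longrightarrow> wd i (rev j) - wd (rev i) j \<in> J"
  shows "A \<in> interm k k"
proof (rule intermI)
  have "deg_pres (rev_mat N k)"
    by (auto simp: deg_pres_def rev_mat_def)
  then show "deg_pres A" using assms(2) deg_pres_tw by metis
qed (use assms in \<open>simp_all add: intertw_rev_mat\<close>)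

text \<open>Stated for any \<open>J\<close> with commuting generators, so as to cover both the ideal
  of \<open>O_N\<close> and the kernel of an evaluation.\<close>

lemma gen1_in_ideal_category:
  assumes "\<And>a b c d. {a, b, c, d} \<subseteq> {1..N} \<Longrightarrow> u_gen a b * u_gen c d - u_gen c d * u_gen a b \<in> J"
  shows "gen1 \<in> ideal_category 2 2"
proof -
  have "wd i (rev j) - wd (rev i) j \<in> J" if "i \<in> multi_indices N 2" "j \<in> multi_indices N 2" for i j
    using that assms by (auto simp: multi_indices_2 wd_Cons)
  then show ?thesis
    using gen1_in_Part by (simp add: ideal_category_def interm_of_rev_mat T_vec_in_lin_maps tw_gen1)
qed

lemma gen2_in_ideal_category:
  assumes "\<And>a b c d e f. {a, b, c, d, e, f} \<subseteq> {1..N} \<Longrightarrow>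
    u_gen a b * u_gen c d * u_gen e f - u_gen e f * u_gen c d * u_gen a b \<in> J"
  shows "gen2 \<in> ideal_category 3 3"
proof -
  have "wd i (rev j) - wd (rev i) j \<in> J" if "i \<in> multi_indices N 3" "j \<in> multi_indices N 3" for i j
    using that assms by (auto simp: multi_indices_3 wd_Cons mult.assoc)
  then show ?thesis
    using gen2_in_Part by (simp add: ideal_category_def interm_of_rev_mat T_vec_in_lin_maps tw_gen2)
qed

end

section \<open>Tannaka--Krein reconstruction\<close>

text \<open>Induction on the support, with one Gram-Schmidt step: the functions in \<open>W\<close>
  that vanish at the new point form a subspace \<open>W'\<close> supported on \<open>S\<close>, of
  codimension at most one in \<open>W\<close>.\<close>

lemma orthogonal_projection_exists:
  fixes f :: "'a \<Rightarrow> complex"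
  assumes "finite S" "(\<lambda>x. 0) \<in> W"
    and "\<And>g h. g \<in> W \<Longrightarrow> h \<in> W \<Longrightarrow> (\<lambda>x. g x + h x) \<in> W"
    and "\<And>c g. g \<in> W \<Longrightarrow> (\<lambda>x. c * g x) \<in> W"
    and "\<And>g x. g \<in> W \<Longrightarrow> g x \<noteq> 0 \<Longrightarrow> x \<in> S"
  shows "\<exists>h\<in>W. \<forall>g\<in>W. (\<Sum>x\<in>S. (f x - h x) * cnj (g x)) = 0"
  using assms
proof (induction S arbitrary: W f rule: finite_induct)
  case empty
  then show ?case by auto
next
  case (insert x S)
  note add = insert.prems(2) and scale = insert.prems(3)
  define W' where "W' = {w \<in> W. w x = 0}"
  have IH: "\<exists>h\<in>W'. \<forall>g\<in>W'. (\<Sum>x\<in>S. (f x - h x) * cnj (g x)) = 0" for f :: "'a \<Rightarrow> complex"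
  proof (rule insert.IH)
    show "y \<in> S" if "g \<in> W'" "g y \<noteq> 0" for g y
      using insert.prems(4)[of g y] that by (auto simp: W'_def)
  qed (use insert.prems(1-3) in \<open>auto simp: W'_def\<close>)
  define ip where "ip f g = (\<Sum>y\<in>insert x S. f y * cnj (g y))" for f g :: "'a \<Rightarrow> complex"
  have ip_eq: "ip f g = (\<Sum>y\<in>S. f y * cnj (g y))" if "g x = 0" for f g
    using that insert.hyps by (simp add: ip_def)
  have ip_diff: "ip (\<lambda>y. f y - g y) h = ip f h - ip g h"
    and ip_add: "ip (\<lambda>y. f y + g y) h = ip f h + ip g h"
    and ip_add': "ip h (\<lambda>y. f y + g y) = ip h f + ip h g"
    and ip_scale: "ip (\<lambda>y. c * f y) h = c * ip f h"
    and ip_scale': "ip h (\<lambda>y. c * f y) = cnj c * ip h f"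
    and ip_cnj: "ip f h = cnj (ip h f)" for f g h c
    by (simp_all add: ip_def algebra_simps sum_subtractf sum.distrib sum_distrib_left)
  have proj: "\<exists>h\<in>W'. \<forall>g\<in>W'. ip (\<lambda>y. f y - h y) g = 0" for f
  proof -
    from IH[of f] obtain h where h: "h \<in> W'" "\<forall>g\<in>W'. (\<Sum>x\<in>S. (f x - h x) * cnj (g x)) = 0" ..
    have "ip (\<lambda>y. f y - h y) g = 0" if "g \<in> W'" for g
      using ip_eq[of g] h(2) that by (simp add: W'_def)
    with h(1) show ?thesis by blast
  qed
  have "\<exists>h\<in>W. \<forall>g\<in>W. ip (\<lambda>y. f y - h y) g = 0"
  proof (cases "W' = W")
    case True
    then show ?thesis using proj by simp
  next
    case False
    then obtain w where w: "w \<in> W" "w x \<noteq> 0" by (auto simp: W'_def)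
    obtain w' where w': "w' \<in> W'" "\<And>g. g \<in> W' \<Longrightarrow> ip (\<lambda>y. w y - w' y) g = 0"
      using proj by blast
    \<comment> \<open>The part of \<open>w\<close> orthogonal to \<open>W'\<close>. Its value at
      \<open>x\<close> is still that of \<open>w\<close>, hence nonzero, so \<open>v\<close> and
      \<open>W'\<close> together span \<open>W\<close>.\<close>
    define v where "v = (\<lambda>y. w y - w' y)"
    have v: "v \<in> W" "v x \<noteq> 0" "\<And>g. g \<in> W' \<Longrightarrow> ip v g = 0"
      using w w' add[of w "\<lambda>y. - 1 * w' y"] scale[of w' "-1"] by (auto simp: v_def W'_def)
    have v0: "ip v v \<noteq> 0"
    proof
      assume "ip v v = 0"
      moreover have "ip v v = complex_of_real (\<Sum>y\<in>insert x S. (cmod (v y))\<^sup>2)"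
        unfolding ip_def of_real_sum by (intro sum.cong refl) (simp only: complex_norm_square)
      ultimately have "(\<Sum>y\<in>insert x S. (cmod (v y))\<^sup>2) = 0"
        by (metis of_real_eq_0_iff)
      then show False
        using v(2) insert.hyps by (subst (asm) sum_nonneg_eq_0_iff) auto
    qed
    obtain h' where h': "h' \<in> W'" "\<And>g. g \<in> W' \<Longrightarrow> ip (\<lambda>y. f y - h' y) g = 0"
      using proj by blast
    define h where "h = (\<lambda>y. h' y + ip f v / ip v v * v y)"
    have "h \<in> W"
      unfolding h_def using h' v by (intro add scale) (auto simp: W'_def)
    moreover have "ip (\<lambda>y. f y - h y) g = 0" if g: "g \<in> W" for g
    proof -
      \<comment> \<open>Subtracting the multiple of \<open>v\<close> that cancels the value at
        \<open>x\<close> moves \<open>g\<close> into \<open>W'\<close>.\<close>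
      define g' where "g' = (\<lambda>y. g y + - (g x / v x) * v y)"
      have g': "g' \<in> W'"
        using add[OF g scale[OF v(1)], of "- (g x / v x)"] v(2) by (simp add: g'_def W'_def)
      have eq: "ip (\<lambda>y. f y - h y) u = ip f u - ip h' u - ip f v / ip v v * ip v u" for u
        unfolding ip_diff h_def ip_add ip_scale by simp
      have 1: "ip (\<lambda>y. f y - h y) g' = 0"
        unfolding eq using h'(2)[OF g'] v(3)[OF g'] by (simp add: ip_diff)
      have "ip h' v = 0" using v(3)[OF h'(1)] ip_cnj[of h' v] by simp
      then have 2: "ip (\<lambda>y. f y - h y) v = 0"
        unfolding eq using v0 by simp
      have "g = (\<lambda>y. g' y + (g x / v x) * v y)" by (simp add: g'_def)
      then have "ip (\<lambda>y. f y - h y) g = ip (\<lambda>y. f y - h y) g' + cnj (g x / v x) * ip (\<lambda>y. f y - h y) v"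
        by (metis ip_add' ip_scale')
      then show ?thesis using 1 2 by simp
    qed
    ultimately show ?thesis by blast
  qed
  then show ?case by (simp add: ip_def)
qed

text \<open>A concrete monoidal category of matrices with adjoints, the input of Tannaka-Krein
  duality.\<close>

locale matrix_category =
  fixes N :: nat and C :: "nat \<Rightarrow> nat \<Rightarrow> (nat list \<Rightarrow> nat list \<Rightarrow> complex) set"
  assumes C_lin_maps: "A \<in> C k l \<Longrightarrow> A \<in> lin_maps N k l"
    and C_zero: "(\<lambda>i j. 0) \<in> C k l"
    and C_add: "A \<in> C k l \<Longrightarrow> B \<in> C k l \<Longrightarrow> (\<lambda>i j. A i j + B i j) \<in> C k l"
    and C_scale: "A \<in> C k l \<Longrightarrow> (\<lambda>i j. c * A i j) \<in> C k l"
    and C_comp: "A \<in> C l m \<Longrightarrow> B \<in> C k l \<Longrightarrow> mat_comp N l A B \<in> C k m"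
    and C_adj: "A \<in> C k l \<Longrightarrow> mat_adj A \<in> C l k"
    and C_tensor: "A \<in> C k l \<Longrightarrow> B \<in> C k' l' \<Longrightarrow> mat_tensor k l A B \<in> C (k + k') (l + l')"
    and C_id: "mat_id N k \<in> C k k"
begin

definition generators :: "free_alg set"
  where "generators = {intertw N k l A i j |k l A i j.
    A \<in> C k l \<and> i \<in> multi_indices N l \<and> j \<in> multi_indices N k}"

definition span_ideal :: "free_alg set"
  where "span_ideal = free_vs.span generators"

lemma span_ideal_subset: "span_ideal \<subseteq> carrier (free_ring N)"
  unfolding span_ideal_def generators_def
  by (rule free_vs.span_minimal[OF _ subspace_carrier]) (auto intro: intertw_in_carrier)

lemma intertw_in_span_ideal:
  "A \<in> C k l \<Longrightarrow> i \<in> multi_indices N l \<Longrightarrow> j \<in> multi_indices N k \<Longrightarrow> intertw N k l A i j \<in> span_ideal"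
  unfolding span_ideal_def generators_def by (intro free_vs.span_base) blast

text \<open>Multiplying an entry by a word amounts to tensoring the matrix with an identity, whose
  own intertwining relation is trivial. This is why the linear span is an ideal.\<close>

lemma basis_mult_generator:
  assumes w: "word_of N w" and g: "g \<in> generators"
  shows "basis_vec w * g \<in> span_ideal" "g * basis_vec w \<in> span_ideal"
proof -
  define p where "p = length (letters w)"
  have ab: "row w \<in> multi_indices N p" "col w \<in> multi_indices N p"
    using row_in_multi_indices[OF w] col_in_multi_indices[OF w] by (simp_all add: p_def)
  obtain k l A i j where A: "A \<in> C k l" and ij: "i \<in> multi_indices N l" "j \<in> multi_indices N k"
    and g: "g = intertw N k l A i j"
    using g by (auto simp: generators_def)
  have "intertw N (p + k) (p + l) (mat_tensor p p (mat_id N p) A) (row w @ i) (col w @ j) = basis_vec w * g"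
    using ab ij by (simp add: intertw_tensor intertw_id sum_mat_id wd_row_col g)
  then show "basis_vec w * g \<in> span_ideal"
    using intertw_in_span_ideal[OF C_tensor[OF C_id A]] ab ij
    by (metis length_multi_index multi_indices_append)
  have "intertw N (k + p) (l + p) (mat_tensor k l A (mat_id N p)) (i @ row w) (j @ col w) = g * basis_vec w"
    using ab ij by (simp add: intertw_tensor intertw_id sum_mat_id wd_row_col g)
  then show "g * basis_vec w \<in> span_ideal"
    using intertw_in_span_ideal[OF C_tensor[OF A C_id]] ab ij
    by (metis length_multi_index multi_indices_append)
qed

lemma subspace_span_ideal: "free_vs.subspace span_ideal"
  by (simp add: span_ideal_def)

lemma mult_span_ideal:
  assumes x: "x \<in> carrier (free_ring N)" and f: "f \<in> span_ideal"
  shows "x * f \<in> span_ideal" "f * x \<in> span_ideal"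
proof -
  have x': "x = lin_ext basis_vec x" by (simp add: lin_ext_basis_vec)
  have "x * g \<in> span_ideal \<and> g * x \<in> span_ideal" if "g \<in> generators" for g
    by (subst (1 2) x', unfold lin_ext_mult_left lin_ext_mult_right)
      (use that x basis_mult_generator in
        \<open>auto intro!: lin_ext_mem_subspace[OF subspace_span_ideal] simp: carrier_free_ring\<close>)
  then have *: "generators \<subseteq> {f. x * f \<in> span_ideal \<and> f * x \<in> span_ideal}" by blast
  have "free_vs.subspace {f. x * f \<in> span_ideal \<and> f * x \<in> span_ideal}"
    using subspace_span_ideal
    by (auto simp: free_vs.subspace_def distrib_left distrib_right vscale_mult_left vscale_mult_right)
  from free_vs.span_minimal[OF * this] f
  show "x * f \<in> span_ideal" "f * x \<in> span_ideal"
    unfolding span_ideal_def by blast+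
qed

lemma ideal_span_ideal: "ideal span_ideal (free_ring N)"
  by (rule ideal_free_ringI[OF span_ideal_subset subspace_span_ideal]) (rule mult_span_ideal; assumption)+

section \<open>Hilbert-Schmidt projections onto the morphism spaces\<close>

definition hs :: "nat \<Rightarrow> nat \<Rightarrow> (nat list \<Rightarrow> nat list \<Rightarrow> complex) \<Rightarrow>
    (nat list \<Rightarrow> nat list \<Rightarrow> complex) \<Rightarrow> complex"
  where "hs k l A B = (\<Sum>i\<in>multi_indices N l. \<Sum>j\<in>multi_indices N k. A i j * cnj (B i j))"

lemma hs_diff: "hs k l (\<lambda>i j. A i j - B i j) D = hs k l A D - hs k l B D"
  by (simp add: hs_def algebra_simps sum_subtractf)

lemma hs_sum: "hs k l (\<lambda>i j. \<Sum>x\<in>X. c x * A x i j) D = (\<Sum>x\<in>X. c x * hs k l (A x) D)"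
  by (simp add: hs_def sum_distrib_left sum_distrib_right sum.swap[of _ X] mult.assoc)

lemma hs_eq_0:
  assumes "A \<in> lin_maps N k l" "hs k l A A = 0"
  shows "A = (\<lambda>i j. 0)"
proof -
  have "hs k l A A = complex_of_real (\<Sum>i\<in>multi_indices N l. \<Sum>j\<in>multi_indices N k. (cmod (A i j))\<^sup>2)"
    unfolding hs_def of_real_sum by (intro sum.cong refl) (simp only: complex_norm_square)
  then have *: "(\<Sum>i\<in>multi_indices N l. \<Sum>j\<in>multi_indices N k. (cmod (A i j))\<^sup>2) = 0"
    using assms(2) by (metis of_real_eq_0_iff)
  have "A i j = 0" if "i \<in> multi_indices N l" "j \<in> multi_indices N k" for i j
  proof -
    have "(\<Sum>j\<in>multi_indices N k. (cmod (A i j))\<^sup>2) = 0"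
      using * that(1) by (subst (asm) sum_nonneg_eq_0_iff) (auto intro: sum_nonneg)
    then show ?thesis
      using that(2) by (subst (asm) sum_nonneg_eq_0_iff) auto
  qed
  then show ?thesis
    using lin_maps_D[OF assms(1)] by blast
qed

text \<open>Composition with \<open>A\<close> from the left has composition with the adjoint matrix
  as its Hilbert-Schmidt adjoint.\<close>

lemma hs_comp: "hs k m (mat_comp N l A B) D = hs k l B (mat_comp N m (mat_adj A) D)"
proof -
  have "hs k m (mat_comp N l A B) D =
      (\<Sum>i\<in>multi_indices N m. \<Sum>j\<in>multi_indices N k. \<Sum>n\<in>multi_indices N l. A i n * B n j * cnj (D i j))"
    by (simp add: hs_def mat_comp_def sum_distrib_right)
  also have "\<dots> = (\<Sum>i\<in>multi_indices N m. \<Sum>n\<in>multi_indices N l. \<Sum>j\<in>multi_indices N k. A i n * B n j * cnj (D i j))"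
    by (rule sum.cong[OF refl]) (rule sum.swap)
  also have "\<dots> = (\<Sum>n\<in>multi_indices N l. \<Sum>i\<in>multi_indices N m. \<Sum>j\<in>multi_indices N k. A i n * B n j * cnj (D i j))"
    by (rule sum.swap)
  also have "\<dots> = (\<Sum>n\<in>multi_indices N l. \<Sum>j\<in>multi_indices N k. \<Sum>i\<in>multi_indices N m. A i n * B n j * cnj (D i j))"
    by (rule sum.cong[OF refl]) (rule sum.swap)
  also have "\<dots> = hs k l B (mat_comp N m (mat_adj A) D)"
    by (simp add: hs_def mat_comp_def mat_adj_def sum_distrib_left ac_simps)
  finally show ?thesis .
qed

lemma projection_exists: "\<exists>P\<in>C k l. \<forall>D\<in>C k l. hs k l (\<lambda>i j. A i j - P i j) D = 0"
proof -
  let ?S = "multi_indices N l \<times> multi_indices N k"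
  let ?W = "(\<lambda>B (i, j). B i j) ` C k l"
  have "\<exists>h\<in>?W. \<forall>g\<in>?W. (\<Sum>x\<in>?S. (case_prod A x - h x) * cnj (g x)) = 0"
  proof (rule orthogonal_projection_exists)
    show "(\<lambda>x. 0) \<in> ?W"
      using C_zero[of k l] by (auto simp: image_iff intro!: bexI[of _ "\<lambda>i j. 0"])
    fix g h c assume "g \<in> ?W"
    then obtain B where B: "B \<in> C k l" "g = (\<lambda>(i, j). B i j)" by blast
    then show "(\<lambda>x. c * g x) \<in> ?W"
      using C_scale[OF B(1), of c] by (auto simp: image_iff fun_eq_iff intro!: bexI[of _ "\<lambda>i j. c * B i j"])
    show "x \<in> ?S" if "g x \<noteq> 0" for x
      using that lin_maps_D[OF C_lin_maps[OF B(1)]] B(2) by (cases x) auto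
    assume "h \<in> ?W"
    then obtain D where "D \<in> C k l" "h = (\<lambda>(i, j). D i j)" by blast
    then show "(\<lambda>x. g x + h x) \<in> ?W"
      using C_add[OF B(1)] B(2) by (auto simp: image_iff fun_eq_iff intro!: bexI[of _ "\<lambda>i j. B i j + D i j"])
  qed simp
  then obtain P where P: "P \<in> C k l"
    "\<forall>D\<in>C k l. (\<Sum>x\<in>?S. (case_prod A x - case_prod P x) * cnj (case_prod D x)) = 0"
    by auto
  have "hs k l (\<lambda>i j. A i j - P i j) D = 0" if "D \<in> C k l" for D
    using P(2)[rule_format, OF that] by (simp add: hs_def sum.cartesian_product case_prod_unfold)
  with P(1) show ?thesis by blast
qed

definition proj :: "nat \<Rightarrow> nat \<Rightarrow> (nat list \<Rightarrow> nat list \<Rightarrow> complex) \<Rightarrow> nat list \<Rightarrow> nat list \<Rightarrow> complex"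
  where "proj k l A = (SOME P. P \<in> C k l \<and> (\<forall>D\<in>C k l. hs k l (\<lambda>i j. A i j - P i j) D = 0))"

lemma proj: "proj k l A \<in> C k l" "D \<in> C k l \<Longrightarrow> hs k l A D = hs k l (proj k l A) D"
proof -
  have "\<exists>P. P \<in> C k l \<and> (\<forall>D\<in>C k l. hs k l (\<lambda>i j. A i j - P i j) D = 0)"
    using projection_exists by blast
  from someI_ex[OF this, folded proj_def]
  show "proj k l A \<in> C k l" "D \<in> C k l \<Longrightarrow> hs k l A D = hs k l (proj k l A) D"
    by (auto simp: hs_diff)
qed

text \<open>The difference of two candidates lies in \<open>C k l\<close> and is orthogonal to
  itself.\<close>

lemma proj_unique:
  assumes P: "P \<in> C k l" and *: "\<And>D. D \<in> C k l \<Longrightarrow> hs k l A D = hs k l P D"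
  shows "proj k l A = P"
proof -
  let ?D = "\<lambda>i j. proj k l A i j + - 1 * P i j"
  have D: "?D \<in> C k l" by (intro C_add C_scale proj P)
  have "hs k l ?D ?D = hs k l (proj k l A) ?D - hs k l P ?D"
    using hs_diff[of k l "proj k l A" P ?D] by simp
  also have "hs k l (proj k l A) ?D = hs k l P ?D"
    by (rule trans[OF proj(2)[OF D, symmetric] *[OF D]])
  finally have "hs k l ?D ?D = 0" by simp
  from hs_eq_0[OF C_lin_maps[OF D] this] have "?D i j = 0" for i j
    by (simp add: fun_eq_iff)
  then show ?thesis by (simp add: fun_eq_iff)
qed

lemma C_sum: "finite X \<Longrightarrow> (\<And>x. x \<in> X \<Longrightarrow> A x \<in> C k l) \<Longrightarrow> (\<lambda>i j. \<Sum>x\<in>X. c x * A x i j) \<in> C k l"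
proof (induction X rule: finite_induct)
  case (insert x X)
  then show ?case
    using C_add[OF C_scale[of "A x" k l "c x"], of "\<lambda>i j. \<Sum>x\<in>X. c x * A x i j"] by simp
qed (simp add: C_zero)

lemma proj_sum:
  assumes "finite X"
  shows "proj k l (\<lambda>i j. \<Sum>x\<in>X. c x * A x i j) = (\<lambda>i j. \<Sum>x\<in>X. c x * proj k l (A x) i j)"
proof (rule proj_unique)
  show "(\<lambda>i j. \<Sum>x\<in>X. c x * proj k l (A x) i j) \<in> C k l"
    by (intro C_sum assms proj)
  fix D assume "D \<in> C k l"
  then show "hs k l (\<lambda>i j. \<Sum>x\<in>X. c x * A x i j) D = hs k l (\<lambda>i j. \<Sum>x\<in>X. c x * proj k l (A x) i j) D"
    unfolding hs_sum by (intro sum.cong refl arg_cong2[where f="(*)"] proj(2))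
qed

text \<open>By \<open>hs_comp\<close>, \<open>B\<close> moves as its adjoint onto the test matrix,
  which stays in the category.\<close>

lemma proj_comp:
  assumes "B \<in> C l m"
  shows "proj k m (mat_comp N l B A) = mat_comp N l B (proj k l A)"
proof (rule proj_unique)
  show "mat_comp N l B (proj k l A) \<in> C k m" by (intro C_comp assms proj)
  fix D assume "D \<in> C k m"
  then have "mat_comp N m (mat_adj B) D \<in> C k l" by (intro C_comp C_adj assms)
  then show "hs k m (mat_comp N l B A) D = hs k m (mat_comp N l B (proj k l A)) D"
    unfolding hs_comp by (rule proj(2))
qed

definition unit_mat :: "nat list \<Rightarrow> nat list \<Rightarrow> nat list \<Rightarrow> nat list \<Rightarrow> complex"
  where "unit_mat b c i j = (if i = b \<and> j = c then 1 else 0)"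

text \<open>The functional that reads off the matrix coefficients of the projection onto \<open>C k m\<close> on the
  words of length \<open>m\<close>.  It annihilates the ideal because the projections commute with
  composition by elements of the category.\<close>

definition proj_form :: "nat \<Rightarrow> nat list \<Rightarrow> nat list \<Rightarrow> (nat \<times> nat) free_mon \<Rightarrow> complex"
  where "proj_form k j c w = proj k (length (letters w)) (unit_mat (col w) c) (row w) j"

lemma lin_form_wd:
  "i \<in> multi_indices N m \<Longrightarrow> b \<in> multi_indices N m \<Longrightarrow>
    lin_form (proj_form k j c) (wd i b) = proj k m (unit_mat b c) i j"
  by (simp add: wd_def proj_form_def length_multi_index)

lemma lin_form_intertw:
  assumes "i \<in> multi_indices N q" "b \<in> multi_indices N p"
  shows "lin_form (proj_form k j c) (intertw N p q A i b) =
    (\<Sum>m\<in>multi_indices N p. A i m * proj k p (unit_mat b c) m j) -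
    (\<Sum>m\<in>multi_indices N q. A m b * proj k q (unit_mat m c) i j)"
  using assms by (simp add: intertw_def lin_form_diff lin_form_sum lin_form_vscale lin_form_wd)

lemma proj_form_span_ideal:
  assumes "f \<in> span_ideal"
  shows "lin_form (proj_form k j c) f = 0"
  using assms unfolding span_ideal_def
proof (induction rule: free_vs.span_induct)
  case (step f)
  then obtain p q A i b where A: "A \<in> C p q" and ib: "i \<in> multi_indices N q" "b \<in> multi_indices N p"
    and f: "f = intertw N p q A i b" by (auto simp: generators_def)
  \<comment> \<open>Composing with a matrix unit picks out a column of \<open>A\<close> and expands
    it in matrix units. Projecting both expressions yields the two sums in
    \<open>lin_form_intertw\<close>.\<close>
  have "mat_comp N p A (unit_mat b c) = (\<lambda>x y. \<Sum>m\<in>multi_indices N q. A m b * unit_mat m c x y)"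
  proof (intro ext)
    fix x y
    have "mat_comp N p A (unit_mat b c) x y = (\<Sum>n\<in>multi_indices N p. if n = b then (if y = c then A x b else 0) else 0)"
      unfolding mat_comp_def by (intro sum.cong refl) (simp add: unit_mat_def)
    also have "\<dots> = (if y = c then A x b else 0)" using ib by simp
    also have "\<dots> = (\<Sum>m\<in>multi_indices N q. if m = x then (if y = c then A x b else 0) else 0)"
      using lin_maps_D[OF C_lin_maps[OF A], of x b] by auto
    also have "\<dots> = (\<Sum>m\<in>multi_indices N q. A m b * unit_mat m c x y)"
      by (intro sum.cong refl) (simp add: unit_mat_def)
    finally show "mat_comp N p A (unit_mat b c) x y = (\<Sum>m\<in>multi_indices N q. A m b * unit_mat m c x y)" .
  qed
  then have "proj k q (\<lambda>x y. \<Sum>m\<in>multi_indices N q. A m b * unit_mat m c x y) =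
      mat_comp N p A (proj k p (unit_mat b c))"
    using proj_comp[OF A, of k "unit_mat b c"] by simp
  then show ?case
    unfolding f lin_form_intertw[OF ib] by (simp add: proj_sum mat_comp_def fun_eq_iff)
qed (auto simp: lin_form_add lin_form_vscale free_vs.subspace_def)

text \<open>For each column \<open>c\<close>, the functional applied to the entry
  \<open>(i, c)\<close> of the relation equates entries of \<open>A\<close> composed with the
  projection of the matrix unit \<open>E_cc\<close>, and of the combination of the projected units
  \<open>E_mc\<close> with coefficients \<open>A m c\<close>. Summed over \<open>c\<close>, the left
  side becomes \<open>A\<close> times the projected identity, hence \<open>A\<close>, and the right
  side the projection of \<open>A\<close>.\<close>

theorem intertwiner_in_category:
  assumes A: "A \<in> lin_maps N k l"
    and *: "\<And>i j. i \<in> multi_indices N l \<Longrightarrow> j \<in> multi_indices N k \<Longrightarrow> intertw N k l A i j \<in> span_ideal"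
  shows "A \<in> C k l"
proof -
  let ?K = "multi_indices N k" and ?L = "multi_indices N l"
  \<comment> \<open>The diagonal matrix units sum to the identity, which lies in
    \<open>C k k\<close> and is therefore its own projection.\<close>
  have id: "proj k k (\<lambda>x y. \<Sum>c\<in>?K. 1 * unit_mat c c x y) = mat_id N k"
  proof -
    have "(\<lambda>x y. \<Sum>c\<in>?K. 1 * unit_mat c c x y) = mat_id N k"
    proof (intro ext)
      fix x y
      have "(\<Sum>c\<in>?K. 1 * unit_mat c c x y) = (\<Sum>c\<in>?K. if c = x then (if x = y then 1 else 0) else 0)"
        by (intro sum.cong refl) (auto simp: unit_mat_def)
      also have "\<dots> = mat_id N k x y"
        by (simp add: mat_id_def)
      finally show "(\<Sum>c\<in>?K. 1 * unit_mat c c x y) = mat_id N k x y" .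
    qed
    then show ?thesis using proj_unique[OF C_id refl] by simp
  qed
  have A_sum: "(\<lambda>x y. \<Sum>(c, m)\<in>?K \<times> ?L. A m c * unit_mat m c x y) = A"
  proof (intro ext)
    fix x y
    have "(\<Sum>(c, m)\<in>?K \<times> ?L. A m c * unit_mat m c x y) =
        (\<Sum>c\<in>?K. \<Sum>m\<in>?L. if m = x then (if c = y then A x y else 0) else 0)"
      unfolding sum.cartesian_product[symmetric]
      by (intro sum.cong refl) (simp add: unit_mat_def)
    also have "\<dots> = A x y"
      by (cases "A x y = 0") (use lin_maps_D[OF A, of x y] in \<open>auto intro!: sum.neutral\<close>)
    finally show "(\<Sum>(c, m)\<in>?K \<times> ?L. A m c * unit_mat m c x y) = A x y" .
  qed
  have "A i j = proj k l A i j" if ij: "i \<in> ?L" "j \<in> ?K" for i j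
  proof -
    have 1: "(\<Sum>m\<in>?K. A i m * proj k k (unit_mat c c) m j) = (\<Sum>m\<in>?L. A m c * proj k l (unit_mat m c) i j)"
      if "c \<in> ?K" for c
      using proj_form_span_ideal[OF *[OF ij(1) that], of k j c] ij that
      by (simp add: lin_form_intertw)
    have "A i j = (\<Sum>m\<in>?K. if m = j then A i m else 0)"
      using ij by simp
    also have "\<dots> = (\<Sum>m\<in>?K. A i m * proj k k (\<lambda>x y. \<Sum>c\<in>?K. 1 * unit_mat c c x y) m j)"
      unfolding id by (intro sum.cong refl) (auto simp: mat_id_def)
    also have "\<dots> = (\<Sum>m\<in>?K. \<Sum>c\<in>?K. A i m * proj k k (unit_mat c c) m j)"
      unfolding proj_sum[OF finite_multi_indices] sum_distrib_left by simp
    also have "\<dots> = (\<Sum>c\<in>?K. \<Sum>m\<in>?K. A i m * proj k k (unit_mat c c) m j)"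
      by (rule sum.swap)
    also have "\<dots> = (\<Sum>c\<in>?K. \<Sum>m\<in>?L. A m c * proj k l (unit_mat m c) i j)"
      by (intro sum.cong refl 1)
    also have "\<dots> = proj k l (\<lambda>x y. \<Sum>z\<in>?K \<times> ?L. A (snd z) (fst z) * unit_mat (snd z) (fst z) x y) i j"
      by (simp add: proj_sum sum.cartesian_product case_prod_unfold)
    also have "\<dots> = proj k l A i j"
      using A_sum by (simp add: case_prod_unfold)
    finally show ?thesis .
  qed
  moreover have "A i j = proj k l A i j" if "\<not> (i \<in> ?L \<and> j \<in> ?K)" for i j
  proof -
    have "A i j = 0" "proj k l A i j = 0"
      using that lin_maps_D[OF A] lin_maps_D[OF C_lin_maps[OF proj(1)[of k l A]]] by blast+
    then show ?thesis by simp
  qed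
  ultimately have "A = proj k l A" by (intro ext) blast
  then show ?thesis using proj(1)[of k l A] by simp
qed

end

section \<open>The twisted quotient algebra\<close>

lemma mat_id_Suc: "mat_tensor k k (mat_id N k) (mat_id N 1) = mat_id N (k + 1)"
proof (intro ext)
  fix i j :: "nat list"
  have "i = j \<longleftrightarrow> take k i = take k j \<and> drop k i = drop k j"
    by (metis append_take_drop_id)
  then show "mat_tensor k k (mat_id N k) (mat_id N 1) i j = mat_id N (k + 1) i j"
    unfolding mat_tensor_def mat_id_def multi_indices_take_drop[of i N k 1] by auto
qed

text \<open>The degree condition is what makes the image of the category under \<open>tw\<close>
  closed under tensor products.\<close>

locale twisted_category =
  fixes N :: nat and K :: "nat \<Rightarrow> nat \<Rightarrow> (part \<Rightarrow>\<^sub>0 complex) set"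
  assumes N_pos: "N \<ge> 1"
    and K_category: "linear_category (of_nat N) K"
    and K_deg_pres: "f \<in> K k l \<Longrightarrow> deg_pres (T_vec N k l f)"
begin

definition C :: "nat \<Rightarrow> nat \<Rightarrow> (nat list \<Rightarrow> nat list \<Rightarrow> complex) set"
  where "C k l = (\<lambda>f. tw (T_vec N k l f)) ` K k l"

lemma K_Part: "f \<in> K k l \<Longrightarrow> f \<in> Part k l"
  using linear_categoryD(1)[OF K_category] by blast

lemma C_I: "f \<in> K k l \<Longrightarrow> tw (T_vec N k l f) \<in> C k l"
  by (simp add: C_def)

lemma C_comp': "A \<in> C l m \<Longrightarrow> B \<in> C k l \<Longrightarrow> mat_comp N l A B \<in> C k m"
  using linear_categoryD(4)[OF K_category] K_Part
  by (force simp: C_def tw_comp[symmetric] T_vec_comp[symmetric])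

lemma C_adj': "A \<in> C k l \<Longrightarrow> mat_adj A \<in> C l k"
  using linear_categoryD(5)[OF K_category]
  by (force simp: C_def tw_adj[symmetric] T_vec_inv[symmetric])

lemma C_tensor':
  assumes "A \<in> C k l" "B \<in> C k' l'"
  shows "mat_tensor k l A B \<in> C (k + k') (l + l')"
proof -
  from assms obtain f g where f: "f \<in> K k l" "A = tw (T_vec N k l f)"
    and g: "g \<in> K k' l'" "B = tw (T_vec N k' l' g)" by (auto simp: C_def)
  have "mat_tensor k l A B = tw (T_vec N (k + k') (l + l') (vec_tensor k l f g))"
    unfolding f g
    by (subst T_vec_tensor[OF K_Part[OF f(1)] K_Part[OF g(1)]])
      (rule tw_tensor[symmetric, OF T_vec_in_lin_maps K_deg_pres[OF f(1)] T_vec_in_lin_maps K_deg_pres[OF g(1)]])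
  then show ?thesis
    using C_I[OF linear_categoryD(3)[OF K_category f(1) g(1)]] by simp
qed

lemma C_scale': "A \<in> C k l \<Longrightarrow> (\<lambda>i j. c * A i j) \<in> C k l"
proof -
  assume "A \<in> C k l"
  then obtain f where f: "f \<in> K k l" "A = tw (T_vec N k l f)" by (auto simp: C_def)
  have "(\<lambda>i j. c * A i j) = tw (T_vec N k l (vscale c f))"
    by (simp add: f T_vec_scale tw_def fun_eq_iff)
  then show ?thesis
    using C_I[OF free_vs.subspace_scale[OF linear_categoryD(2)[OF K_category] f(1)]] by simp
qed

lemma C_add':
  assumes "A \<in> C k l" "B \<in> C k l"
  shows "(\<lambda>i j. A i j + B i j) \<in> C k l"
proof -
  from assms obtain f g where f: "f \<in> K k l" "A = tw (T_vec N k l f)"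
    and g: "g \<in> K k l" "B = tw (T_vec N k l g)" by (auto simp: C_def)
  have "(\<lambda>i j. A i j + B i j) = tw (T_vec N k l (f + g))"
    by (simp add: f g T_vec_add tw_def fun_eq_iff distrib_left)
  then show ?thesis
    using C_I[OF free_vs.subspace_add[OF linear_categoryD(2)[OF K_category] f(1) g(1)]] by simp
qed

lemma pair_in_C: "pair_mat N \<in> C 0 2"
  using C_I[OF linear_categoryD(7)[OF K_category]] by (simp only: T_vec_pair tw_pair)

lemma id_in_C: "mat_id N k \<in> C k k"
proof (induction k)
  case 0
  \<comment> \<open>The identity on the empty word is not among the generators of a category. It is
    obtained from the closed loop, the pair followed by its adjoint, whose value \<open>N\<close> is
    invertible.\<close>
  have "mat_comp N 2 (mat_adj (pair_mat N)) (pair_mat N) [] [] = of_nat N"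
  proof -
    have "mat_comp N 2 (mat_adj (pair_mat N)) (pair_mat N) [] [] =
        (\<Sum>a=1..N. \<Sum>b=1..N. if b = a then 1 else 0)"
      unfolding mat_comp_def sum_multi_indices_2
      by (intro sum.cong refl) (auto simp: mat_adj_def pair_mat_def)
    then show ?thesis by simp
  qed
  then have "mat_id N 0 = (\<lambda>i j. (1 / of_nat N) * mat_comp N 2 (mat_adj (pair_mat N)) (pair_mat N) i j)"
    using N_pos by (auto simp: fun_eq_iff mat_id_def mat_comp_def mat_adj_def pair_mat_def intro!: sum.neutral)
  then show ?case
    by (simp only: C_scale'[OF C_comp'[OF C_adj'[OF pair_in_C] pair_in_C]])
next
  case (Suc k)
  have "mat_id N 1 \<in> C 1 1"
    using C_I[OF linear_categoryD(6)[OF K_category]] by (simp only: T_vec_id tw_id)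
  from C_tensor'[OF Suc this] show ?case by (simp only: mat_id_Suc Suc_eq_plus1)
qed

sublocale matrix_category N C
proof
  fix k l
  show "(\<lambda>i j. 0) \<in> C k l"
    using C_I[OF free_vs.subspace_0[OF linear_categoryD(2)[OF K_category]], of k l]
    by (simp add: T_vec_zero tw_def[abs_def])
qed (use C_add' C_scale' C_comp' C_adj' C_tensor' id_in_C in
    \<open>auto simp: C_def T_vec_in_lin_maps\<close>)

lemma C_deg_pres: "A \<in> C k l \<Longrightarrow> deg_pres A"
  by (auto simp: C_def K_deg_pres)

end

section \<open>The bigrading of words, and the structure maps on words\<close>

definition degfun :: "nat \<Rightarrow> (nat list \<Rightarrow> complex) \<Rightarrow> bool"
  where "degfun N \<alpha> \<longleftrightarrow> (\<forall>k l. \<forall>i\<in>multi_indices N k. \<forall>j\<in>multi_indices N l. deg i = deg j \<longrightarrow> \<alpha> i = \<alpha> j)"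

lemma degfun_chi: "j \<in> multi_indices N l \<Longrightarrow> degfun N (\<lambda>i. chi i j)"
  unfolding degfun_def using chi_deg_cong by blast

lemma degfun_const: "degfun N (\<lambda>i. c)"
  by (simp add: degfun_def)

text \<open>A diagonal operator on words. For functions \<open>\<alpha>\<close> and
  \<open>\<beta>\<close> of the degree it respects the bigrading and hence acts on the quotient
  (\<open>weight_J\<close>).\<close>

definition weight :: "(nat list \<Rightarrow> complex) \<Rightarrow> (nat list \<Rightarrow> complex) \<Rightarrow> free_alg \<Rightarrow> free_alg"
  where "weight \<alpha> \<beta> f = lin_ext (\<lambda>w. vscale (\<alpha> (row w) * \<beta> (col w)) (basis_vec w)) f"

lemma weight_wd: "length i = length j \<Longrightarrow> weight \<alpha> \<beta> (wd i j) = vscale (\<alpha> i * \<beta> j) (wd i j)"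
  by (simp add: weight_def wd_def)

lemma weight_in_carrier: "f \<in> carrier (free_ring N) \<Longrightarrow> weight \<alpha> \<beta> f \<in> carrier (free_ring N)"
  unfolding weight_def
  by (rule lin_ext_in_carrier, rule free_vs.subspace_scale[OF subspace_carrier])
    (simp add: carrier_free_ring)

lemma lin_ext_weight: "lin_ext (\<lambda>w. vscale (\<alpha> (row w) * \<beta> (col w)) (B w)) f = lin_ext B (weight \<alpha> \<beta> f)"
  by (simp add: weight_def lin_ext_lin_ext lin_ext_vscale)

lemma lin_form_weight: "lin_form (\<lambda>w. \<alpha> (row w) * \<beta> (col w) * g w) f = lin_form g (weight \<alpha> \<beta> f)"
  by (simp add: weight_def lin_form_lin_ext lin_form_vscale)

text \<open>As for matrix coefficients of a tensor power of \<open>u\<close>, the coproduct of a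
  word inserts one intermediate index word \<open>m\<close>.\<close>

lemma prod_list_comult:
  "(\<Prod>(i, j)\<leftarrow>ls. \<Sum>k=1..N. basis_vec (Word [(i, k)], Word [(k, j)])) =
    (\<Sum>m\<in>multi_indices N (length ls). basis_vec (Word (zip (map fst ls) m), Word (zip m (map snd ls))))"
proof (induction ls)
  case Nil
  then show ?case by (simp add: zero_free_mon_def[symmetric] zero_prod_def[symmetric])
next
  case (Cons p ls)
  then show ?case
    by (simp add: sum_multi_indices_Suc case_prod_unfold sum_product mult_single plus_free_mon_def)
qed

lemma free_comult_eq:
  "free_comult N f = lin_ext (\<lambda>w. \<Sum>m\<in>multi_indices N (length (letters w)).
    basis_vec (Word (zip (row w) m), Word (zip m (col w)))) f"
  unfolding free_comult_def hom_ext_def prod_list_comult[unfolded case_prod_unfold] case_prod_unfold row_def col_def ..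

text \<open>The map \<open>q\<close> before passing to the quotient. \<open>q_map\<close> applies it
  to a chosen representative, and \<open>free_q_J\<close> makes that choice immaterial.\<close>

definition free_q :: "free_alg \<Rightarrow> ((nat \<Rightarrow>\<^sub>0 bit) \<Rightarrow>\<^sub>0 complex)"
  where "free_q = hom_ext (\<lambda>(i, j). if i = j then basis_vec (z2_gen i) else 0)"

lemma prod_list_q:
  "(\<Prod>(i, j)\<leftarrow>ls. if i = j then basis_vec (z2_gen i) else 0) =
    (if map fst ls = map snd ls then basis_vec (deg (map fst ls)) else 0)"
  by (induction ls) (auto simp: deg_Cons mult_single)

lemma free_q_eq: "free_q f = lin_ext (\<lambda>w. if row w = col w then basis_vec (deg (row w)) else 0) f"
  unfolding free_q_def hom_ext_def prod_list_q row_def col_def ..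

lemma prod_list_counit:
  "(\<Prod>(i, j)\<leftarrow>ls. if i = j then 1 else 0) = (if map fst ls = map snd ls then 1 else (0 :: complex))"
  by (induction ls) auto

lemma free_counit_eq: "free_counit f = lin_form (\<lambda>w. if row w = col w then 1 else 0) f"
  unfolding free_counit_def lin_form_def prod_list_counit row_def col_def ..

text \<open>The meeting point of both sides: the relations \<open>R\<close> generate exactly the
  ideal spanned by the intertwining relations of \<open>K\<close>. The twist is computed here once
  for both quantum groups.\<close>

locale twisted_presentation = twisted_category +
  fixes R :: "free_alg set" and \<sigma> :: "nat \<Rightarrow> nat \<Rightarrow> complex"
  assumes rel_ideal_eq: "rel_ideal N R = span_ideal"
    and \<sigma>_eq: "\<And>i j. i \<in> {1..N} \<Longrightarrow> j \<in> {1..N} \<Longrightarrow> \<sigma> i j = (if i < j then -1 else 1)"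
begin

abbreviation J :: "free_alg set"
  where "J \<equiv> rel_ideal N R"

sublocale free_ideal N J
  by (rule free_ideal.intro) (simp only: rel_ideal_eq ideal_span_ideal)

abbreviation F :: "free_alg set"
  where "F \<equiv> carrier (free_ring N)"

abbreviation cl :: "free_alg \<Rightarrow> free_alg set"
  where "cl \<equiv> coset N R"

abbreviation clw :: "(nat \<times> nat) free_mon \<Rightarrow> free_alg set"
  where "clw w \<equiv> cl (basis_vec w)"

abbreviation clz :: "nat list \<Rightarrow> nat list \<Rightarrow> free_alg set"
  where "clz i j \<equiv> clw (Word (zip i j))"

abbreviation idx :: "(nat \<times> nat) free_mon \<Rightarrow> nat list set"
  where "idx w \<equiv> multi_indices N (length (letters w))"

abbreviation A :: "free_alg set hopf_star_algebra"
  where "A \<equiv> universal_algebra N R"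

abbreviation cc :: "free_alg set \<Rightarrow> free_alg set \<Rightarrow> complex"
  where "cc \<equiv> cocycle N \<sigma>"

lemma cl_eq: "cl f = {h + f |h. h \<in> J}"
  by (auto simp: coset_def a_r_coset_def')

lemma cl_eq_iff: "cl f = cl g \<longleftrightarrow> f - g \<in> J"
proof
  assume "cl f = cl g"
  moreover have "f \<in> cl f" unfolding cl_eq using J_zero by force
  ultimately show "f - g \<in> J" unfolding cl_eq by auto
next
  assume *: "f - g \<in> J"
  have "h + f = (h + (f - g)) + g" "h + g = (h - (f - g)) + f" for h by simp_all
  then show "cl f = cl g"
    unfolding cl_eq using J_add[OF _ *] J_diff[OF _ *] by blast
qed

lemma some_rep_cl: "some_rep (cl f) - f \<in> J"
proof -
  have "f \<in> cl f" unfolding cl_eq using J_zero by force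
  then have "some_rep (cl f) \<in> cl f" unfolding some_rep_def by (rule someI)
  then show ?thesis unfolding cl_eq by auto
qed

lemma cl_some_rep [simp]: "cl (some_rep (cl f)) = cl f"
  using some_rep_cl cl_eq_iff by blast

lemma some_rep_in_F: "f \<in> F \<Longrightarrow> some_rep (cl f) \<in> F"
  using free_vs.subspace_add[OF subspace_carrier, of f N "some_rep (cl f) - f"] J_carrier[OF some_rep_cl]
  by simp

lemma carrier_A: "carrier A = cl ` F"
  by (auto simp: universal_algebra_def Let_def FactRing_def A_RCOSETS_def' coset_def)

lemma add_A: "f \<in> F \<Longrightarrow> g \<in> F \<Longrightarrow> cl f \<oplus>\<^bsub>A\<^esub> cl g = cl (f + g)"
  using ideal.a_rcos_sum[OF ideal, of f g]
  by (simp add: universal_algebra_def Let_def FactRing_def coset_def)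

lemma mult_A: "f \<in> F \<Longrightarrow> g \<in> F \<Longrightarrow> cl f \<otimes>\<^bsub>A\<^esub> cl g = cl (f * g)"
  using ideal.rcoset_mult_add[OF ideal, of f g]
  by (simp add: universal_algebra_def Let_def FactRing_def coset_def)

lemma one_A: "\<one>\<^bsub>A\<^esub> = cl 1"
  by (simp add: universal_algebra_def Let_def FactRing_def coset_def)

lemma smult_A: "c \<odot>\<^bsub>A\<^esub> cl f = cl (vscale c f)"
proof -
  have "vscale c (some_rep (cl f)) - vscale c f \<in> J"
    using J_scale[OF some_rep_cl, of c f] by (simp add: free_vs.scale_right_diff_distrib)
  then show ?thesis by (simp add: universal_algebra_def Let_def cl_eq_iff)
qed

lemma zero_A: "\<zero>\<^bsub>A\<^esub> = cl 0"
  by (auto simp: universal_algebra_def Let_def FactRing_def cl_eq)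

lemma finsum_A:
  assumes "finite X" "\<And>x. x \<in> X \<Longrightarrow> G x = cl (g x)" "\<And>x. x \<in> X \<Longrightarrow> g x \<in> F"
  shows "finsum A G X = cl (\<Sum>x\<in>X. g x)"
proof -
  let ?Q = "free_ring N Quot J"
  interpret Q: ring ?Q by (rule ideal.quotient_is_ring[OF ideal])
  have eqs: "carrier A = carrier ?Q" "add A = add ?Q" "zero A = zero ?Q"
    by (simp_all add: universal_algebra_def Let_def)
  \<comment> \<open>\<open>A\<close> is merely a record and not known to be a ring. Finite sums only
    look at the carrier, addition and zero, which it shares with the quotient ring.\<close>
  have fs: "finsum A h X = finsum ?Q h X" for h :: "'b \<Rightarrow> free_alg set" and X
    by (simp add: finsum_def finprod_def eqs)
  show ?thesis
    unfolding fs using assms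
  proof (induction X rule: finite_induct)
    case empty
    then show ?case by (simp add: eqs(3)[symmetric] zero_A)
  next
    case (insert x X)
    have sum: "(\<Sum>x\<in>X. g x) \<in> F"
      using insert.prems by (intro free_vs.subspace_sum[OF subspace_carrier]) auto
    have "finsum ?Q G (insert x X) = G x \<oplus>\<^bsub>?Q\<^esub> finsum ?Q G X"
      using insert by (intro Q.finsum_insert) (auto simp: eqs(1)[symmetric] carrier_A)
    also have "\<dots> = cl (g x) \<oplus>\<^bsub>A\<^esub> cl (\<Sum>x\<in>X. g x)"
      using insert by (simp add: eqs)
    also have "\<dots> = cl (\<Sum>x\<in>insert x X. g x)"
      using insert sum by (simp add: add_A)
    finally show ?case .
  qed
qed

text \<open>Nonzero coefficients of \<open>B\<close> link indices of equal degree, so all words in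
  an entry of the relation have the row degree of \<open>i\<close> and the column degree of
  \<open>j\<close>; the weight acts on it as a scalar.\<close>

lemma weight_J:
  assumes \<alpha>: "degfun N \<alpha>" and \<beta>: "degfun N \<beta>" and f: "f \<in> J"
  shows "weight \<alpha> \<beta> f \<in> J"
  using f unfolding rel_ideal_eq span_ideal_def
proof (induction rule: free_vs.span_induct)
  case base
  then show ?case
    using free_vs.subspace_span[of generators]
    by (auto simp: free_vs.subspace_def weight_def lin_ext_add lin_ext_vscale)
next
  case (step f)
  then obtain k l B i j where B: "B \<in> C k l" and ij: "i \<in> multi_indices N l" "j \<in> multi_indices N k"
    and f: "f = intertw N k l B i j" by (auto simp: generators_def)
  have d: "B x y \<noteq> 0 \<Longrightarrow> deg x = deg y" for x y
    using C_deg_pres[OF B] by (simp add: deg_pres_def)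
  have 1: "B i m * (\<alpha> m * \<beta> j) = \<alpha> i * \<beta> j * B i m" if "m \<in> multi_indices N k" for m
  proof (cases "B i m = 0")
    case False
    then have "\<alpha> i = \<alpha> m" using d that ij \<alpha> unfolding degfun_def by blast
    then show ?thesis by simp
  qed simp
  have 2: "B m j * (\<alpha> i * \<beta> m) = \<alpha> i * \<beta> j * B m j" if "m \<in> multi_indices N l" for m
  proof (cases "B m j = 0")
    case False
    then have "\<beta> m = \<beta> j" using d that ij \<beta> unfolding degfun_def by blast
    then show ?thesis by simp
  qed simp
  have lin: "weight \<alpha> \<beta> (g - h) = weight \<alpha> \<beta> g - weight \<alpha> \<beta> h"
      "weight \<alpha> \<beta> (vscale c g) = vscale c (weight \<alpha> \<beta> g)"
      "weight \<alpha> \<beta> (\<Sum>x\<in>X. G x) = (\<Sum>x\<in>X. weight \<alpha> \<beta> (G x))" for g h c G and X :: "nat list set"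
    by (simp_all add: weight_def lin_ext_diff lin_ext_vscale lin_ext_sum)
  have "weight \<alpha> \<beta> f = vscale (\<alpha> i * \<beta> j) f"
    unfolding f intertw_def lin free_vs.scale_right_diff_distrib free_vs.scale_sum_right
    by (intro arg_cong2[where f="(-)"] sum.cong refl)
      (use ij 1 2 in \<open>simp_all add: weight_wd length_multi_index\<close>)
  then show ?case
    using free_vs.span_scale[OF free_vs.span_base[OF step]] by simp
qed

text \<open>Only diagonal words survive \<open>free_q\<close>, which leaves \<open>B i j\<close>
  times the group elements \<open>deg j\<close> and \<open>deg i\<close>; these agree whenever
  \<open>B i j\<close> is nonzero.\<close>

lemma free_q_J:
  assumes "f \<in> J"
  shows "free_q f = 0"
  using assms unfolding rel_ideal_eq span_ideal_def
proof (induction rule: free_vs.span_induct)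
  case base
  then show ?case by (auto simp: free_vs.subspace_def free_q_eq lin_ext_add lin_ext_vscale)
next
  case (step f)
  then obtain k l B i j where B: "B \<in> C k l" and ij: "i \<in> multi_indices N l" "j \<in> multi_indices N k"
    and f: "f = intertw N k l B i j" by (auto simp: generators_def)
  have wd: "free_q (wd x y) = (if x = y then basis_vec (deg x) else 0)" if "length x = length y" for x y
    using that by (simp add: free_q_eq wd_def)
  have lin: "free_q (g - h) = free_q g - free_q h" "free_q (vscale c g) = vscale c (free_q g)"
      "free_q (\<Sum>x\<in>X. G x) = (\<Sum>x\<in>X. free_q (G x))" for g h c G and X :: "nat list set"
    by (simp_all add: free_q_eq lin_ext_diff lin_ext_vscale lin_ext_sum)
  have "(\<Sum>m\<in>multi_indices N k. vscale (B i m) (free_q (wd m j))) =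
      (\<Sum>m\<in>multi_indices N k. if m = j then vscale (B i j) (basis_vec (deg j)) else 0)"
    using ij by (intro sum.cong refl) (auto simp: wd length_multi_index)
  moreover have "(\<Sum>m\<in>multi_indices N l. vscale (B m j) (free_q (wd i m))) =
      (\<Sum>m\<in>multi_indices N l. if i = m then vscale (B i j) (basis_vec (deg i)) else 0)"
    using ij by (intro sum.cong refl) (auto simp: wd length_multi_index)
  moreover have "vscale (B i j) (basis_vec (deg j)) = vscale (B i j) (basis_vec (deg i))"
    using C_deg_pres[OF B] by (cases "B i j = 0") (auto simp: deg_pres_def)
  ultimately show ?case
    using ij by (simp add: f intertw_def lin)
qed

text \<open>The counit is \<open>free_q\<close> followed by the augmentation of the group
  algebra.\<close>

lemma free_counit_J:
  assumes "f \<in> J"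
  shows "free_counit f = 0"
proof -
  have "free_counit f = lin_form (\<lambda>g. 1) (free_q f)"
    by (simp add: free_counit_eq free_q_eq lin_form_lin_ext if_distrib[of "lin_form _"] cong: if_cong)
  then show ?thesis using free_q_J[OF assms] by simp
qed

lemma q_map_cl: "q_map (cl f) = free_q f"
proof -
  have "free_q (some_rep (cl f)) - free_q f = free_q (some_rep (cl f) - f)"
    by (simp add: free_q_eq lin_ext_diff)
  then have "free_q (some_rep (cl f)) = free_q f"
    using free_q_J[OF some_rep_cl] by simp
  then show ?thesis by (simp add: q_map_def free_q_def)
qed

lemma counit_cl: "counit A (cl f) = free_counit f"
proof -
  have "free_counit (some_rep (cl f)) - free_counit f = free_counit (some_rep (cl f) - f)"
    by (simp add: free_counit_eq lin_form_diff)
  then have "free_counit (some_rep (cl f)) = free_counit f"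
    using free_counit_J[OF some_rep_cl] by simp
  then show ?thesis by (simp add: universal_algebra_def Let_def)
qed

lemma cocycle_eq: "cc X Y = lin_form (\<lambda>g. lin_form (bicharacter N \<sigma> g) (q_map Y)) (q_map X)"
  by (simp add: cocycle_def lin_form_def sum_distrib_left mult.assoc)

lemma cocycle_words:
  assumes "word_of N v" "word_of N w"
  shows "cc (clw v) (clw w) = (if row v = col v \<and> row w = col w then chi (row v) (row w) else 0)"
proof -
  have "chi (row v) (row w) = bicharacter N \<sigma> (deg (row v)) (deg (row w))"
    by (rule chi_eq_bicharacter[OF \<sigma>_eq row_in_multi_indices[OF assms(1)] row_in_multi_indices[OF assms(2)]])
  then show ?thesis
    by (auto simp: cocycle_eq q_map_cl free_q_eq)
qed

lemma bilinear_form_cocycle: "bilinear_form A cc"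
proof -
  have add: "q_map (cl f \<oplus>\<^bsub>A\<^esub> cl g) = q_map (cl f) + q_map (cl g)" if "f \<in> F" "g \<in> F" for f g
    using that by (simp add: add_A q_map_cl free_q_eq lin_ext_add)
  have scale: "q_map (c \<odot>\<^bsub>A\<^esub> cl f) = vscale c (q_map (cl f))" for c f
    by (simp add: smult_A q_map_cl free_q_eq lin_ext_vscale)
  have fadd: "lin_form (\<lambda>x. g x + h x) f = lin_form g f + lin_form h f"
    for g h and f :: "(nat \<Rightarrow>\<^sub>0 bit) \<Rightarrow>\<^sub>0 complex"
    by (simp add: lin_form_def distrib_left sum.distrib)
  show ?thesis
    unfolding bilinear_form_def carrier_A
    by (auto simp: cocycle_eq add scale lin_form_add lin_form_vscale fadd lin_form_fun_mult)
qed

lemma comult_A: "comult A X = lin_ext (\<lambda>(v, w). basis_vec (clw v, clw w)) (free_comult N (some_rep X))"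
  by (simp add: universal_algebra_def Let_def)

lemma lin_form_comult:
  "lin_form G (comult A X) = lin_form (\<lambda>w. \<Sum>m\<in>idx w.
    G (clz (row w) m, clz m (col w))) (some_rep X)"
  by (simp add: comult_A free_comult_eq lin_form_lin_ext lin_form_sum case_prod_unfold)

lemma convolution_eq:
  "convolution A s t X Y = lin_form (\<lambda>v. \<Sum>m\<in>idx v.
    lin_form (\<lambda>w. \<Sum>n\<in>idx w.
      s (clz (row v) m) (clz (row w) n) *
      t (clz m (col v)) (clz n (col w))) (some_rep Y)) (some_rep X)"
proof -
  have "convolution A s t X Y = lin_form (\<lambda>p. lin_form (\<lambda>q. s (fst p) (fst q) * t (snd p) (snd q))
      (comult A Y)) (comult A X)"
    by (simp add: convolution_def lin_form_def case_prod_unfold sum_distrib_left mult.assoc)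
  then show ?thesis by (simp add: lin_form_comult)
qed

text \<open>On words, \<open>cc\<close> is supported on diagonal pairs with values 1 and -1, so
  convolving it with itself squares the sign away and leaves the counit.\<close>

lemma convolution_cocycle:
  assumes "X \<in> carrier A" "Y \<in> carrier A"
  shows "convolution A cc cc X Y = counit A X * counit A Y"
proof -
  let ?d = "\<lambda>w. if row w = col w then 1 else (0 :: complex)"
  obtain f g where X: "X = cl f" "f \<in> F" and Y: "Y = cl g" "g \<in> F"
    using assms by (auto simp: carrier_A)
  have "(\<Sum>m\<in>idx v. lin_form (\<lambda>w. \<Sum>n\<in>idx w.
      cc (clz (row v) m) (clz (row w) n) *
      cc (clz m (col v)) (clz n (col w))) (some_rep Y)) =
      ?d v * lin_form ?d (some_rep Y)" if v: "word_of N v" for v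
  proof -
    have inner: "(\<Sum>n\<in>idx w.
        cc (clz (row v) m) (clz (row w) n) *
        cc (clz m (col v)) (clz n (col w))) =
        (if m = row v then ?d v * ?d w else 0)"
      if w: "word_of N w" and m: "m \<in> idx v" for w m
    proof -
      note vm = row_in_multi_indices[OF v] col_in_multi_indices[OF v] m
      note wm = row_in_multi_indices[OF w] col_in_multi_indices[OF w]
      have "(\<Sum>n\<in>idx w.
          cc (clz (row v) m) (clz (row w) n) *
          cc (clz m (col v)) (clz n (col w))) =
        (\<Sum>n\<in>idx w. if n = row w then
          (if m = row v then ?d v * ?d w else 0) else 0)"
      proof (rule sum.cong[OF refl])
        fix n assume n: "n \<in> idx w"
        have 1: "cc (clz (row v) m) (clz (row w) n) =
            (if row v = m \<and> row w = n then chi (row v) (row w) else 0)"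
          using vm wm n by (subst cocycle_words) (auto intro: word_of_zip simp: length_multi_index)
        have 2: "cc (clz m (col v)) (clz n (col w)) =
            (if m = col v \<and> n = col w then chi m n else 0)"
          using vm wm n by (subst cocycle_words) (auto intro: word_of_zip simp: length_multi_index)
        show "cc (clz (row v) m) (clz (row w) n) *
          cc (clz m (col v)) (clz n (col w)) =
          (if n = row w then (if m = row v then ?d v * ?d w else 0) else 0)"
          unfolding 1 2 by (simp add: chi_sq)
      qed
      then show ?thesis using wm by simp
    qed
    have "lin_form (\<lambda>w. \<Sum>n\<in>idx w.
        cc (clz (row v) m) (clz (row w) n) *
        cc (clz m (col v)) (clz n (col w))) (some_rep Y) =
        (if m = row v then ?d v * lin_form ?d (some_rep Y) else 0)"
      if m: "m \<in> idx v" for m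
    proof -
      have "lin_form (\<lambda>w. \<Sum>n\<in>idx w.
          cc (clz (row v) m) (clz (row w) n) *
          cc (clz m (col v)) (clz n (col w))) (some_rep Y) =
          lin_form (\<lambda>w. (if m = row v then ?d v else 0) * ?d w) (some_rep Y)"
      proof (rule lin_form_cong)
        fix w assume "w \<in> Poly_Mapping.keys (some_rep Y)"
        then have "word_of N w" using some_rep_in_F[OF Y(2)] Y(1) by (simp add: carrier_free_ring)
        from inner[OF this m] show "(\<Sum>n\<in>idx w.
          cc (clz (row v) m) (clz (row w) n) *
          cc (clz m (col v)) (clz n (col w))) =
          (if m = row v then ?d v else 0) * ?d w" by simp
      qed
      then show ?thesis by (simp only: lin_form_fun_mult) simp
    qed
    then show ?thesis
      using row_in_multi_indices[OF v] by simp
  qed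
  then have "convolution A cc cc X Y = lin_form (\<lambda>v. ?d v * lin_form ?d (some_rep Y)) (some_rep X)"
    unfolding convolution_eq using some_rep_in_F[OF X(2)] X(1)
    by (intro lin_form_cong) (auto simp: carrier_free_ring)
  also have "\<dots> = free_counit (some_rep X) * free_counit (some_rep Y)"
    by (simp only: lin_form_fun_mult_right free_counit_eq)
  finally show ?thesis
    by (simp add: universal_algebra_def Let_def)
qed

end

section \<open>The convolution inverse of the cocycle and the twisted product of words\<close>

lemma degfun_chi': "i \<in> multi_indices N k \<Longrightarrow> degfun N (\<lambda>j. c * chi i j)"
  unfolding degfun_def
  by (intro allI ballI impI arg_cong[where f="(*) c"] chi_deg_cong) auto

lemma weight_diff: "weight \<alpha> \<beta> (f - g) = weight \<alpha> \<beta> f - weight \<alpha> \<beta> g"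
  by (simp add: weight_def lin_ext_diff)

lemma weight_vscale: "weight \<alpha> \<beta> (vscale c f) = vscale c (weight \<alpha> \<beta> f)"
  by (simp add: weight_def lin_ext_vscale)

lemma weight_basis: "weight \<alpha> \<beta> (basis_vec w) = vscale (\<alpha> (row w) * \<beta> (col w)) (basis_vec w)"
  by (simp add: weight_def)

lemma keys_sum_subset: "Poly_Mapping.keys (\<Sum>x\<in>S. g x) \<subseteq> (\<Union>x\<in>S. Poly_Mapping.keys (g x))"
proof (induction S rule: infinite_finite_induct)
  case (insert x S)
  then show ?case using keys_add[of "g x" "\<Sum>x\<in>S. g x"] by auto
qed auto

context twisted_presentation
begin

definition tau :: "free_alg set \<Rightarrow> free_alg set \<Rightarrow> complex"
  where "tau = conv_inverse A cc"

abbreviation dg :: "(nat \<times> nat) free_mon \<Rightarrow> complex"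
  where "dg w \<equiv> if row w = col w then 1 else 0"

text \<open>The witness for the choice is \<open>cc\<close> itself. From here on, \<open>tau\<close>
  is known only through bilinearity and its convolution equation.\<close>

lemma tau: "bilinear_form A tau"
  "X \<in> carrier A \<Longrightarrow> Y \<in> carrier A \<Longrightarrow> convolution A tau cc X Y = counit A X * counit A Y"
proof -
  have "bilinear_form A tau \<and> (\<forall>x\<in>carrier A. \<forall>y\<in>carrier A.
       convolution A cc tau x y = counit A x * counit A y \<and>
       convolution A tau cc x y = counit A x * counit A y)"
    unfolding tau_def conv_inverse_def
    by (rule someI[of _ cc]) (simp add: bilinear_form_cocycle convolution_cocycle)
  then show "bilinear_form A tau"
    "X \<in> carrier A \<Longrightarrow> Y \<in> carrier A \<Longrightarrow> convolution A tau cc X Y = counit A X * counit A Y"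
    by blast+
qed

definition linear_on_A :: "(free_alg set \<Rightarrow> complex) \<Rightarrow> bool"
  where "linear_on_A h \<longleftrightarrow> (\<forall>X\<in>carrier A. \<forall>Y\<in>carrier A. h (X \<oplus>\<^bsub>A\<^esub> Y) = h X + h Y) \<and>
    (\<forall>c. \<forall>X\<in>carrier A. h (c \<odot>\<^bsub>A\<^esub> X) = c * h X)"

lemma linear_on_A_tau:
  "Y \<in> carrier A \<Longrightarrow> linear_on_A (\<lambda>X. tau X Y)" "Y \<in> carrier A \<Longrightarrow> linear_on_A (\<lambda>X. tau Y X)"
  using tau(1) by (auto simp: linear_on_A_def bilinear_form_def)

lemma linear_on_A_scale:
  assumes "linear_on_A h" "f \<in> F"
  shows "h (cl (vscale c f)) = c * h (cl f)"
proof -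
  have "cl f \<in> carrier A" using assms by (simp add: carrier_A)
  then have "h (c \<odot>\<^bsub>A\<^esub> cl f) = c * h (cl f)"
    using assms(1) unfolding linear_on_A_def by blast
  then show ?thesis by (simp add: smult_A)
qed

lemma linear_on_A_eq:
  assumes h: "linear_on_A h" and f: "f \<in> F"
  shows "h (cl f) = lin_form (\<lambda>w. h (clw w)) f"
proof -
  have F0: "0 \<in> F" by (rule free_vs.subspace_0[OF subspace_carrier])
  have "h (cl (\<Sum>w\<in>X. vscale (c w) (basis_vec w))) = (\<Sum>w\<in>X. c w * h (clw w))"
    if "finite X" "\<forall>w\<in>X. word_of N w" for X and c :: "(nat \<times> nat) free_mon \<Rightarrow> complex"
    using that
  proof (induction X rule: finite_induct)
    case empty
    then show ?case using linear_on_A_scale[OF h F0, of 0] by simp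
  next
    case (insert w X)
    let ?f = "vscale (c w) (basis_vec w)" and ?g = "\<Sum>w\<in>X. vscale (c w) (basis_vec w)"
    have mem: "?f \<in> F" "?g \<in> F"
      using insert.prems
      by (auto intro!: free_vs.subspace_sum[OF subspace_carrier] free_vs.subspace_scale[OF subspace_carrier])
    have "h (cl ?f \<oplus>\<^bsub>A\<^esub> cl ?g) = h (cl ?f) + h (cl ?g)"
      using h mem unfolding linear_on_A_def carrier_A by blast
    then have "h (cl (?f + ?g)) = h (cl ?f) + h (cl ?g)"
      using mem by (simp add: add_A)
    moreover have "h (cl ?f) = c w * h (clw w)"
      using insert.prems by (intro linear_on_A_scale[OF h]) simp
    ultimately show ?case using insert by simp
  qed
  from this[OF finite_keys, of f "Poly_Mapping.lookup f"] f show ?thesis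
    using lin_ext_basis_vec[of f] by (simp add: lin_ext_def lin_form_def carrier_free_ring)
qed

text \<open>Convolutions are evaluated at a chosen representative \<open>f\<close> of the coset of
  \<open>v\<close>. Weighting by a function of the column degree is well defined on cosets, so
  \<open>f\<close> may be traded for the word \<open>v\<close>.\<close>

lemma linear_on_A_absorb:
  assumes h: "linear_on_A h" and \<alpha>: "degfun N \<alpha>" and f: "f \<in> F" and v: "word_of N v"
    and fv: "f - basis_vec v \<in> J"
  shows "lin_form (\<lambda>w. \<alpha> (col w) * h (clw w)) f = \<alpha> (col v) * h (clw v)"
proof -
  have "lin_form (\<lambda>w. \<alpha> (col w) * h (clw w)) f = lin_form (\<lambda>w. h (clw w)) (weight (\<lambda>i. 1) \<alpha> f)"
    using lin_form_weight[of "\<lambda>i. 1" \<alpha> "\<lambda>w. h (clw w)" f] by simp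
  also have "\<dots> = h (cl (weight (\<lambda>i. 1) \<alpha> f))"
    by (rule linear_on_A_eq[OF h weight_in_carrier[OF f], symmetric])
  also have "cl (weight (\<lambda>i. 1) \<alpha> f) = cl (weight (\<lambda>i. 1) \<alpha> (basis_vec v))"
    using weight_J[OF degfun_const \<alpha> fv] by (simp add: cl_eq_iff weight_diff)
  also have "h \<dots> = \<alpha> (col v) * h (clw v)"
    using v by (simp add: weight_basis linear_on_A_scale[OF h])
  finally show ?thesis .
qed

text \<open>Since \<open>cc\<close> is supported on diagonal words, the equation \<open>tau * cc = \<epsilon> \<otimes> \<epsilon>\<close> can be solved
  for \<open>tau\<close> word by word.\<close>

lemma tau_words:
  assumes v: "word_of N v" and w: "word_of N w"
  shows "tau (clw v) (clw w) = dg v * dg w * chi (row v) (row w)"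
proof -
  let ?f = "some_rep (clw v)" and ?g = "some_rep (clw w)"
  have vF: "?f \<in> F" and wF: "?g \<in> F" using v w by (simp_all add: some_rep_in_F)
  have cA: "clw x \<in> carrier A" if "word_of N x" for x using that by (simp add: carrier_A)
  have inner: "(\<Sum>m\<in>idx v'. lin_form (\<lambda>w'. \<Sum>n\<in>idx w'.
      tau (clz (row v') m) (clz (row w') n) *
      cc (clz m (col v')) (clz n (col w'))) ?g) =
      chi (col v') (col w) * tau (clw v') (clw w)" if v': "word_of N v'" for v'
  proof -
    have "lin_form (\<lambda>w'. \<Sum>n\<in>idx w'.
        tau (clz (row v') m) (clz (row w') n) *
        cc (clz m (col v')) (clz n (col w'))) ?g =
        (if m = col v' then lin_form (\<lambda>w'. chi (col v') (col w') * tau (clw v') (clw w')) ?g else 0)"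
      if m: "m \<in> idx v'" for m
    proof -
      have "(\<Sum>n\<in>idx w'.
          tau (clz (row v') m) (clz (row w') n) *
          cc (clz m (col v')) (clz n (col w'))) =
          (if m = col v' then 1 else 0) * (chi (col v') (col w') * tau (clw v') (clw w'))"
        if w': "word_of N w'" for w'
      proof -
        have "(\<Sum>n\<in>idx w'.
            tau (clz (row v') m) (clz (row w') n) *
            cc (clz m (col v')) (clz n (col w'))) =
          (\<Sum>n\<in>idx w'. if n = col w' then
            (if m = col v' then 1 else 0) * (chi (col v') (col w') * tau (clw v') (clw w')) else 0)"
        proof (rule sum.cong[OF refl])
          fix n assume n: "n \<in> idx w'"
          have 1: "cc (clz m (col v')) (clz n (col w')) =
              (if m = col v' \<and> n = col w' then chi m n else 0)"
            using col_in_multi_indices[OF v'] col_in_multi_indices[OF w'] m n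
            by (subst cocycle_words) (auto intro: word_of_zip simp: length_multi_index)
          show "tau (clz (row v') m) (clz (row w') n) *
            cc (clz m (col v')) (clz n (col w')) =
            (if n = col w' then
            (if m = col v' then 1 else 0) * (chi (col v') (col w') * tau (clw v') (clw w')) else 0)"
            unfolding 1 by (auto simp: zip_row_col)
        qed
        then show ?thesis using col_in_multi_indices[OF w'] by simp
      qed
      then have "lin_form (\<lambda>w'. \<Sum>n\<in>idx w'.
        tau (clz (row v') m) (clz (row w') n) *
        cc (clz m (col v')) (clz n (col w'))) ?g =
        lin_form (\<lambda>w'. (if m = col v' then 1 else 0) * (chi (col v') (col w') * tau (clw v') (clw w'))) ?g"
        using wF by (intro lin_form_cong) (simp add: carrier_free_ring)
      then show ?thesis by (simp only: lin_form_fun_mult) simp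
    qed
    moreover have "lin_form (\<lambda>w'. chi (col v') (col w') * tau (clw v') (clw w')) ?g =
        chi (col v') (col w) * tau (clw v') (clw w)"
      using linear_on_A_absorb[OF linear_on_A_tau(2)[OF cA[OF v']]
          degfun_chi'[OF col_in_multi_indices[OF v'], of 1] wF w some_rep_cl] by simp
    ultimately show ?thesis using col_in_multi_indices[OF v'] by simp
  qed
  have "convolution A tau cc (clw v) (clw w) = lin_form (\<lambda>v'. chi (col v') (col w) * tau (clw v') (clw w)) ?f"
    unfolding convolution_eq using vF inner by (intro lin_form_cong) (simp add: carrier_free_ring)
  also have "\<dots> = chi (col v) (col w) * tau (clw v) (clw w)"
    by (rule linear_on_A_absorb[OF linear_on_A_tau(1)[OF cA[OF w]]
          degfun_chi[OF col_in_multi_indices[OF w]] vF v some_rep_cl])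
  also have "convolution A tau cc (clw v) (clw w) = dg v * dg w"
    using tau(2)[OF cA[OF v] cA[OF w]] by (simp add: counit_cl free_counit_eq)
  finally have "chi (col v) (col w) * (chi (col v) (col w) * tau (clw v) (clw w)) =
      chi (col v) (col w) * (dg v * dg w)" by simp
  then have "tau (clw v) (clw w) = chi (col v) (col w) * (dg v * dg w)"
    by (simp add: mult.assoc[symmetric] chi_sq)
  then show ?thesis by auto
qed

lemma lin_ext_comult:
  "lin_ext G (comult A X) = lin_ext (\<lambda>w. \<Sum>m\<in>idx w.
    G (clz (row w) m, clz m (col w))) (some_rep X)"
  by (simp add: comult_A free_comult_eq lin_ext_lin_ext lin_ext_sum case_prod_unfold)

lemma iter_comult_2:
  "iter_comult A 2 X = lin_ext (\<lambda>(a, b). lin_ext (\<lambda>(a', b'). basis_vec [a, a', b']) (comult A b)) (comult A X)"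
  by (simp add: numeral_2_eq_2 lin_ext_lin_ext case_prod_unfold)

text \<open>All Sweedler factors are cosets of words, where \<open>cc\<close> and \<open>tau\<close>
  have known values.\<close>

lemma keys_comult:
  assumes f: "f \<in> F" and p: "p \<in> Poly_Mapping.keys (comult A (cl f))"
  shows "\<exists>v w. word_of N v \<and> word_of N w \<and> p = (clw v, clw w)"
proof -
  have "comult A (cl f) = lin_ext (\<lambda>w. \<Sum>m\<in>idx w.
    basis_vec (clz (row w) m, clz m (col w))) (some_rep (cl f))"
    using lin_ext_comult[of basis_vec "cl f"] by (simp only: lin_ext_basis_vec)
  with p obtain w where w: "w \<in> Poly_Mapping.keys (some_rep (cl f))" and
    "p \<in> Poly_Mapping.keys (\<Sum>m\<in>idx w.
      (basis_vec (clz (row w) m, clz m (col w)) :: _ \<Rightarrow>\<^sub>0 complex))"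
    using keys_lin_ext by fastforce
  then obtain m where m: "m \<in> idx w"
    and p: "p = (clz (row w) m, clz m (col w))"
    using keys_sum_subset by fastforce
  have "word_of N w" using some_rep_in_F[OF f] w by (simp add: carrier_free_ring)
  then show ?thesis
    using p m word_of_zip row_in_multi_indices col_in_multi_indices by blast
qed

lemma keys_iter_comult:
  assumes f: "f \<in> F" and a: "a \<in> Poly_Mapping.keys (iter_comult A 2 (cl f))"
  shows "\<exists>v v' w. word_of N v \<and> word_of N v' \<and> word_of N w \<and> a = [clw v, clw v', clw w]"
proof -
  obtain p where p: "p \<in> Poly_Mapping.keys (comult A (cl f))"
    and a: "a \<in> Poly_Mapping.keys (case p of (x, b) \<Rightarrow> lin_ext (\<lambda>(a', b'). basis_vec [x, a', b']) (comult A b))"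
    using subsetD[OF keys_lin_ext a[unfolded iter_comult_2]] by (rule UN_E)
  from keys_comult[OF f p] obtain v w where vw: "word_of N v" "word_of N w" "p = (clw v, clw w)"
    by blast
  have "a \<in> Poly_Mapping.keys (lin_ext (\<lambda>(a', b'). basis_vec [clw v, a', b']) (comult A (clw w)))"
    using a vw(3) by simp
  from subsetD[OF keys_lin_ext this] obtain q where q: "q \<in> Poly_Mapping.keys (comult A (clw w))"
    and a: "a \<in> Poly_Mapping.keys ((case q of (a', b') \<Rightarrow> basis_vec [clw v, a', b']) :: _ \<Rightarrow>\<^sub>0 complex)"
    by (rule UN_E)
  have "basis_vec w \<in> F" using vw by simp
  from keys_comult[OF this q] obtain v' w' where "word_of N v'" "word_of N w'" "q = (clw v', clw w')"
    by blast
  with a vw show ?thesis by auto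
qed

text \<open>The outer Sweedler factors only see diagonal words, so they collapse and leave weights on the
  middle factor.\<close>

lemma lin_ext_iter_comult:
  assumes f: "f \<in> F" and \<alpha>: "degfun N \<alpha>" and \<beta>: "degfun N \<beta>"
    and BJ: "\<And>g. g \<in> J \<Longrightarrow> lin_ext B g \<in> J"
    and \<Psi>: "\<And>v v' w. word_of N v \<Longrightarrow> word_of N v' \<Longrightarrow> word_of N w \<Longrightarrow>
      \<Psi> [clw v, clw v', clw w] - vscale (dg v * \<alpha> (row v) * (dg w * \<beta> (col w))) (B v') \<in> J"
  shows "lin_ext \<Psi> (iter_comult A 2 (cl f)) - lin_ext B (weight \<alpha> \<beta> f) \<in> J"
proof -
  \<comment> \<open>The sum that remains once the first factor is split off. The two coproducts are
    handled in separate rounds because the second one chooses a new representative for the coset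
    produced by the first.\<close>
  define I where "I a b = lin_ext (\<lambda>(a', b'). \<Psi> [a, a', b']) (comult A b)" for a b
  have I: "I (clw v) (clw u) - vscale (dg v * \<alpha> (row v) * \<beta> (col u)) (B u) \<in> J"
    if v: "word_of N v" and u: "word_of N u" for v u
  proof -
    let ?g = "some_rep (clw u)"
    have g: "?g \<in> F" using u by (simp add: some_rep_in_F)
    have "I (clw v) (clw u) = lin_ext (\<lambda>w. \<Sum>m\<in>idx w.
        \<Psi> [clw v, clz (row w) m, clz m (col w)]) ?g"
      by (simp add: I_def lin_ext_comult)
    also have "\<dots> - lin_ext (\<lambda>w. vscale (dg v * \<alpha> (row v)) (vscale (1 * \<beta> (col w)) (B w))) ?g \<in> J"
    proof (rule J_lin_ext_diff)
      fix w assume "w \<in> Poly_Mapping.keys ?g"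
      then have w: "word_of N w" using g by (simp add: carrier_free_ring)
      let ?M = "idx w"
      have "(\<Sum>m\<in>?M. \<Psi> [clw v, clz (row w) m, clz m (col w)]) -
          (\<Sum>m\<in>?M. if m = col w then vscale (dg v * \<alpha> (row v) * \<beta> (col w)) (B w) else 0) \<in> J"
      proof (rule J_sum_diff)
        fix m assume m: "m \<in> ?M"
        then have "word_of N (Word (zip (row w) m))" "word_of N (Word (zip m (col w)))"
          using w row_in_multi_indices col_in_multi_indices by (auto intro: word_of_zip)
        from \<Psi>[OF v this] show "\<Psi> [clw v, clz (row w) m, clz m (col w)] -
            (if m = col w then vscale (dg v * \<alpha> (row v) * \<beta> (col w)) (B w) else 0) \<in> J"
          using m by (cases "m = col w") (simp_all add: length_multi_index zip_row_col)
      qed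
      then show "(\<Sum>m\<in>?M. \<Psi> [clw v, clz (row w) m, clz m (col w)]) -
          vscale (dg v * \<alpha> (row v)) (vscale (1 * \<beta> (col w)) (B w)) \<in> J"
        using col_in_multi_indices[OF w] by simp
    qed
    also have "lin_ext (\<lambda>w. vscale (dg v * \<alpha> (row v)) (vscale (1 * \<beta> (col w)) (B w))) ?g =
        vscale (dg v * \<alpha> (row v)) (lin_ext B (weight (\<lambda>i. 1) \<beta> ?g))"
      unfolding lin_ext_fun_vscale lin_ext_weight[of "\<lambda>i. 1" \<beta> B ?g, symmetric] ..
    finally have 1: "I (clw v) (clw u) - vscale (dg v * \<alpha> (row v)) (lin_ext B (weight (\<lambda>i. 1) \<beta> ?g)) \<in> J" .
    \<comment> \<open>Trading the representative for the word \<open>u\<close> costs an element of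
      \<open>J\<close>, since both \<open>weight\<close> and \<open>B\<close> preserve
      \<open>J\<close>.\<close>
    have "vscale (dg v * \<alpha> (row v)) (lin_ext B (weight (\<lambda>i. 1) \<beta> (?g - basis_vec u))) \<in> J"
      by (intro J_scale BJ weight_J degfun_const \<beta> some_rep_cl)
    then have 2: "vscale (dg v * \<alpha> (row v)) (lin_ext B (weight (\<lambda>i. 1) \<beta> ?g)) -
        vscale (dg v * \<alpha> (row v) * \<beta> (col u)) (B u) \<in> J"
      unfolding weight_diff lin_ext_diff free_vs.scale_right_diff_distrib
      by (simp add: weight_basis lin_ext_vscale)
    show ?thesis by (rule J_trans[OF 1 2])
  qed
  let ?f = "some_rep (cl f)"
  have "lin_ext \<Psi> (iter_comult A 2 (cl f)) = lin_ext (\<lambda>(a, b). I a b) (comult A (cl f))"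
    by (simp add: iter_comult_2 lin_ext_lin_ext I_def case_prod_unfold)
  also have "\<dots> = lin_ext (\<lambda>w. \<Sum>m\<in>idx w.
      I (clz (row w) m) (clz m (col w))) ?f"
    by (simp add: lin_ext_comult)
  also have "\<dots> - lin_ext (\<lambda>w. vscale (\<alpha> (row w) * \<beta> (col w)) (B w)) ?f \<in> J"
  proof (rule J_lin_ext_diff)
    fix w assume "w \<in> Poly_Mapping.keys ?f"
    then have w: "word_of N w" using some_rep_in_F[OF f] by (simp add: carrier_free_ring)
    let ?M = "idx w"
    have "(\<Sum>m\<in>?M. I (clz (row w) m) (clz m (col w))) -
        (\<Sum>m\<in>?M. if m = row w then vscale (\<alpha> (row w) * \<beta> (col w)) (B w) else 0) \<in> J"
    proof (rule J_sum_diff)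
      fix m assume m: "m \<in> ?M"
      then have "word_of N (Word (zip (row w) m))" "word_of N (Word (zip m (col w)))"
        using w row_in_multi_indices col_in_multi_indices by (auto intro: word_of_zip)
      from I[OF this] show "I (clz (row w) m) (clz m (col w)) -
          (if m = row w then vscale (\<alpha> (row w) * \<beta> (col w)) (B w) else 0) \<in> J"
        using m by (cases "m = row w") (simp_all add: length_multi_index zip_row_col)
    qed
    then show "(\<Sum>m\<in>?M. I (clz (row w) m) (clz m (col w))) -
        vscale (\<alpha> (row w) * \<beta> (col w)) (B w) \<in> J"
      using row_in_multi_indices[OF w] by simp
  qed
  also have "lin_ext (\<lambda>w. vscale (\<alpha> (row w) * \<beta> (col w)) (B w)) ?f = lin_ext B (weight \<alpha> \<beta> ?f)"
    by (rule lin_ext_weight)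
  finally have 1: "lin_ext \<Psi> (iter_comult A 2 (cl f)) - lin_ext B (weight \<alpha> \<beta> ?f) \<in> J" .
  have 2: "lin_ext B (weight \<alpha> \<beta> ?f) - lin_ext B (weight \<alpha> \<beta> f) \<in> J"
    using BJ[OF weight_J[OF \<alpha> \<beta> some_rep_cl[of f]]] by (simp add: weight_diff lin_ext_diff)
  show ?thesis by (rule J_trans[OF 1 2])
qed

text \<open>The first Sweedler factors contribute the sign of the rows, the last ones that of the
  columns. The scalar \<open>s\<close> on the right is there because products are built up by
  prefixing letters to already signed words.\<close>

lemma twist_mult_words:
  assumes v: "word_of N v" and w: "word_of N w"
  shows "twist_mult A cc (clw v) (cl (vscale s (basis_vec w))) =
    cl (vscale (s * chi (row v) (row w) * chi (col v) (col w)) (basis_vec v * basis_vec w))"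
proof -
  define P where "P = iter_comult A 2 (clw v)"
  define Q where "Q = iter_comult A 2 (cl (vscale s (basis_vec w)))"
  \<comment> \<open>A representative of the middle Sweedler factor in the free algebra, so that
    products in \<open>A\<close> become cosets of products of representatives.\<close>
  define r where "r a = some_rep (a ! 1)" for a :: "free_alg set list"
  define H where "H a b = vscale (cc (a ! 0) (b ! 0) * tau (a ! 2) (b ! 2)) (r a * r b)" for a b
  have vF: "basis_vec v \<in> F" and wF: "vscale s (basis_vec w) \<in> F"
    using v w by (auto intro: free_vs.subspace_scale[OF subspace_carrier])
  have wF': "basis_vec w \<in> F" using w by simp
  have r: "cl (r a) = a ! 1" "r a \<in> F" if "a \<in> Poly_Mapping.keys P \<or> a \<in> Poly_Mapping.keys Q" for a
  proof -
    obtain x x' y where "word_of N x'" "a = [clw x, clw x', clw y]"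
      using \<open>a \<in> _ \<or> a \<in> _\<close> keys_iter_comult[OF vF] keys_iter_comult[OF wF] unfolding P_def Q_def by blast
    then show "cl (r a) = a ! 1" "r a \<in> F" by (simp_all add: r_def some_rep_in_F)
  qed
  have mem: "vscale c (r a * r b) \<in> F" if "a \<in> Poly_Mapping.keys P" "b \<in> Poly_Mapping.keys Q" for a b c
    using r that by (intro free_vs.subspace_scale[OF subspace_carrier] mult_in_carrier) auto
  let ?c = "\<lambda>a b. Poly_Mapping.lookup P a * Poly_Mapping.lookup Q b * cc (a ! 0) (b ! 0) * tau (a ! 2) (b ! 2)"
  have "twist_mult A cc (clw v) (cl (vscale s (basis_vec w))) =
      (\<Oplus>\<^bsub>A\<^esub>a\<in>Poly_Mapping.keys P. \<Oplus>\<^bsub>A\<^esub>b\<in>Poly_Mapping.keys Q. ?c a b \<odot>\<^bsub>A\<^esub> (a ! 1 \<otimes>\<^bsub>A\<^esub> b ! 1))"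
    by (simp only: twist_mult_def P_def Q_def tau_def)
  also have "\<dots> = cl (\<Sum>a\<in>Poly_Mapping.keys P. \<Sum>b\<in>Poly_Mapping.keys Q. vscale (?c a b) (r a * r b))"
  proof (rule finsum_A[OF finite_keys])
    fix a assume a: "a \<in> Poly_Mapping.keys P"
    show "(\<Oplus>\<^bsub>A\<^esub>b\<in>Poly_Mapping.keys Q. ?c a b \<odot>\<^bsub>A\<^esub> (a ! 1 \<otimes>\<^bsub>A\<^esub> b ! 1)) =
        cl (\<Sum>b\<in>Poly_Mapping.keys Q. vscale (?c a b) (r a * r b))"
    proof (rule finsum_A[OF finite_keys])
      fix b assume b: "b \<in> Poly_Mapping.keys Q"
      have "a ! 1 \<otimes>\<^bsub>A\<^esub> b ! 1 = cl (r a * r b)"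
        using r[of a] r[of b] a b mult_A[of "r a" "r b"] by simp
      then show "?c a b \<odot>\<^bsub>A\<^esub> (a ! 1 \<otimes>\<^bsub>A\<^esub> b ! 1) = cl (vscale (?c a b) (r a * r b))"
        by (simp only: smult_A)
    qed (rule mem[OF a])
    show "(\<Sum>b\<in>Poly_Mapping.keys Q. vscale (?c a b) (r a * r b)) \<in> F"
      by (intro free_vs.subspace_sum[OF subspace_carrier] mem a)
  qed
  also have "(\<Sum>a\<in>Poly_Mapping.keys P. \<Sum>b\<in>Poly_Mapping.keys Q. vscale (?c a b) (r a * r b)) =
      lin_ext (\<lambda>a. lin_ext (H a) Q) P"
    by (simp add: lin_ext_def H_def free_vs.scale_sum_right mult.assoc)
  finally have tm: "twist_mult A cc (clw v) (cl (vscale s (basis_vec w))) = cl (lin_ext (\<lambda>a. lin_ext (H a) Q) P)" .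
  \<comment> \<open>The right factor is expanded first, with the three factors of the left word held
    fixed; these supply its weights. Afterwards \<open>lin_ext_iter_comult\<close> is applied once
    more to the left word, with weights supplied by \<open>w\<close>.\<close>
  have inner: "lin_ext (H [clw x, clw x', clw y]) Q - vscale (dg x * chi (row x) (row w) * (dg y * chi (col y) (col w)))
      (vscale s (basis_vec x' * basis_vec w)) \<in> J"
    if x: "word_of N x" "word_of N x'" "word_of N y" for x x' y
  proof -
    let ?a = "[clw x, clw x', clw y]"
    let ?\<alpha> = "\<lambda>i. dg x * chi (row x) i" and ?\<beta> = "\<lambda>j. dg y * chi (row y) j"
    have ra: "r ?a \<in> F" using x by (simp add: r_def some_rep_in_F)
    have 1: "lin_ext (H ?a) Q - lin_ext (\<lambda>b. r ?a * basis_vec b) (weight ?\<alpha> ?\<beta> (vscale s (basis_vec w))) \<in> J"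
      unfolding Q_def
    proof (rule lin_ext_iter_comult[OF wF])
      show "degfun N ?\<alpha>" "degfun N ?\<beta>"
        by (rule degfun_chi'[OF row_in_multi_indices]; fact)+
      show "lin_ext (\<lambda>b. r ?a * basis_vec b) g \<in> J" if "g \<in> J" for g
        using J_mult_left[OF that ra] by (simp add: lin_ext_mult_right[symmetric] lin_ext_basis_vec)
      fix z z' u assume z: "word_of N z" "word_of N z'" "word_of N u"
      have "vscale (dg z * ?\<alpha> (row z) * (dg u * ?\<beta> (col u))) (r ?a * (some_rep (clw z') - basis_vec z')) \<in> J"
        by (intro J_scale J_mult_left some_rep_cl ra)
      moreover have "H ?a [clw z, clw z', clw u] =
          vscale (dg z * ?\<alpha> (row z) * (dg u * ?\<beta> (col u))) (r ?a * some_rep (clw z'))"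
        using x z by (simp add: H_def cocycle_words tau_words r_def)
      ultimately show "H ?a [clw z, clw z', clw u] -
          vscale (dg z * ?\<alpha> (row z) * (dg u * ?\<beta> (col u))) (r ?a * basis_vec z') \<in> J"
        by (simp only: right_diff_distrib free_vs.scale_right_diff_distrib)
    qed
    have 2: "vscale (s * (?\<alpha> (row w) * ?\<beta> (col w))) ((r ?a - basis_vec x') * basis_vec w) \<in> J"
      unfolding r_def using some_rep_cl by (intro J_scale J_mult_right wF') simp
    have e: "lin_ext (\<lambda>b. r ?a * basis_vec b) (weight ?\<alpha> ?\<beta> (vscale s (basis_vec w))) =
        vscale (s * (?\<alpha> (row w) * ?\<beta> (col w))) (r ?a * basis_vec w)"
      by (simp add: weight_vscale weight_basis lin_ext_vscale)
    have "lin_ext (H ?a) Q - vscale (s * (?\<alpha> (row w) * ?\<beta> (col w))) (basis_vec x' * basis_vec w) \<in> J"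
      by (rule J_trans[OF 1[unfolded e] 2[unfolded left_diff_distrib free_vs.scale_right_diff_distrib]])
    moreover have "vscale (s * (?\<alpha> (row w) * ?\<beta> (col w))) (basis_vec x' * basis_vec w) =
        vscale (dg x * chi (row x) (row w) * (dg y * chi (col y) (col w))) (vscale s (basis_vec x' * basis_vec w))"
      by (auto simp: mult.commute)
    ultimately show ?thesis by simp
  qed
  have "lin_ext (\<lambda>a. lin_ext (H a) Q) P - lin_ext (\<lambda>x. vscale s (basis_vec x * basis_vec w))
      (weight (\<lambda>i. chi i (row w)) (\<lambda>j. chi j (col w)) (basis_vec v)) \<in> J"
    unfolding P_def
  proof (rule lin_ext_iter_comult[OF vF])
    show "degfun N (\<lambda>i. chi i (row w))" "degfun N (\<lambda>j. chi j (col w))"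
      by (rule degfun_chi[OF row_in_multi_indices[OF w]] degfun_chi[OF col_in_multi_indices[OF w]])+
    show "lin_ext (\<lambda>x. vscale s (basis_vec x * basis_vec w)) g \<in> J" if "g \<in> J" for g
      using J_scale[OF J_mult_right[OF that wF'], of s]
      by (simp add: lin_ext_fun_vscale lin_ext_mult_left[symmetric] lin_ext_basis_vec)
  qed (rule inner)
  then show ?thesis
    unfolding tm cl_eq_iff by (simp add: weight_basis lin_ext_vscale mult.commute mult.left_commute)
qed

abbreviation tA :: "free_alg set star_bialgebra"
  where "tA \<equiv> twist A cc"

text \<open>Prefixing the letter \<open>(a, b)\<close> multiplies the coefficient by
  \<open>chi [a] i'\<close> and \<open>chi [b] j'\<close>, which is the recursion of
  \<open>sg\<close> in rows and columns.\<close>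

lemma rep_power_twist:
  "i \<in> multi_indices N k \<Longrightarrow> j \<in> multi_indices N k \<Longrightarrow>
    rep_power tA (\<lambda>i j. cl (u_gen i j)) i j = cl (vscale (sg i * sg j) (wd i j))"
proof (induction k arbitrary: i j)
  case 0
  then show ?case by (simp add: twist_def one_A)
next
  case (Suc k)
  from Suc.prems obtain a i' b j' where ij: "i = a # i'" "j = b # j'" "a \<in> {1..N}" "b \<in> {1..N}"
      "i' \<in> multi_indices N k" "j' \<in> multi_indices N k"
    unfolding multi_indices_Suc by auto
  have len: "length i' = length j'" using ij by (simp add: length_multi_index)
  have "rep_power tA (\<lambda>i j. cl (u_gen i j)) i j =
      twist_mult A cc (cl (u_gen a b)) (cl (vscale (sg i' * sg j') (wd i' j')))"
    using Suc.IH[OF ij(5,6)] by (simp add: ij(1,2) twist_def)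
  also have "\<dots> = cl (vscale (sg i' * sg j' * chi [a] i' * chi [b] j') (u_gen a b * wd i' j'))"
    using twist_mult_words[of "Word [(a, b)]" "Word (zip i' j')" "sg i' * sg j'"] ij len word_of_zip[OF ij(5,6)]
    by (simp add: u_gen_def wd_def word_of_def row_def col_def)
  also have "\<dots> = cl (vscale (sg i * sg j) (wd i j))"
    by (simp add: ij(1,2) wd_Cons ac_simps)
  finally show ?case .
qed

text \<open>The twisted relation for \<open>T\<close> differs from the untwisted one for
  \<open>tw T\<close> by the common sign \<open>sg i * sg j\<close>, so both lie in \<open>J\<close>
  together. Tannaka-Krein duality then applies to \<open>tw T\<close>.\<close>

theorem Mor_twist: "Mor tA N (\<lambda>i j. cl (u_gen i j)) k l = T_vec N k l ` K k l"
proof -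
  let ?u = "\<lambda>i j. cl (u_gen i j)"
  have fs: "finsum tA h X = finsum A h X" for h :: "nat list \<Rightarrow> free_alg set" and X
    by (simp add: finsum_def finprod_def twist_def)
  have sm: "(\<odot>\<^bsub>tA\<^esub>) = (\<odot>\<^bsub>A\<^esub>)" by (simp add: twist_def)
  have eq: "(\<Oplus>\<^bsub>tA\<^esub>m\<in>multi_indices N k. T i m \<odot>\<^bsub>tA\<^esub> rep_power tA ?u m j) =
      (\<Oplus>\<^bsub>tA\<^esub>m\<in>multi_indices N l. T m j \<odot>\<^bsub>tA\<^esub> rep_power tA ?u i m) \<longleftrightarrow>
      intertw N k l (tw T) i j \<in> J"
    if ij: "i \<in> multi_indices N l" "j \<in> multi_indices N k" for i j T
  proof -
    let ?X = "\<Sum>m\<in>multi_indices N k. vscale (T i m * (sg m * sg j)) (wd m j)"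
    let ?Y = "\<Sum>m\<in>multi_indices N l. vscale (T m j * (sg i * sg m)) (wd i m)"
    have 1: "(\<Oplus>\<^bsub>tA\<^esub>m\<in>multi_indices N k. T i m \<odot>\<^bsub>tA\<^esub> rep_power tA ?u m j) = cl ?X"
      unfolding fs sm
    proof (rule finsum_A[OF finite_multi_indices])
      fix m assume "m \<in> multi_indices N k"
      then show "T i m \<odot>\<^bsub>A\<^esub> rep_power tA ?u m j = cl (vscale (T i m * (sg m * sg j)) (wd m j))"
        "vscale (T i m * (sg m * sg j)) (wd m j) \<in> F"
        using ij by (simp_all add: rep_power_twist smult_A
            free_vs.subspace_scale[OF subspace_carrier wd_in_carrier])
    qed
    have 2: "(\<Oplus>\<^bsub>tA\<^esub>m\<in>multi_indices N l. T m j \<odot>\<^bsub>tA\<^esub> rep_power tA ?u i m) = cl ?Y"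
      unfolding fs sm
    proof (rule finsum_A[OF finite_multi_indices])
      fix m assume "m \<in> multi_indices N l"
      then show "T m j \<odot>\<^bsub>A\<^esub> rep_power tA ?u i m = cl (vscale (T m j * (sg i * sg m)) (wd i m))"
        "vscale (T m j * (sg i * sg m)) (wd i m) \<in> F"
        using ij by (simp_all add: rep_power_twist smult_A
            free_vs.subspace_scale[OF subspace_carrier wd_in_carrier])
    qed
    have sgsg: "sg x * (sg x * c) = c" for x c
      using sg_sq[of x] by (simp add: mult.assoc[symmetric])
    have XY: "?X - ?Y = vscale (sg i * sg j) (intertw N k l (tw T) i j)"
      unfolding intertw_def free_vs.scale_right_diff_distrib free_vs.scale_sum_right
      by (intro arg_cong2[where f="(-)"] sum.cong refl)
        (simp_all add: tw_def sgsg mult.assoc mult.commute mult.left_commute)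
    have "intertw N k l (tw T) i j = vscale (sg i * sg j) (?X - ?Y)"
      unfolding XY by (simp add: sgsg sg_sq ac_simps)
    then have "?X - ?Y \<in> J \<longleftrightarrow> intertw N k l (tw T) i j \<in> J"
      using J_scale XY by metis
    then show ?thesis unfolding 1 2 cl_eq_iff .
  qed
  have "T \<in> Mor tA N ?u k l \<longleftrightarrow> T \<in> T_vec N k l ` K k l" for T
  proof -
    have "T \<in> Mor tA N ?u k l \<longleftrightarrow> T \<in> lin_maps N k l \<and>
        (\<forall>i\<in>multi_indices N l. \<forall>j\<in>multi_indices N k. intertw N k l (tw T) i j \<in> J)"
      unfolding Mor_def using eq by auto
    also have "\<dots> \<longleftrightarrow> tw T \<in> C k l"
    proof
      assume "T \<in> lin_maps N k l \<and>
        (\<forall>i\<in>multi_indices N l. \<forall>j\<in>multi_indices N k. intertw N k l (tw T) i j \<in> J)"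
      then show "tw T \<in> C k l"
        unfolding rel_ideal_eq by (intro intertwiner_in_category) simp_all
    next
      assume T: "tw T \<in> C k l"
      then have "T \<in> lin_maps N k l"
        using C_lin_maps[OF T] by simp
      with T show "T \<in> lin_maps N k l \<and>
        (\<forall>i\<in>multi_indices N l. \<forall>j\<in>multi_indices N k. intertw N k l (tw T) i j \<in> J)"
        unfolding rel_ideal_eq by (simp add: intertw_in_span_ideal)
    qed
    also have "\<dots> \<longleftrightarrow> T \<in> T_vec N k l ` K k l"
    proof -
      have "tw T = tw S \<longleftrightarrow> T = S" for S by (metis tw_tw)
      then show ?thesis by (auto simp: C_def image_iff)
    qed
    finally show ?thesis .
  qed
  then show ?thesis by blast
qed

end

section \<open>The quantum groups $O_N$ and $O_N^*$\<close>

lemma u_gen_word_induct [consumes 1]: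
  assumes "word_of N w"
    and "P 0" "\<And>a b w. a \<in> {1..N} \<Longrightarrow> b \<in> {1..N} \<Longrightarrow> word_of N w \<Longrightarrow> P w \<Longrightarrow> P (Word [(a, b)] + w)"
  shows "P w"
proof -
  have "set ls \<subseteq> {1..N} \<times> {1..N} \<Longrightarrow> P (Word ls)" for ls
  proof (induction ls)
    case Nil
    then show ?case using assms(2) by (simp add: zero_free_mon_def)
  next
    case (Cons p ls)
    then show ?case
      using assms(3)[of "fst p" "snd p" "Word ls"] by (auto simp: plus_free_mon_def word_of_def)
  qed
  then show ?thesis using assms(1) by (cases w) (simp add: word_of_def)
qed

context free_ideal
begin

text \<open>\<open>O_rel\<close> contains the commutators of all elements, while the category
  supplies those of the generators. Commutation modulo an ideal passes to products and linear
  combinations, one argument after the other.\<close>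

lemma commutators_in_J:
  assumes comm: "\<And>a b c d. {a, b, c, d} \<subseteq> {1..N} \<Longrightarrow> u_gen a b * u_gen c d - u_gen c d * u_gen a b \<in> J"
    and f: "f \<in> carrier (free_ring N)" and g: "g \<in> carrier (free_ring N)"
  shows "f * g - g * f \<in> J"
proof -
  have step: "(x * y) * g - g * (x * y) \<in> J"
    if "x * g - g * x \<in> J" "y * g - g * y \<in> J" "x \<in> carrier (free_ring N)" "y \<in> carrier (free_ring N)" for x y g
  proof -
    have "x * (y * g - g * y) + (x * g - g * x) * y \<in> J"
      by (intro J_add J_mult_left J_mult_right that)
    then show ?thesis by (simp add: algebra_simps)
  qed
  have neg: "x * y - y * x \<in> J \<Longrightarrow> y * x - x * y \<in> J" for x y
    using J_uminus[of "x * y - y * x"] by simp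
  have split: "basis_vec (Word [(a, b)] + w) = u_gen a b * (basis_vec w :: free_alg)" for a b w
    by (simp add: u_gen_def mult_single)
  have 1: "basis_vec w * u_gen c d - u_gen c d * basis_vec w \<in> J"
    if "word_of N w" "c \<in> {1..N}" "d \<in> {1..N}" for w c d
    using that(1)
  proof (induction rule: u_gen_word_induct)
    case (2 a b w)
    then show ?case unfolding split
      using comm that by (intro step) (auto intro: u_gen_in_carrier)
  qed simp
  have 2: "basis_vec v * basis_vec w - basis_vec w * (basis_vec v :: free_alg) \<in> J"
    if "word_of N v" "word_of N w" for v w
    using that(1)
  proof (induction rule: u_gen_word_induct)
    case (2 a b v)
    then show ?case unfolding split
      using neg[OF 1[OF that(2)]] by (intro step) (auto intro: u_gen_in_carrier)
  qed simp
  have 3: "basis_vec v * g - g * basis_vec v \<in> J" if "word_of N v" for v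
  proof -
    have "lin_ext (\<lambda>w. basis_vec v * basis_vec w) g - lin_ext (\<lambda>w. basis_vec w * basis_vec v) g \<in> J"
      using g 2 that by (intro J_lin_ext_diff) (simp add: carrier_free_ring)
    then show ?thesis
      by (simp only: lin_ext_mult_left[symmetric] lin_ext_mult_right[symmetric] lin_ext_basis_vec)
  qed
  have "lin_ext (\<lambda>v. basis_vec v * g) f - lin_ext (\<lambda>v. g * basis_vec v) f \<in> J"
    using f 3 by (intro J_lin_ext_diff) (simp add: carrier_free_ring)
  then show ?thesis
    by (simp only: lin_ext_mult_left[symmetric] lin_ext_mult_right[symmetric] lin_ext_basis_vec)
qed

end

lemma free_star_orthogonality: "r \<in> orthogonality N \<Longrightarrow> free_star r \<in> orthogonality N"
proof -
  have rows: "(\<Sum>k=1..N. u_gen i k * u_gen j k) - (if i = j then 1 else 0) \<in> orthogonality N"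
    and cols: "(\<Sum>k=1..N. u_gen k i * u_gen k j) - (if i = j then 1 else 0) \<in> orthogonality N"
    if "i \<in> {1..N}" "j \<in> {1..N}" for i j
    unfolding orthogonality_def using that by blast+
  have star: "free_star ((\<Sum>k=1..N. u_gen (a k) (b k) * u_gen (c k) (d k)) - (if i = j then 1 else 0)) =
      (\<Sum>k=1..N. u_gen (c k) (d k) * u_gen (a k) (b k)) - (if j = i then 1 else 0)"
    for a b c d and i j :: nat
    by (simp add: free_star_diff free_star_sum free_star_mult)
  assume "r \<in> orthogonality N"
  then consider i j where "i \<in> {1..N}" "j \<in> {1..N}"
      "r = (\<Sum>k=1..N. u_gen i k * u_gen j k) - (if i = j then 1 else 0)"
    | i j where "i \<in> {1..N}" "j \<in> {1..N}"
      "r = (\<Sum>k=1..N. u_gen k i * u_gen k j) - (if i = j then 1 else 0)"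
    unfolding orthogonality_def by blast
  then show "free_star r \<in> orthogonality N"
    by cases (simp_all only: star rows cols)
qed

lemma orthogonality_in_carrier: "orthogonality N \<subseteq> carrier (free_ring N)"
  unfolding orthogonality_def
  by (auto intro!: free_vs.subspace_diff[OF subspace_carrier] free_vs.subspace_sum[OF subspace_carrier]
      mult_in_carrier one_in_carrier u_gen_in_carrier free_vs.subspace_0[OF subspace_carrier]
      split: if_splits)

lemma rel_ideal_superset:
  assumes "R \<subseteq> carrier (free_ring N)"
  shows "R \<subseteq> rel_ideal N R"
proof -
  have "R \<union> free_star ` R \<subseteq> carrier (free_ring N)"
    using assms free_star_in_carrier by blast
  from ring.genideal_self[OF ring_free_ring this] show ?thesis
    unfolding rel_ideal_def by simp
qed

text \<open>The elements whose star lies in the ideal form an ideal that contains the generating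
  set, as this set is closed under the star.\<close>

lemma orth_ideal_rel_ideal:
  assumes R: "R \<subseteq> carrier (free_ring N)" "orthogonality N \<subseteq> R"
  shows "orth_ideal N (rel_ideal N R)"
proof -
  interpret F: ring "free_ring N" by (rule ring_free_ring)
  have carr: "R \<union> free_star ` R \<subseteq> carrier (free_ring N)"
    using R(1) free_star_in_carrier by blast
  interpret free_ideal N "rel_ideal N R"
    by (rule free_ideal.intro) (unfold rel_ideal_def, rule F.genideal_ideal[OF carr])
  have sub: "R \<union> free_star ` R \<subseteq> rel_ideal N R"
    unfolding rel_ideal_def by (rule F.genideal_self[OF carr])
  let ?S = "{f \<in> carrier (free_ring N). free_star f \<in> rel_ideal N R}"
  have "ideal ?S (free_ring N)"
  proof (rule ideal_free_ringI)
    show "free_vs.subspace ?S"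
      using subspace_carrier[of N] subspace_J
      by (auto simp: free_vs.subspace_def free_star_add free_star_vscale)
  qed (auto simp: free_star_mult mult_in_carrier free_star_in_carrier J_mult_left J_mult_right)
  moreover have "R \<union> free_star ` R \<subseteq> ?S"
    using carr sub by auto
  ultimately have "rel_ideal N R \<subseteq> ?S"
    unfolding rel_ideal_def by (rule F.genideal_minimal)
  then show ?thesis
    using sub R(2) by unfold_locales auto
qed

lemma intertw_adj_pair:
  assumes "a \<in> {1..N}" "b \<in> {1..N}"
  shows "intertw N 2 0 (mat_adj (pair_mat N)) [] [a, b] =
    (\<Sum>c=1..N. u_gen c a * u_gen c b) - (if a = b then 1 else 0)"
proof -
  have "(\<Sum>m\<in>multi_indices N 2. vscale (mat_adj (pair_mat N) [] m) (wd m [a, b])) =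
      (\<Sum>c=1..N. \<Sum>d=1..N. if d = c then wd [c, d] [a, b] else 0)"
    unfolding sum_multi_indices_2
    by (intro sum.cong refl) (auto simp: pair_mat_def mat_adj_def)
  also have "\<dots> = (\<Sum>c=1..N. u_gen c a * u_gen c b)"
    by (simp add: wd_Cons)
  finally show ?thesis
    using assms by (auto simp: intertw_def pair_mat_def mat_adj_def)
qed

context twisted_category
begin

text \<open>Row orthogonality comes from the pair partition, column orthogonality from its
  adjoint.\<close>

lemma orthogonality_in_span_ideal: "orthogonality N \<subseteq> span_ideal"
proof -
  have rows: "(\<Sum>k=1..N. u_gen i k * u_gen j k) - (if i = j then 1 else 0) \<in> span_ideal"
    if "i \<in> {1..N}" "j \<in> {1..N}" for i j
  proof -
    have "intertw N 0 2 (pair_mat N) [i, j] [] \<in> span_ideal"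
      using that by (intro intertw_in_span_ideal pair_in_C) (auto simp: multi_indices_2)
    from free_vs.subspace_neg[OF subspace_span_ideal this] show ?thesis
      using that by (simp add: intertw_pair)
  qed
  have cols: "(\<Sum>k=1..N. u_gen k i * u_gen k j) - (if i = j then 1 else 0) \<in> span_ideal"
    if "i \<in> {1..N}" "j \<in> {1..N}" for i j
  proof -
    have "intertw N 2 0 (mat_adj (pair_mat N)) [] [i, j] \<in> span_ideal"
      using that by (intro intertw_in_span_ideal C_adj pair_in_C) (auto simp: multi_indices_2)
    then show ?thesis
      using that by (simp add: intertw_adj_pair)
  qed
  show ?thesis
    unfolding orthogonality_def using rows cols by blast
qed

lemma rev_mat_relation:
  assumes "rev_mat N k \<in> C k k" "i \<in> multi_indices N k" "j \<in> multi_indices N k"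
  shows "wd i (rev j) - wd (rev i) j \<in> span_ideal"
  using intertw_in_span_ideal[OF assms] by (simp add: intertw_rev_mat assms)

end

text \<open>Two inclusions of ideals. The premise \<open>K_sub\<close> gives one of them and also
  the degree condition on \<open>K\<close>; hence \<open>twisted_category\<close> is available, and
  \<open>R_span\<close> may assume it when supplying the other.\<close>

lemma twisted_presentationI:
  assumes N: "N \<ge> 1" and R: "R \<subseteq> carrier (free_ring N)" "orthogonality N \<subseteq> R" "free_star ` R \<subseteq> R"
    and K: "linear_category (of_nat N) K"
    and K_sub: "\<And>k l. K k l \<subseteq> orth_ideal.ideal_category N (rel_ideal N R) k l"
    and R_span: "twisted_category N K \<Longrightarrow> R \<subseteq> matrix_category.span_ideal N (twisted_category.C N K)"
    and \<sigma>: "\<And>i j. i \<in> {1..N} \<Longrightarrow> j \<in> {1..N} \<Longrightarrow> \<sigma> i j = (if i < j then -1 else 1)"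
  shows "twisted_presentation N K R \<sigma>"
proof -
  interpret J: orth_ideal N "rel_ideal N R" by (rule orth_ideal_rel_ideal[OF R(1,2)])
  have interm: "T_vec N k l f \<in> J.interm k l" if "f \<in> K k l" for k l f
    using K_sub[of k l] that by (auto simp: J.ideal_category_def)
  interpret K: twisted_category N K
    by unfold_locales (use N K J.intermD(2)[OF interm] in auto)
  interpret F: ring "free_ring N" by (rule ring_free_ring)
  have "rel_ideal N R \<subseteq> K.span_ideal"
    unfolding rel_ideal_def using R(3) R_span[OF K.twisted_category_axioms]
    by (intro F.genideal_minimal K.ideal_span_ideal) auto
  moreover have "K.generators \<subseteq> rel_ideal N R"
    using J.intermD(3)[OF interm] by (auto simp: K.generators_def K.C_def)
  then have "K.span_ideal \<subseteq> rel_ideal N R"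
    unfolding K.span_ideal_def by (rule free_vs.span_minimal) (rule J.subspace_J)
  ultimately show ?thesis
    by unfold_locales (use \<sigma> in auto)
qed

lemma cat_K1_linear_category: "linear_category (of_nat N) (cat_K1 N)"
  unfolding cat_K1_def by (rule linear_category_generated) (use gen1_in_Part in auto)

lemma cat_K2_linear_category: "linear_category (of_nat N) (cat_K2 N)"
  unfolding cat_K2_def by (rule linear_category_generated) (use gen2_in_Part in auto)

lemma gen1_in_cat_K1: "gen1 \<in> cat_K1 N 2 2"
  unfolding cat_K1_def by (rule generator_in_generated) simp

lemma gen2_in_cat_K2: "gen2 \<in> cat_K2 N 3 3"
  unfolding cat_K2_def by (rule generator_in_generated) simp

lemma twisted_presentation_O:
  assumes N: "N \<ge> 1"
    and \<sigma>: "\<And>i j. i \<in> {1..N} \<Longrightarrow> j \<in> {1..N} \<Longrightarrow> \<sigma> i j = (if i < j then -1 else 1)"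
  shows "twisted_presentation N (cat_K1 N) (O_rel N) \<sigma>"
proof (rule twisted_presentationI[OF N _ _ _ cat_K1_linear_category])
  show R: "O_rel N \<subseteq> carrier (free_ring N)"
    using orthogonality_in_carrier
    by (auto simp: O_rel_def intro!: free_vs.subspace_diff[OF subspace_carrier] mult_in_carrier)
  show R': "orthogonality N \<subseteq> O_rel N" by (simp add: O_rel_def)
  show "free_star ` O_rel N \<subseteq> O_rel N"
  proof (rule image_subsetI)
    fix r assume "r \<in> O_rel N"
    then consider "r \<in> orthogonality N"
      | a b where "a \<in> carrier (free_ring N)" "b \<in> carrier (free_ring N)" "r = a * b - b * a"
      unfolding O_rel_def by blast
    then show "free_star r \<in> O_rel N"
    proof cases
      case 1
      then show ?thesis using free_star_orthogonality by (auto simp: O_rel_def)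
    next
      case (2 a b)
      then have "free_star r = free_star b * free_star a - free_star a * free_star b"
        by (simp add: free_star_diff free_star_mult)
      then show ?thesis
        using 2 free_star_in_carrier unfolding O_rel_def by blast
    qed
  qed
  interpret J: orth_ideal N "rel_ideal N (O_rel N)" by (rule orth_ideal_rel_ideal[OF R R'])
  note sub = rel_ideal_superset[OF R]
  have "u_gen a b * u_gen c d - u_gen c d * u_gen a b \<in> O_rel N"
    if "{a, b, c, d} \<subseteq> {1..N}" for a b c d
  proof -
    have "u_gen a b \<in> carrier (free_ring N)" "u_gen c d \<in> carrier (free_ring N)"
      using that by (simp_all add: u_gen_in_carrier)
    then show ?thesis unfolding O_rel_def by blast
  qed
  then have g: "gen1 \<in> J.ideal_category 2 2"
    by (intro J.gen1_in_ideal_category subsetD[OF sub])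
  show "cat_K1 N k l \<subseteq> J.ideal_category k l" for k l
    unfolding cat_K1_def
    by (rule generated_category_least[OF J.linear_category_ideal_category]) (use g in auto)
  assume "twisted_category N (cat_K1 N)"
  then interpret K: twisted_category N "cat_K1 N" .
  interpret I: free_ideal N K.span_ideal by (rule free_ideal.intro[OF K.ideal_span_ideal])
  have rev: "rev_mat N 2 \<in> K.C 2 2"
    using K.C_I[OF gen1_in_cat_K1] by (simp add: tw_gen1)
  \<comment> \<open>The column word is listed backwards, so that \<open>rev [d, b]\<close> matches
    \<open>[a, c]\<close> letter by letter.\<close>
  have "u_gen a b * u_gen c d - u_gen c d * u_gen a b \<in> K.span_ideal"
    if "{a, b, c, d} \<subseteq> {1..N}" for a b c d
    using K.rev_mat_relation[OF rev, of "[a, c]" "[d, b]"] that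
    by (simp add: multi_indices_2 wd_Cons)
  then show "O_rel N \<subseteq> K.span_ideal"
    using K.orthogonality_in_span_ideal I.commutators_in_J unfolding O_rel_def by blast
qed (rule \<sigma>)

lemma twisted_presentation_O_star:
  assumes N: "N \<ge> 1"
    and \<sigma>: "\<And>i j. i \<in> {1..N} \<Longrightarrow> j \<in> {1..N} \<Longrightarrow> \<sigma> i j = (if i < j then -1 else 1)"
  shows "twisted_presentation N (cat_K2 N) (O_star_rel N) \<sigma>"
proof (rule twisted_presentationI[OF N _ _ _ cat_K2_linear_category])
  \<comment> \<open>The relations are defined through sets of algebra elements, but the comparison
    with words requires the six indices explicitly.\<close>
  have triples: "O_star_rel N = orthogonality N \<union>
    {u_gen a b * u_gen c d * u_gen e f - u_gen e f * u_gen c d * u_gen a b |a b c d e f. {a, b, c, d, e, f} \<subseteq> {1..N}}"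
    (is "_ = _ \<union> ?T")
  proof -
    let ?U = "{u_gen i j |i j. i \<in> {1..N} \<and> j \<in> {1..N}}"
    have "r \<in> ?T" if "\<exists>a b c. r = a * b * c - c * b * a \<and> {a, b, c} \<subseteq> ?U" for r
    proof -
      from that obtain a b c where r: "r = a * b * c - c * b * a" and "{a, b, c} \<subseteq> ?U"
        by (elim exE conjE)
      then have U: "a \<in> ?U" "b \<in> ?U" "c \<in> ?U" by (simp_all only: insert_subset)
      from U(1) obtain i1 j1 where 1: "a = u_gen i1 j1" "i1 \<in> {1..N}" "j1 \<in> {1..N}" by blast
      from U(2) obtain i2 j2 where 2: "b = u_gen i2 j2" "i2 \<in> {1..N}" "j2 \<in> {1..N}" by blast
      from U(3) obtain i3 j3 where 3: "c = u_gen i3 j3" "i3 \<in> {1..N}" "j3 \<in> {1..N}" by blast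
      have "{i1, j1, i2, j2, i3, j3} \<subseteq> {1..N}" using 1 2 3 by simp
      then show ?thesis unfolding r 1(1) 2(1) 3(1) by blast
    qed
    moreover have "\<exists>a b c. r = a * b * c - c * b * a \<and> {a, b, c} \<subseteq> ?U" if r: "r \<in> ?T" for r
    proof -
      from r obtain a b c d e f where "r = u_gen a b * u_gen c d * u_gen e f - u_gen e f * u_gen c d * u_gen a b"
        and "{a, b, c, d, e, f} \<subseteq> {1..N}" by blast
      moreover from this(2) have "u_gen a b \<in> ?U" "u_gen c d \<in> ?U" "u_gen e f \<in> ?U" by blast+
      ultimately show ?thesis by (intro exI[of _ "u_gen a b"] exI[of _ "u_gen c d"] exI[of _ "u_gen e f"]) simp
    qed
    ultimately have "{a * b * c - c * b * a |a b c. {a, b, c} \<subseteq> ?U} = ?T"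
      by (intro equalityI subsetI) (simp_all only: mem_Collect_eq)
    then show ?thesis unfolding O_star_rel_def by (rule arg_cong)
  qed
  show R: "O_star_rel N \<subseteq> carrier (free_ring N)"
    using orthogonality_in_carrier unfolding triples
    by (auto intro!: free_vs.subspace_diff[OF subspace_carrier] mult_in_carrier u_gen_in_carrier)
  show R': "orthogonality N \<subseteq> O_star_rel N" by (simp add: O_star_rel_def)
  have triple: "u_gen a b * u_gen c d * u_gen e f - u_gen e f * u_gen c d * u_gen a b \<in> O_star_rel N"
    if "{a, b, c, d, e, f} \<subseteq> {1..N}" for a b c d e f
    unfolding triples by (rule UnI2) (use that in blast)
  show "free_star ` O_star_rel N \<subseteq> O_star_rel N"
  proof (rule image_subsetI)
    fix r assume "r \<in> O_star_rel N"
    then consider "r \<in> orthogonality N"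
      | a b c d e f where "{a, b, c, d, e, f} \<subseteq> {1..N}"
        "r = u_gen a b * u_gen c d * u_gen e f - u_gen e f * u_gen c d * u_gen a b"
      unfolding triples by blast
    then show "free_star r \<in> O_star_rel N"
    proof cases
      case 1
      then show ?thesis using free_star_orthogonality by (auto simp: O_star_rel_def)
    next
      case (2 a b c d e f)
      then have "free_star r = u_gen e f * u_gen c d * u_gen a b - u_gen a b * u_gen c d * u_gen e f"
        by (simp add: free_star_diff free_star_mult mult.assoc)
      then show ?thesis using triple[of e f c d a b] 2 by auto
    qed
  qed
  interpret J: orth_ideal N "rel_ideal N (O_star_rel N)" by (rule orth_ideal_rel_ideal[OF R R'])
  note sub = rel_ideal_superset[OF R]
  have g: "gen2 \<in> J.ideal_category 3 3"
    by (intro J.gen2_in_ideal_category subsetD[OF sub] triple)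
  show "cat_K2 N k l \<subseteq> J.ideal_category k l" for k l
    unfolding cat_K2_def
    by (rule generated_category_least[OF J.linear_category_ideal_category]) (use g in auto)
  assume "twisted_category N (cat_K2 N)"
  then interpret K: twisted_category N "cat_K2 N" .
  have rev: "rev_mat N 3 \<in> K.C 3 3"
    using K.C_I[OF gen2_in_cat_K2] by (simp add: tw_gen2)
  have "u_gen a b * u_gen c d * u_gen e f - u_gen e f * u_gen c d * u_gen a b \<in> K.span_ideal"
    if "{a, b, c, d, e, f} \<subseteq> {1..N}" for a b c d e f
    using K.rev_mat_relation[OF rev, of "[a, c, e]" "[f, d, b]"] that
    by (simp add: multi_indices_3 wd_Cons mult.assoc)
  then show "O_star_rel N \<subseteq> K.span_ideal"
    using K.orthogonality_in_span_ideal unfolding triples by blast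
qed (rule \<sigma>)

section \<open>Non-easiness\<close>

definition polyfun :: "(nat \<Rightarrow> complex) \<Rightarrow> bool"
  where "polyfun g \<longleftrightarrow> (\<exists>P. \<forall>n. g n = poly P (of_nat n))"

lemma polyfun_const: "polyfun (\<lambda>n. c)"
  unfolding polyfun_def by (rule exI[of _ "[:c:]"]) simp

lemma polyfun_of_nat: "polyfun of_nat"
  unfolding polyfun_def by (rule exI[of _ "[:0, 1:]"]) simp

lemma polyfun_add: "polyfun g \<Longrightarrow> polyfun h \<Longrightarrow> polyfun (\<lambda>n. g n + h n)"
  unfolding polyfun_def by (metis poly_add)

lemma polyfun_mult: "polyfun g \<Longrightarrow> polyfun h \<Longrightarrow> polyfun (\<lambda>n. g n * h n)"
  unfolding polyfun_def by (metis poly_mult)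

lemma polyfun_diff: "polyfun g \<Longrightarrow> polyfun h \<Longrightarrow> polyfun (\<lambda>n. g n - h n)"
  unfolding polyfun_def by (metis poly_diff)

lemma polyfun_power: "polyfun g \<Longrightarrow> polyfun (\<lambda>n. g n ^ m)"
  by (induction m) (simp_all add: polyfun_const polyfun_mult)

lemma polyfun_sum: "(\<And>x. x \<in> X \<Longrightarrow> polyfun (\<lambda>n. g x n)) \<Longrightarrow> polyfun (\<lambda>n. \<Sum>x\<in>X. g x n)"
  by (induction X rule: infinite_finite_induct) (simp_all add: polyfun_const polyfun_add)

text \<open>At real arguments, conjugating the value amounts to conjugating the coefficients. This
  serves the antilinear involution.\<close>

lemma polyfun_cnj: "polyfun g \<Longrightarrow> polyfun (\<lambda>n. cnj (g n))"
proof -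
  assume "polyfun g"
  then obtain P where P: "\<And>n. g n = poly P (of_nat n)" unfolding polyfun_def by blast
  have "cnj (poly P (of_nat n)) = poly (map_poly cnj P) (of_nat n)" for n
    by (induction P) (simp_all add: map_poly_pCons)
  with P show ?thesis unfolding polyfun_def by metis
qed

text \<open>A polynomial with infinitely many zeros vanishes. This carries identities that hold for
  \<open>n \<ge> 2\<close> over to the given parameter, however small.\<close>

lemma polyfun_eventually_zero:
  assumes "polyfun g" "\<And>n. n \<ge> 2 \<Longrightarrow> g n = 0"
  shows "g n = 0"
proof -
  obtain P where P: "\<And>n. g n = poly P (of_nat n)" using assms(1) unfolding polyfun_def by blast
  have "of_nat ` {2..} \<subseteq> {x. poly P x = 0}"
    using assms(2) P by auto
  moreover have "infinite ((of_nat :: nat \<Rightarrow> complex) ` {2..})"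
    by (subst finite_image_iff) (auto simp: inj_on_def infinite_Ici)
  ultimately have "infinite {x. poly P x = 0}" using finite_subset by blast
  then have "P = 0" using poly_roots_finite by blast
  then show ?thesis by (simp add: P)
qed

lemma polyfun_lin_form:
  assumes "\<And>n. G n \<in> Part k l" "\<And>p. polyfun (\<lambda>n. Poly_Mapping.lookup (G n) p)"
    "\<And>p. polyfun (\<lambda>n. h n p)"
  shows "polyfun (\<lambda>n. lin_form (h n) (G n))"
proof -
  have "lin_form (h n) (G n) = (\<Sum>p\<in>partitions k l. Poly_Mapping.lookup (G n) p * h n p)" for n
    using assms(1)[of n] by (intro lin_form_superset) (auto simp: Part_def)
  then show ?thesis
    using assms(2,3) by (simp add: polyfun_sum polyfun_mult)
qed

lemma lookup_lin_ext_form: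
  "Poly_Mapping.lookup (lin_ext \<phi> f) y = lin_form (\<lambda>x. Poly_Mapping.lookup (\<phi> x) y) f"
  by (simp add: lookup_lin_ext lin_form_def)

text \<open>A rotation of the first two coordinates.  It is not a signed permutation matrix, so the
  matrices of the one-block partitions do not commute with its tensor powers.\<close>

definition rot :: "nat \<Rightarrow> nat \<Rightarrow> complex"
  where "rot a b = (if a = 1 \<and> b = 1 \<or> a = 2 \<and> b = 2 then 3/5 else if a = 1 \<and> b = 2 then 4/5
    else if a = 2 \<and> b = 1 then -4/5 else if a = b then 1 else 0)"

definition rots :: "nat list \<Rightarrow> nat list \<Rightarrow> complex"
  where "rots i j = (\<Prod>(a, b)\<leftarrow>zip i j. rot a b)"

text \<open>Evaluation at the matrix \<open>rot\<close>, a point of the classical orthogonal group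
  and so a character of the free algebra.\<close>

definition ev :: "free_alg \<Rightarrow> complex"
  where "ev = lin_form (\<lambda>w. \<Prod>(a, b)\<leftarrow>letters w. rot a b)"

lemma ev_linear: "ev (f + g) = ev f + ev g" "ev (f - g) = ev f - ev g" "ev (vscale c f) = c * ev f"
  "ev (\<Sum>x\<in>X. h x) = (\<Sum>x\<in>X. ev (h x))" "ev 0 = 0"
  by (simp_all add: ev_def lin_form_add lin_form_diff lin_form_vscale lin_form_sum)

lemma ev_mult: "ev (f * g) = ev f * ev g"
  by (simp add: ev_def mult_eq_lin_ext lin_form_lin_ext plus_free_mon_def lin_form_fun_mult
      lin_form_fun_mult_right)

lemma ev_one: "ev 1 = 1"
proof -
  have "ev (basis_vec 0) = 1"
    by (simp only: ev_def lin_form_basis) (simp add: zero_free_mon_def)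
  then show ?thesis by simp
qed

lemma ev_wd: "ev (wd i j) = rots i j"
  by (simp add: ev_def wd_def rots_def)

lemma ev_u_gen: "ev (u_gen a b) = rot a b"
  by (simp add: ev_def u_gen_def)

lemma cnj_rot: "cnj (rot a b) = rot a b"
  by (simp add: rot_def)

lemma ev_free_star: "ev (free_star f) = cnj (ev f)"
proof -
  have cnj_prod: "cnj (\<Prod>(a, b)\<leftarrow>ls. rot a b) = (\<Prod>(a, b)\<leftarrow>ls. rot a b)" for ls
    by (induction ls) (auto simp: cnj_rot)
  have "prod_list (rev xs) = prod_list xs" for xs :: "complex list"
    by (induction xs) (simp_all add: mult.commute)
  then show ?thesis
    by (simp add: ev_def free_star_eq lin_form_lin_ext lin_form_conj_coeffs cnj_prod rev_map[symmetric])
qed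

lemma rot_ge_3: "k \<ge> 3 \<Longrightarrow> rot i k = (if i = k then 1 else 0)" "k \<ge> 3 \<Longrightarrow> rot k i = (if i = k then 1 else 0)"
  by (auto simp: rot_def)

lemma sum_split_2:
  fixes g :: "nat \<Rightarrow> complex"
  assumes "n \<ge> 2"
  shows "(\<Sum>k=1..n. g k) = g 1 + g 2 + (\<Sum>k=3..n. g k)"
proof -
  have "{1..n} = insert 1 (insert 2 {3..n})" using assms by auto
  then show ?thesis by simp
qed

text \<open>The entries 3/5 and 4/5 come from \<open>9 + 16 = 25\<close>, which keeps the arithmetic
  rational; the coordinates from 3 on are fixed.\<close>

lemma rot_orthogonal:
  assumes "n \<ge> 2" "i \<in> {1..n}" "j \<in> {1..n}"
  shows "(\<Sum>k=1..n. rot i k * rot j k) = (if i = j then 1 else 0)"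
    "(\<Sum>k=1..n. rot k i * rot k j) = (if i = j then 1 else 0)"
proof -
  have "(\<Sum>k=3..n. rot i k * rot j k) = (\<Sum>k=3..n. if k = i then (if i = j then 1 else 0) else 0)"
    "(\<Sum>k=3..n. rot k i * rot k j) = (\<Sum>k=3..n. if k = i then (if i = j then 1 else 0) else 0)"
    by (intro sum.cong refl; auto simp: rot_ge_3)+
  then have *: "(\<Sum>k=3..n. rot i k * rot j k) = (if i \<ge> 3 \<and> i = j then 1 else 0)"
    "(\<Sum>k=3..n. rot k i * rot k j) = (if i \<ge> 3 \<and> i = j then 1 else 0)"
    using assms by auto
  have "i = 1 \<or> i = 2 \<or> i \<ge> 3" "j = 1 \<or> j = 2 \<or> j \<ge> 3" using assms by auto
  then show "(\<Sum>k=1..n. rot i k * rot j k) = (if i = j then 1 else 0)"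
    "(\<Sum>k=1..n. rot k i * rot k j) = (if i = j then 1 else 0)"
    unfolding sum_split_2[OF assms(1)] * by (auto simp: rot_def)
qed

definition rot_ideal :: "nat \<Rightarrow> free_alg set"
  where "rot_ideal n = {f \<in> carrier (free_ring n). ev f = 0}"

lemma orth_ideal_rot_ideal:
  assumes n: "n \<ge> 2"
  shows "orth_ideal n (rot_ideal n)"
proof (intro orth_ideal.intro free_ideal.intro orth_ideal_axioms.intro)
  show "ideal (rot_ideal n) (free_ring n)"
  proof (rule ideal_free_ringI)
    show "free_vs.subspace (rot_ideal n)"
      using subspace_carrier[of n] by (auto simp: free_vs.subspace_def rot_ideal_def ev_linear)
  qed (auto simp: rot_ideal_def mult_in_carrier ev_mult)
  show "free_star f \<in> rot_ideal n" if "f \<in> rot_ideal n" for f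
    using that by (simp add: rot_ideal_def free_star_in_carrier ev_free_star)
  have ev_if: "ev (if b then 1 else 0) = (if b then 1 else 0)" for b
    by (simp add: ev_one ev_linear)
  have "ev r = 0" if "r \<in> orthogonality n" for r
    using that rot_orthogonal[OF n] unfolding orthogonality_def
    by (auto simp only: ev_linear ev_mult ev_u_gen ev_if mem_Collect_eq Un_iff diff_self)
  then show "orthogonality n \<subseteq> rot_ideal n"
    using orthogonality_in_carrier by (auto simp: rot_ideal_def)
qed

abbreviation rot_category :: "nat \<Rightarrow> nat \<Rightarrow> nat \<Rightarrow> (part \<Rightarrow>\<^sub>0 complex) set"
  where "rot_category n \<equiv> orth_ideal.ideal_category n (rot_ideal n)"

text \<open>Under the evaluation the generators become commuting scalars, so the relations behind
  both generators hold and one test category serves \<open>cat_K1\<close> and \<open>cat_K2\<close>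
  alike.\<close>

lemma rot_category_generators:
  assumes "n \<ge> 2"
  shows "gen1 \<in> rot_category n 2 2" "gen2 \<in> rot_category n 3 3"
proof -
  interpret orth_ideal n "rot_ideal n" by (rule orth_ideal_rot_ideal[OF assms])
  show "gen1 \<in> rot_category n 2 2"
    by (rule gen1_in_ideal_category)
      (auto simp: rot_ideal_def ev_linear ev_mult
        intro!: free_vs.subspace_diff[OF subspace_carrier] mult_in_carrier u_gen_in_carrier)
  show "gen2 \<in> rot_category n 3 3"
    by (rule gen2_in_ideal_category)
      (auto simp: rot_ideal_def ev_linear ev_mult
        intro!: free_vs.subspace_diff[OF subspace_carrier] mult_in_carrier u_gen_in_carrier)
qed

text \<open>For small \<open>N\<close> the maps \<open>T_p\<close> are linearly dependent, so an element is not determined by its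
  image.  We therefore deform it polynomially in the loop parameter \<open>n\<close> and test it for all
  \<open>n \<ge> 2\<close>.\<close>

definition family_category :: "nat \<Rightarrow> nat \<Rightarrow> nat \<Rightarrow> (part \<Rightarrow>\<^sub>0 complex) set"
  where "family_category N k l = {G N |G. (\<forall>n. G n \<in> Part k l) \<and>
    (\<forall>p. polyfun (\<lambda>n. Poly_Mapping.lookup (G n) p)) \<and> (\<forall>n\<ge>2. G n \<in> rot_category n k l)}"

lemma family_categoryI:
  "(\<And>n. G n \<in> Part k l) \<Longrightarrow> (\<And>p. polyfun (\<lambda>n. Poly_Mapping.lookup (G n) p)) \<Longrightarrow>
    (\<And>n. n \<ge> 2 \<Longrightarrow> G n \<in> rot_category n k l) \<Longrightarrow> G N \<in> family_category N k l"
  unfolding family_category_def by blast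

lemma family_categoryE:
  assumes "f \<in> family_category N k l"
  obtains G where "f = G N" "\<And>n. G n \<in> Part k l" "\<And>p. polyfun (\<lambda>n. Poly_Mapping.lookup (G n) p)"
    "\<And>n. n \<ge> 2 \<Longrightarrow> G n \<in> rot_category n k l"
  using assms unfolding family_category_def by blast

text \<open>Each operation is applied member by member to the deformations, so it remains to see
  that coefficients stay polynomial in \<open>n\<close>.\<close>

lemma linear_category_family_category: "linear_category (of_nat N) (family_category N)"
proof -
  note cat = linear_categoryD[OF orth_ideal.linear_category_ideal_category[OF orth_ideal_rot_ideal]]
  show ?thesis
  proof (rule linear_categoryI)
    fix k l
    show "family_category N k l \<subseteq> Part k l"
      by (auto elim: family_categoryE)
    show "free_vs.subspace (family_category N k l)"
    proof (rule free_vs.subspaceI)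
      show "0 \<in> family_category N k l"
        by (rule family_categoryI[of "\<lambda>n. 0"])
          (auto simp: polyfun_const free_vs.subspace_0[OF subspace_Part] free_vs.subspace_0[OF cat(2)])
    next
      fix f g assume "f \<in> family_category N k l" "g \<in> family_category N k l"
      then show "f + g \<in> family_category N k l"
      proof (elim family_categoryE)
        fix G H assume "f = G N" "g = H N" and GH: "\<And>n. G n \<in> Part k l" "\<And>n. H n \<in> Part k l"
          "\<And>p. polyfun (\<lambda>n. Poly_Mapping.lookup (G n) p)" "\<And>p. polyfun (\<lambda>n. Poly_Mapping.lookup (H n) p)"
          "\<And>n. n \<ge> 2 \<Longrightarrow> G n \<in> rot_category n k l" "\<And>n. n \<ge> 2 \<Longrightarrow> H n \<in> rot_category n k l"
        have "(\<lambda>n. G n + H n) N \<in> family_category N k l"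
          by (rule family_categoryI)
            (auto simp: lookup_add GH intro!: polyfun_add free_vs.subspace_add[OF subspace_Part]
              free_vs.subspace_add[OF cat(2)])
        then show ?thesis by (simp add: \<open>f = G N\<close> \<open>g = H N\<close>)
      qed
    next
      fix c f assume "f \<in> family_category N k l"
      then show "vscale c f \<in> family_category N k l"
      proof (elim family_categoryE)
        fix G assume "f = G N" and G: "\<And>n. G n \<in> Part k l"
          "\<And>p. polyfun (\<lambda>n. Poly_Mapping.lookup (G n) p)" "\<And>n. n \<ge> 2 \<Longrightarrow> G n \<in> rot_category n k l"
        have "(\<lambda>n. vscale c (G n)) N \<in> family_category N k l"
          by (rule family_categoryI)
            (auto simp: G intro!: polyfun_mult polyfun_const free_vs.subspace_scale[OF subspace_Part]
              free_vs.subspace_scale[OF cat(2)])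
        then show ?thesis by (simp add: \<open>f = G N\<close>)
      qed
    qed
  next
    fix k l k' l' f g assume "f \<in> family_category N k l" "g \<in> family_category N k' l'"
    then show "vec_tensor k l f g \<in> family_category N (k + k') (l + l')"
    proof (elim family_categoryE)
      fix G H assume "f = G N" "g = H N" and GH: "\<And>n. G n \<in> Part k l" "\<And>n. H n \<in> Part k' l'"
        "\<And>p. polyfun (\<lambda>n. Poly_Mapping.lookup (G n) p)" "\<And>p. polyfun (\<lambda>n. Poly_Mapping.lookup (H n) p)"
        "\<And>n. n \<ge> 2 \<Longrightarrow> G n \<in> rot_category n k l" "\<And>n. n \<ge> 2 \<Longrightarrow> H n \<in> rot_category n k' l'"
      have "(\<lambda>n. vec_tensor k l (G n) (H n)) N \<in> family_category N (k + k') (l + l')"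
      proof (rule family_categoryI)
        show "polyfun (\<lambda>n. Poly_Mapping.lookup (vec_tensor k l (G n) (H n)) p)" for p
          unfolding vec_tensor_def lookup_lin_ext_form
          by (rule polyfun_lin_form[OF GH(1,3)], rule polyfun_lin_form[OF GH(2,4)], rule polyfun_const)
      qed (auto intro: vec_tensor_in_Part GH cat(3))
      then show ?thesis by (simp add: \<open>f = G N\<close> \<open>g = H N\<close>)
    qed
  next
    fix k l m f g assume "f \<in> family_category N k l" "g \<in> family_category N l m"
    then show "vec_comp (of_nat N) g f \<in> family_category N k m"
    proof (elim family_categoryE)
      fix G H assume "f = G N" "g = H N" and GH: "\<And>n. G n \<in> Part k l" "\<And>n. H n \<in> Part l m"
        "\<And>p. polyfun (\<lambda>n. Poly_Mapping.lookup (G n) p)" "\<And>p. polyfun (\<lambda>n. Poly_Mapping.lookup (H n) p)"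
        "\<And>n. n \<ge> 2 \<Longrightarrow> G n \<in> rot_category n k l" "\<And>n. n \<ge> 2 \<Longrightarrow> H n \<in> rot_category n l m"
      \<comment> \<open>The composition parameter moves along with \<open>n\<close>, so that each
        member is composed in its own category; the factors \<open>n ^ loops\<close> are polynomial
        in \<open>n\<close>.\<close>
      have "(\<lambda>n. vec_comp (of_nat n) (H n) (G n)) N \<in> family_category N k m"
      proof (rule family_categoryI)
        show "polyfun (\<lambda>n. Poly_Mapping.lookup (vec_comp (of_nat n) (H n) (G n)) p)" for p
          unfolding vec_comp_def lookup_lin_ext_form lookup_vscale
          by (rule polyfun_lin_form[OF GH(2,4)], rule polyfun_lin_form[OF GH(1,3)])
            (intro polyfun_mult polyfun_power polyfun_of_nat polyfun_const)
      qed (auto intro: vec_comp_in_Part GH cat(4))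
      then show ?thesis by (simp add: \<open>f = G N\<close> \<open>g = H N\<close>)
    qed
  next
    fix k l f assume "f \<in> family_category N k l"
    then show "vec_inv f \<in> family_category N l k"
    proof (elim family_categoryE)
      fix G assume "f = G N" and G: "\<And>n. G n \<in> Part k l"
        "\<And>p. polyfun (\<lambda>n. Poly_Mapping.lookup (G n) p)" "\<And>n. n \<ge> 2 \<Longrightarrow> G n \<in> rot_category n k l"
      have "(\<lambda>n. vec_inv (G n)) N \<in> family_category N l k"
      proof (rule family_categoryI)
        show "polyfun (\<lambda>n. Poly_Mapping.lookup (vec_inv (G n)) p)" for p
          unfolding vec_inv_def antilin_ext_eq lookup_lin_ext_form lin_form_conj_coeffs
          by (intro polyfun_cnj polyfun_lin_form[OF G(1,2)] polyfun_const)
      qed (auto intro: vec_inv_in_Part G cat(5))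
      then show ?thesis by (simp add: \<open>f = G N\<close>)
    qed
  next
    show "basis_vec {{Inl 1, Inr 1}} \<in> family_category N 1 1"
      by (rule family_categoryI[of "\<lambda>n. basis_vec {{Inl 1, Inr 1}}"])
        (simp_all only: basis_vec_in_Part id_in_partitions polyfun_const cat(6))
    show "basis_vec {{Inr 1, Inr 2}} \<in> family_category N 0 2"
      by (rule family_categoryI[of "\<lambda>n. basis_vec {{Inr 1, Inr 2}}"])
        (simp_all only: basis_vec_in_Part pair_in_partitions polyfun_const cat(7))
  qed
qed

lemma cat_K_in_family_category:
  "cat_K1 N k l \<subseteq> family_category N k l" "cat_K2 N k l \<subseteq> family_category N k l"
proof -
  have "gen1 \<in> family_category N 2 2"
    by (rule family_categoryI[of "\<lambda>n. gen1"]) (simp_all add: gen1_in_Part polyfun_const rot_category_generators)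
  then show "cat_K1 N k l \<subseteq> family_category N k l"
    unfolding cat_K1_def
    by (intro generated_category_least linear_category_family_category) auto
  have "gen2 \<in> family_category N 3 3"
    by (rule family_categoryI[of "\<lambda>n. gen2"]) (simp_all add: gen2_in_Part polyfun_const rot_category_generators)
  then show "cat_K2 N k l \<subseteq> family_category N k l"
    unfolding cat_K2_def
    by (intro generated_category_least linear_category_family_category) auto
qed

section \<open>Testing the one-block partitions against the rotation\<close>

lemma multi_indices_mono: "n \<ge> 2 \<Longrightarrow> multi_indices 2 k \<subseteq> multi_indices n k"
  by (auto simp: multi_indices_def)

text \<open>On the letters 1 and 2 the entries do not depend on the dimension, so a single test in
  these coordinates works for all \<open>n \<ge> 2\<close> at once.\<close>

lemma T_vec_mono:
  assumes "n \<ge> 2" "i \<in> multi_indices 2 l" "j \<in> multi_indices 2 k"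
  shows "T_vec n k l f i j = T_vec 2 k l f i j"
  using assms multi_indices_mono[OF assms(1)]
  by (simp add: T_vec_def T_part_def subset_iff)

text \<open>The rotation is block diagonal and does not mix the letters 1 and 2 with larger
  ones.\<close>

lemma rots_eq_0:
  assumes "m \<in> multi_indices n k" "m \<notin> multi_indices 2 k" "j \<in> multi_indices 2 k"
  shows "rots m j = 0" "rots j m = 0"
proof -
  have len: "length m = k" "length j = k" using assms by (auto simp: multi_indices_def)
  from assms(1,2) obtain x where "x \<in> set m" "x \<notin> {1..2}" "x \<ge> 1"
    by (force simp: multi_indices_def)
  then obtain t where t: "t < k" "m ! t \<ge> 3"
    using len by (metis One_nat_def Suc_1 Suc_leI atLeastAtMost_iff in_set_conv_nth not_less numeral_3_eq_3)
  have "j ! t \<in> {1..2}" using nth_multi_indices[OF assms(3), of "Suc t"] t(1) by simp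
  then have "rot (m ! t) (j ! t) = 0" "rot (j ! t) (m ! t) = 0"
    using t by (auto simp: rot_ge_3)
  moreover have "(m ! t, j ! t) \<in> set (zip m j)" "(j ! t, m ! t) \<in> set (zip j m)"
    using t len by (auto simp: in_set_zip)
  ultimately show "rots m j = 0" "rots j m = 0"
    unfolding rots_def by (force simp: prod_list_zero_iff)+
qed

text \<open>The evaluated intertwining relation at \<open>(i, j)\<close>, cut down to the letters 1
  and 2. As a linear form it no longer involves \<open>n\<close>, so it is polynomial along a
  family.\<close>

definition test_form :: "nat \<Rightarrow> nat list \<Rightarrow> nat list \<Rightarrow> (part \<Rightarrow>\<^sub>0 complex) \<Rightarrow> complex"
  where "test_form k i j f =
    (\<Sum>m\<in>multi_indices 2 k. tw (T_vec 2 k k f) i m * rots m j) -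
    (\<Sum>m\<in>multi_indices 2 k. tw (T_vec 2 k k f) m j * rots i m)"

lemma test_form_rot_category:
  assumes n: "n \<ge> 2" and f: "f \<in> rot_category n k k"
    and ij: "i \<in> multi_indices 2 k" "j \<in> multi_indices 2 k"
  shows "test_form k i j f = 0"
proof -
  interpret orth_ideal n "rot_ideal n" by (rule orth_ideal_rot_ideal[OF n])
  note sub = multi_indices_mono[OF n, of k]
  have 1: "(\<Sum>m\<in>multi_indices n k. tw (T_vec n k k f) i m * rots m j) =
      (\<Sum>m\<in>multi_indices 2 k. tw (T_vec 2 k k f) i m * rots m j)"
    by (rule sum.mono_neutral_cong_right) (use sub ij rots_eq_0 T_vec_mono[OF n] in \<open>auto simp: tw_def\<close>)
  have 2: "(\<Sum>m\<in>multi_indices n k. tw (T_vec n k k f) m j * rots i m) =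
      (\<Sum>m\<in>multi_indices 2 k. tw (T_vec 2 k k f) m j * rots i m)"
    by (rule sum.mono_neutral_cong_right) (use sub ij rots_eq_0 T_vec_mono[OF n] in \<open>auto simp: tw_def\<close>)
  have "T_vec n k k f \<in> interm k k" using f by (simp add: ideal_category_def)
  from intermD(3)[OF this] ij sub have "ev (intertw n k k (tw (T_vec n k k f)) i j) = 0"
    by (auto simp: rot_ideal_def)
  then show ?thesis
    by (simp add: intertw_def ev_linear ev_wd 1 2 test_form_def)
qed

text \<open>For \<open>i = 1...12\<close> and \<open>j = 1...1\<close>, the row of the one-block
  matrix at \<open>i\<close> vanishes because \<open>i\<close> is not constant, and its column at
  \<open>j\<close> has a single entry 1. The test form is therefore \<open>- rots i j\<close>, a
  product of nonzero entries of the rotation up to sign.\<close>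

lemma full_block_not_in_family_category:
  assumes k: "k \<ge> 2"
  shows "basis_vec {{1..k} <+> {1..k}} \<notin> family_category N k k"
proof
  let ?B = "{1..k} <+> {1..k} :: (nat + nat) set"
  define i :: "nat list" where "i = replicate (k - 1) 1 @ [2]"
  define j :: "nat list" where "j = replicate k 1"
  have ij: "i \<in> multi_indices 2 k" "j \<in> multi_indices 2 k"
    using k by (auto simp: i_def j_def multi_indices_def)
  have "T_part 2 k k {?B} i m = 0" for m
  proof -
    have "point_label i m (Inr 1) \<noteq> point_label i m (Inr k)"
      using k by (auto simp: point_label_def i_def nth_append)
    moreover have "Inr 1 \<in> ?B" "Inr k \<in> ?B" using k by auto
    ultimately have "\<not> const_on_blocks {?B} (point_label i m)"
      by (meson const_on_blocksD insertI1)
    then show ?thesis by (simp add: T_part_eq)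
  qed
  then have 1: "tw (T_vec 2 k k (basis_vec {?B})) i m = 0" for m
    by (simp add: tw_def T_vec_basis)
  have 2: "tw (T_vec 2 k k (basis_vec {?B})) m j = (if m = j then 1 else 0)"
    if m: "m \<in> multi_indices 2 k" for m
  proof (cases "const_on_blocks {?B} (point_label m j)")
    case True
    have "m ! t = 1" if t: "t < k" for t
    proof -
      have "Inl 1 \<in> ?B" "Inr (Suc t) \<in> ?B" using k t by auto
      then have "point_label m j (Inr (Suc t)) = point_label m j (Inl 1)"
        using const_on_blocksD[OF True] by blast
      then show ?thesis using k by (simp add: point_label_def j_def)
    qed
    then have "m = j"
      using length_multi_index[OF m] by (auto simp: j_def list_eq_iff_nth_eq)
    with True ij show ?thesis by (simp add: tw_def T_vec_basis T_part_eq sg_sq)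
  next
    case False
    have "m \<noteq> j"
    proof
      assume "m = j"
      have "point_label m j x = 1" if "x \<in> ?B" for x
        using that by (auto simp: \<open>m = j\<close> j_def point_label_def)
      then have "const_on_blocks {?B} (point_label m j)"
        unfolding const_on_blocks_def by (metis singletonD)
      with False show False ..
    qed
    with False show ?thesis by (simp add: tw_def T_vec_basis T_part_eq)
  qed
  have rots_ij: "rots i j \<noteq> 0"
  proof -
    have "j = replicate (k - 1) 1 @ [1]"
      using k by (simp add: j_def replicate_append_same flip: replicate_Suc)
    then have "rots i j = rot 1 1 ^ (k - 1) * rot 2 1"
      by (simp add: rots_def i_def zip_replicate)
    then show ?thesis by (simp add: rot_def)
  qed
  assume "basis_vec {?B} \<in> family_category N k k"
  then obtain G where G: "basis_vec {?B} = G N" "\<And>n. G n \<in> Part k k"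
    "\<And>p. polyfun (\<lambda>n. Poly_Mapping.lookup (G n) p)" "\<And>n. n \<ge> 2 \<Longrightarrow> G n \<in> rot_category n k k"
    by (rule family_categoryE) blast
  have "polyfun (\<lambda>n. test_form k i j (G n))"
    unfolding test_form_def tw_def T_vec_eq_lin_form
    by (intro polyfun_diff polyfun_sum polyfun_mult polyfun_lin_form[OF G(2,3)] polyfun_const)
  then have "test_form k i j (G N) = 0"
    by (rule polyfun_eventually_zero) (rule test_form_rot_category[OF _ G(4) ij])
  moreover have "test_form k i j (basis_vec {?B}) =
      (\<Sum>m\<in>multi_indices 2 k. 0) - (\<Sum>m\<in>multi_indices 2 k. if m = j then rots i m else 0)"
    unfolding test_form_def 1
    by (intro arg_cong2[where f="(-)"] sum.cong refl) (simp_all only: 2 mult_zero_left if_distrib[of "\<lambda>x. x * _"] mult_1_left)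
  ultimately show False using rots_ij ij unfolding G(1) by simp
qed

lemma b22_eq: "part_b22 = {{1..2} <+> {1..2}}"
proof -
  have "{1..2::nat} = {1, 2}" by auto
  then show ?thesis by (auto simp: part_b22_def Plus_def)
qed

lemma b33_eq: "part_b33 = {{1..3} <+> {1..3}}"
proof -
  have "{1..3::nat} = {1, 2, 3}" by auto
  then show ?thesis by (auto simp: part_b33_def Plus_def)
qed

text \<open>A span of basis vectors is a coordinate subspace, hence contains every basis vector in
  the support of its elements.\<close>

lemma easy_basis_vec:
  assumes "easy K" "f \<in> K k l" "p \<in> Poly_Mapping.keys f"
  shows "basis_vec p \<in> K k l"
proof -
  obtain S where S: "K k l = free_vs.span (basis_vec ` S)" using assms(1) unfolding easy_def by blast
  have "free_vs.span (basis_vec ` S) \<subseteq> {f. Poly_Mapping.keys f \<subseteq> S}"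
  proof (rule free_vs.span_minimal)
    show "free_vs.subspace {f. Poly_Mapping.keys f \<subseteq> S}"
      by (rule free_vs.subspaceI) (use keys_add keys_vscale in \<open>fastforce dest!: subsetD\<close>)+
  qed auto
  then have "p \<in> S" using assms(2,3) S by blast
  then show ?thesis unfolding S by (intro free_vs.span_base) blast
qed

lemma keys_gen1: "part_b22 \<in> Poly_Mapping.keys gen1"
proof -
  have "{Inl 1, Inr 2} \<in> part_crossing" "Inl 2 \<notin> {Inl 1, Inr 2 :: nat + nat}"
    by (auto simp: part_crossing_def)
  moreover have "Inl 2 \<in> B" if "B \<in> part_b22" for B using that by (auto simp: part_b22_def)
  ultimately have "part_crossing \<noteq> part_b22" by metis
  then show ?thesis by (simp add: in_keys_iff lookup_minus lookup_single)
qed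

lemma keys_gen2: "part_b33 \<in> Poly_Mapping.keys gen2"
proof -
  have b: "Inl 1 \<in> B \<and> Inl 2 \<in> B" if "B \<in> part_b33" for B
    using that by (auto simp: part_b33_def)
  have "{Inl 2, Inr 2} \<in> part_h" "{Inl 1, Inr 3} \<in> part_h1" "{Inl 2, Inr 2} \<in> part_h2"
    "{Inl 3, Inr 1} \<in> part_h3"
    by (auto simp: part_h_def part_h1_def part_h2_def part_h3_def)
  moreover have "\<not> (Inl 1 \<in> B \<and> Inl 2 \<in> B)"
    if "B \<in> {{Inl 2, Inr 2}, {Inl 1, Inr 3}, {Inl 3, Inr 1}}" for B :: "(nat + nat) set"
    using that by auto
  ultimately have "part_h \<noteq> part_b33" "part_h1 \<noteq> part_b33" "part_h2 \<noteq> part_b33" "part_h3 \<noteq> part_b33"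
    using b by (metis insertCI)+
  then show ?thesis by (simp add: in_keys_iff lookup_minus lookup_add lookup_single)
qed

lemma not_easy_cat_K1: "\<not> easy (cat_K1 N)"
  using easy_basis_vec[of "cat_K1 N" gen1 2 2 part_b22] gen1_in_cat_K1[of N] keys_gen1 cat_K_in_family_category(1)[of N 2 2]
    full_block_not_in_family_category[of 2 N] by (auto simp: b22_eq)

lemma not_easy_cat_K2: "\<not> easy (cat_K2 N)"
  using easy_basis_vec[of "cat_K2 N" gen2 3 3 part_b33] gen2_in_cat_K2[of N] keys_gen2 cat_K_in_family_category(2)[of N 3 3]
    full_block_not_in_family_category[of 3 N] by (auto simp: b33_eq)

theorem proposition7p10:
  fixes N :: nat and \<sigma> :: "nat \<Rightarrow> nat \<Rightarrow> complex"
  assumes "N \<ge> 1"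
    and "\<And>i j. i \<in> {1..N} \<Longrightarrow> j \<in> {1..N} \<Longrightarrow> \<sigma> i j = (if i < j then -1 else 1)"
  shows "linear_category (of_nat N) (cat_K1 N) \<and> \<not> easy (cat_K1 N)
    \<and> linear_category (of_nat N) (cat_K2 N) \<and> \<not> easy (cat_K2 N)
    \<and> (\<forall>k l. Mor (twist (Pol_O N) (cocycle N \<sigma>)) N (u_O N) k l = T_vec N k l ` cat_K1 N k l)
    \<and> (\<forall>k l. Mor (twist (Pol_O_star N) (cocycle N \<sigma>)) N (u_O_star N) k l = T_vec N k l ` cat_K2 N k l)"
proof -
  interpret O: twisted_presentation N "cat_K1 N" "O_rel N" \<sigma>
    by (rule twisted_presentation_O[OF assms])
  interpret O_star: twisted_presentation N "cat_K2 N" "O_star_rel N" \<sigma>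
    by (rule twisted_presentation_O_star[OF assms])
  have "u_O N = (\<lambda>i j. coset N (O_rel N) (u_gen i j))"
    "u_O_star N = (\<lambda>i j. coset N (O_star_rel N) (u_gen i j))"
    by (simp_all add: fun_eq_iff u_O_def u_O_star_def)
  then show ?thesis
    using O.Mor_twist O_star.Mor_twist
    by (simp add: Pol_O_def Pol_O_star_def cat_K1_linear_category cat_K2_linear_category
        not_easy_cat_K1 not_easy_cat_K2)
qed

end
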